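(* Let $L_z\ge 1$ be an integer and write $L_z=2^i\ell$ with $\ell$ odd. Let $n_{L_z}$ be the number of copies of the 2D toric code to which Haah's cubic code, compactified in the $\hat z$ direction with compactification radius $L_z$, is equivalent. Then $$ n_{L_z}=\begin{cases} 2L_z & \text{if } 3\nmid L_z,\\ 2L_z-2^{i+2} & \text{if } 3\mid L_z.\end{cases} $$
   Context: **Cubic code.** Qubits live on the cubic lattice $\mathbb Z^3$, two qubits (first and second) per site. For each $v\in\mathbb Z^3$ there are two stabilizer generators, where $e_x,e_y,e_z$ are the unit lattice vectors. - The $X$-generator at $v$ is the product of Pauli $X$ on the first qubit of the sites $v,\ v+e_x+e_y,\ v+e_y+e_z,\ v+e_z+e_x$ and Pauli $X$ on the second qubit of the sites $v,\ v+e_x,\ v+e_y,\ v+e_z$. - The $Z$-generator at $v$ is the product of Pauli $Z$ on the first qubit of the sites $v+e_x+e_y+e_z,\ v+e_x+e_y,\ v+e_y+e_z,\ v+e_z+e_x$ and Pauli $Z$ on the second qubit of the sites $v+e_x+e_y+e_z,\ v+e_x,\ v+e_y,\ v+e_z$. All generators commute, and the Hamiltonian is $\sum (1-h)$ over all generators $h$. **Compactification.** The model compactified in the $\hat z$ direction with radius $L_z$ is the same set of generators on the lattice $\mathbb Z^2\times(\mathbb Z/L_z\mathbb Z)$, i.e. periodic in $z$ with period $L_z$ (Pauli factors that coincide after this identification are multiplied), regarded as a translation-invariant 2D stabilizer model on $\mathbb Z^2$ with $2L_z$ qubits per site (all qubits in a $\hat z$ column are grouped onto one site). **Number of toric codes.**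 By a known structure theorem, a translation-invariant 2D topological CSS stabilizer Hamiltonian is equivalent, by a Clifford local unitary circuit, after coarse-graining and tensoring with qubits in a trivial product state, to a finite number of copies of the 2D toric code and a trivial product state; this number is a well-defined invariant and for the compactified cubic code it is denoted $n_{L_z}$. Equivalently, the abelian group of anyon types (topological superselection sectors: finite patterns of violated generators modulo the patterns created by finitely supported Pauli operators) has order $4^{n_{L_z}}$. *)

theory Defs
  imports "HOL-Algebra.Coset" "HOL-Library.Poly_Mapping" "HOL-Library.Z2"
    "HOL-Library.Disjoint_Sets"
begin

section \<open>Pauli operators\<close>

datatype pauli_type = PX | PZ

text \<open>
  Finitely supported Pauli operators modulo phases, on qubits labelled by \<open>'q\<close>: the
  coefficients at \<open>(q, PX)\<close> and \<open>(q, PZ)\<close> are the exponents of $X_q$ and $Z_q$. Addition is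
  the product of operators, so equal factors cancel.
\<close>

type_synonym 'q pauli = "('q \<times> pauli_type) \<Rightarrow>\<^sub>0 bit"

definition Xop :: "'q \<Rightarrow> 'q pauli" where
  "Xop q = Poly_Mapping.single (q, PX) 1"

definition Zop :: "'q \<Rightarrow> 'q pauli" where
  "Zop q = Poly_Mapping.single (q, PZ) 1"

definition paulis_on :: "'q set \<Rightarrow> 'q pauli set" where
  "paulis_on Q = {P. Poly_Mapping.keys P \<subseteq> Q \<times> UNIV}"

text \<open>The commutator form: 0 if the two operators commute, 1 if they anticommute.\<close>

definition anticomm :: "'q pauli \<Rightarrow> 'q pauli \<Rightarrow> bit" where
  "anticomm P Q = (\<Sum>q \<in> fst ` (Poly_Mapping.keys P \<union> Poly_Mapping.keys Q).
     Poly_Mapping.lookup P (q, PX) * Poly_Mapping.lookup Q (q, PZ) + Poly_Mapping.lookup P (q, PZ) * Poly_Mapping.lookup Q (q, PX))"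

text \<open>
  Relabelling of qubits. If \<open>f\<close> identifies several qubits, the factors that become
  coincident are multiplied.
\<close>

definition relabel :: "('q \<Rightarrow> 'r) \<Rightarrow> 'q pauli \<Rightarrow> 'r pauli" where
  "relabel f P = (\<Sum>(q, s) \<in> Poly_Mapping.keys P. Poly_Mapping.single (f q, s) (Poly_Mapping.lookup P (q, s)))"


section \<open>Stabilizer groups and anyon types\<close>

definition stab_group :: "'i set \<Rightarrow> ('i \<Rightarrow> 'q pauli) \<Rightarrow> 'q pauli set" where
  "stab_group I g = {\<Sum>i\<in>F. g i | F. finite F \<and> F \<subseteq> I}"

text \<open>
  Finite patterns of violated generators, as a group: a pattern has coefficient 1 at the violated
  generators.
\<close>

definition pattern_group :: "'i set \<Rightarrow> ('i \<Rightarrow>\<^sub>0 bit) monoid" where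
  "pattern_group I = \<lparr>carrier = {A. Poly_Mapping.keys A \<subseteq> I}, mult = (+), one = 0\<rparr>"

definition created_patterns :: "'q set \<Rightarrow> 'i set \<Rightarrow> ('i \<Rightarrow> 'q pauli) \<Rightarrow> ('i \<Rightarrow>\<^sub>0 bit) set" where
  "created_patterns Q I g =
     {A. Poly_Mapping.keys A \<subseteq> I \<and> (\<exists>P \<in> paulis_on Q. \<forall>i\<in>I. Poly_Mapping.lookup A i = anticomm P (g i))}"

definition anyon_group :: "'q set \<Rightarrow> 'i set \<Rightarrow> ('i \<Rightarrow> 'q pauli) \<Rightarrow> ('i \<Rightarrow>\<^sub>0 bit) set monoid" where
  "anyon_group Q I g = pattern_group I Mod created_patterns Q I g"


section \<open>Stabilizer codes on the square lattice\<close>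

type_synonym site = "int \<times> int"

text \<open>
  The qubits at each site are labelled by the set \<open>labels\<close>. A code is given by its stabilizer
  group: Hamiltonians with the same stabilizer group are identified.
\<close>

record 'k code =
  labels :: "'k set"
  stab :: "(site \<times> 'k) pauli set"

fun coarse_label :: "int \<Rightarrow> int \<Rightarrow> site \<times> 'k \<Rightarrow> site \<times> ('k \<times> int \<times> int)" where
  "coarse_label a b ((x, y), k) = ((x div a, y div b), (k, x mod a, y mod b))"

definition coarsen :: "int \<Rightarrow> int \<Rightarrow> 'k code \<Rightarrow> ('k \<times> int \<times> int) code" where
  "coarsen a b C =
     \<lparr>labels = labels C \<times> {0..<a} \<times> {0..<b}, stab = relabel (coarse_label a b) ` stab C\<rparr>"

definition tensor_code :: "'k code \<Rightarrow> 'l code \<Rightarrow> ('k + 'l) code" where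
  "tensor_code C D =
     \<lparr>labels = labels C <+> labels D,
      stab = {relabel (apsnd Inl) P + relabel (apsnd Inr) Q | P Q. P \<in> stab C \<and> Q \<in> stab D}\<rparr>"

text \<open>The product state in which each of the \<open>m\<close> qubits at each site is stabilized by $Z$.\<close>

definition trivial_code :: "nat \<Rightarrow> nat code" where
  "trivial_code m =
     \<lparr>labels = {..<m}, stab = stab_group (UNIV \<times> {..<m}) Zop\<rparr>"


section \<open>Clifford circuits and equivalence\<close>

definition bounded_block :: "int \<Rightarrow> (site \<times> 'k) set \<Rightarrow> bool" where
  "bounded_block r B \<longleftrightarrow> (\<forall>x y k x' y' k'. ((x, y), k) \<in> B \<and> ((x', y'), k') \<in> B \<longrightarrow>
     \<bar>x - x'\<bar> \<le> r \<and> \<bar>y - y'\<bar> \<le> r)"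

text \<open>
  One layer of Clifford gates of bounded range with disjoint supports (the blocks), through its
  conjugation action on Pauli operators modulo phases. On the finitely many qubits of a block,
  the actions of Clifford unitaries are exactly the additive bijections that preserve commutation.
  The gates need not be translation invariant.
\<close>

definition clifford_layer :: "'k set \<Rightarrow> ((site \<times> 'k) pauli \<Rightarrow> (site \<times> 'k) pauli) \<Rightarrow> bool" where
  "clifford_layer K F \<longleftrightarrow>
     (\<forall>P \<in> paulis_on (UNIV \<times> K). \<forall>Q \<in> paulis_on (UNIV \<times> K).
        F (P + Q) = F P + F Q \<and> anticomm (F P) (F Q) = anticomm P Q) \<and>
     (\<exists>\<B> r. partition_on (UNIV \<times> K) \<B> \<and>
        (\<forall>B\<in>\<B>. bounded_block r B \<and> bij_betw F (paulis_on B) (paulis_on B)))"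

inductive clifford_circuit :: "'k set \<Rightarrow> ((site \<times> 'k) pauli \<Rightarrow> (site \<times> 'k) pauli) \<Rightarrow> bool"
  for K where
  empty_circuit: "clifford_circuit K (\<lambda>P. P)"
| add_layer: "clifford_circuit K F \<Longrightarrow> clifford_layer K G \<Longrightarrow> clifford_circuit K (\<lambda>P. G (F P))"

text \<open>
  The bijection \<open>e\<close> matches the names of the qubits within each site.
\<close>

definition circuit_equivalent :: "'k code \<Rightarrow> 'l code \<Rightarrow> bool" where
  "circuit_equivalent C D \<longleftrightarrow>
     (\<exists>F e. clifford_circuit (labels C) F \<and> bij_betw e (labels C) (labels D) \<and>
        (\<lambda>P. relabel (apsnd e) (F P)) ` stab C = stab D)"


section \<open>Copies of the toric code\<close>

text \<open>\<open>Horiz\<close> and \<open>Vert\<close> at \<open>v\<close> are the edges from \<open>v\<close> to $v + e_x$ and to $v + e_y$.\<close>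

datatype edge = Horiz | Vert

fun toric_gen :: "site \<times> (nat \<times> pauli_type) \<Rightarrow> (site \<times> (nat \<times> edge)) pauli" where
  "toric_gen ((x, y), (c, PX)) =
     Xop ((x, y), (c, Horiz)) + Xop ((x - 1, y), (c, Horiz)) +
     Xop ((x, y), (c, Vert)) + Xop ((x, y - 1), (c, Vert))"
| "toric_gen ((x, y), (c, PZ)) =
     Zop ((x, y), (c, Horiz)) + Zop ((x, y + 1), (c, Horiz)) +
     Zop ((x, y), (c, Vert)) + Zop ((x + 1, y), (c, Vert))"

definition toric_copies :: "nat \<Rightarrow> (nat \<times> edge) code" where
  "toric_copies n =
     \<lparr>labels = {..<n} \<times> UNIV,
      stab = stab_group (UNIV \<times> ({..<n} \<times> UNIV)) toric_gen\<rparr>"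

definition equivalent_to_toric_copies :: "'k code \<Rightarrow> nat \<Rightarrow> bool" where
  "equivalent_to_toric_copies C n \<longleftrightarrow>
     (\<exists>a b p q. a > 0 \<and> b > 0 \<and>
        circuit_equivalent (tensor_code (coarsen a b C) (trivial_code p))
                           (tensor_code (toric_copies n) (trivial_code q)))"


section \<open>The cubic code and its compactification\<close>

datatype slot = First | Second

fun cubic_gen :: "pauli_type \<Rightarrow> int \<times> int \<times> int \<Rightarrow> ((int \<times> int \<times> int) \<times> slot) pauli" where
  "cubic_gen PX (x, y, z) =
     Xop ((x, y, z), First) + Xop ((x + 1, y + 1, z), First) +
     Xop ((x, y + 1, z + 1), First) + Xop ((x + 1, y, z + 1), First) +
     Xop ((x, y, z), Second) + Xop ((x + 1, y, z), Second) +
     Xop ((x, y + 1, z), Second) + Xop ((x, y, z + 1), Second)"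
| "cubic_gen PZ (x, y, z) =
     Zop ((x + 1, y + 1, z + 1), First) + Zop ((x + 1, y + 1, z), First) +
     Zop ((x, y + 1, z + 1), First) + Zop ((x + 1, y, z + 1), First) +
     Zop ((x + 1, y + 1, z + 1), Second) + Zop ((x + 1, y, z), Second) +
     Zop ((x, y + 1, z), Second) + Zop ((x, y, z + 1), Second)"

text \<open>$\mathbb{Z}/L\mathbb{Z}$ is represented by \<open>{0..<L}\<close>.\<close>

fun wrap :: "nat \<Rightarrow> (int \<times> int \<times> int) \<times> slot \<Rightarrow> site \<times> (int \<times> slot)" where
  "wrap L ((x, y, z), s) = ((x, y), (z mod int L, s))"

fun compact_gen :: "nat \<Rightarrow> site \<times> (int \<times> pauli_type) \<Rightarrow> (site \<times> (int \<times> slot)) pauli" where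
  "compact_gen L ((x, y), (z, t)) = relabel (wrap L) (cubic_gen t (x, y, z))"

definition compact_labels :: "nat \<Rightarrow> (int \<times> slot) set" where
  "compact_labels L = {0..<int L} \<times> UNIV"

definition compact_gens :: "nat \<Rightarrow> (site \<times> (int \<times> pauli_type)) set" where
  "compact_gens L = UNIV \<times> ({0..<int L} \<times> UNIV)"

definition compact_cubic_code :: "nat \<Rightarrow> (int \<times> slot) code" where
  "compact_cubic_code L =
     \<lparr>labels = compact_labels L, stab = stab_group (compact_gens L) (compact_gen L)\<rparr>"

definition compact_cubic_anyons :: "nat \<Rightarrow> ((site \<times> (int \<times> pauli_type)) \<Rightarrow>\<^sub>0 bit) set monoid" where
  "compact_cubic_anyons L =
     anyon_group (UNIV \<times> compact_labels L) (compact_gens L) (compact_gen L)"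

end

theory Submission
  imports Defs "HOL-Library.Product_Plus" "HOL-Computational_Algebra.Polynomial"
begin

text \<open>
  The anyons of a code can be described by its stabilizer group alone: they are the homomorphisms
  from the group to the field of two elements that are nonzero on only finitely many stabilizers
  of each size, modulo those induced by finitely supported Pauli operators. This quotient does not
  change under circuits of bounded depth, coarse-graining and ancillas. For translation-invariant
  independent generators it is the group of patterns of violated generators modulo created
  patterns, so it has $4^n$ elements for $n$ toric codes, and the number of toric codes can be
  read off the order of the anyon group of the cubic code.

  For the compactified cubic code this group is the square of
  $\mathbb{F}_2[x^{\pm 1}, y^{\pm 1}, z] / (1 + x + y + z, 1 + xy + yz + zx, z^L - 1)$. Eliminating
  $y$ leaves $x^2 + (1 + z) x + (1 + z + z^2) = 0$, where $xy = 1 + z + z^2$ has to be a unit. The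
  dimension is therefore twice the degree of the part of $z^L - 1$ prime to $1 + z + z^2$; for
  $L = 2^i l$ with $l$ odd the other part is $(1 + z + z^2)^{2^i}$ if $3 \mid L$ and trivial
  otherwise.
\<close>

text \<open>The equivalence moves a stabilizer group, not a list of generators, and its circuits
  need not be translation invariant, so patterns of violated generators cannot be carried through it
  directly. Finiteness of a pattern is therefore restated through the diameter of operators, which a
  circuit changes only by a bounded amount. Translation invariance and independence of generators
  enter when the sectors of the two concrete codes are counted.

  For the cubic code the patterns of X- and of Z-generators do not interact. Each type contributes
  the same quotient, with 2^(2 deg m) elements, where m is the part of z^L - 1 prime to w = 1 + z +
  z^2. The order is thus 4^(2 deg m), so n = 2 deg m. If 3 divides L, the other part w^(2^i) has
  degree 2^(i+1), hence n = 2 (L - 2^(i+1)); this is the origin of 2^(i+2).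

  The count forms no quotient ring: reduction to p + q x and evaluation at explicit values of x, y,
  z are shown to be inverse to each other, modulo the ideal on one side and modulo m on the
  other.\<close>

hide_const (open) Polynomial.order

text \<open>By default sums and products of bits are rewritten to bit operations. Removing these
  rules keeps the ring operations in place for algebraic simplification.\<close>

declare add_bit_eq_xor [simp del] mult_bit_eq_and [simp del]

section \<open>Finitely supported functions with values in the field of two elements\<close>

lemma bit_add_self [simp]: "a + a = 0" for a :: bit
  by (cases a) simp_all

lemma bit_add_eq_0_iff: "a + b = 0 \<longleftrightarrow> a = b" for a b :: bit
  by (cases a; cases b) simp_all

lemma pm_add_self [simp]: "A + A = 0" for A :: "'a \<Rightarrow>\<^sub>0 bit"
  by (rule poly_mapping_eqI) (simp add: lookup_add)

lemma pm_add_self_left [simp]: "A + (A + B) = B" for A :: "'a \<Rightarrow>\<^sub>0 bit"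
  by (simp flip: add.assoc)

lemma pm_add_eq_0_iff: "A + B = 0 \<longleftrightarrow> A = B" for A B :: "'a \<Rightarrow>\<^sub>0 bit"
  by (metis pm_add_self add.assoc add.right_neutral)

lemma pm_minus_eq_plus: "A - B = A + B" for A B :: "'a \<Rightarrow>\<^sub>0 bit"
  by (rule poly_mapping_eqI) (simp add: lookup_add lookup_minus)

lemma keys_add_subset: "Poly_Mapping.keys A \<subseteq> S \<Longrightarrow> Poly_Mapping.keys B \<subseteq> S \<Longrightarrow> Poly_Mapping.keys (A + B) \<subseteq> S"
  using keys_add[of A B] by blast

lemma keys_sum_subset: "(\<And>i. i \<in> I \<Longrightarrow> Poly_Mapping.keys (f i) \<subseteq> S) \<Longrightarrow> Poly_Mapping.keys (sum f I) \<subseteq> S"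
  by (induction I rule: infinite_finite_induct) (simp_all add: keys_add_subset)

text \<open>Adding \<open>single k 1\<close> for a key \<open>k\<close> deletes \<open>k\<close>
  from the support, because the only nonzero coefficient is 1 and 1 + 1 = 0. The induction descends
  along supports inside \<open>S\<close>.\<close>

lemma bit_pm_induct [consumes 1, case_names zero add]:
  fixes A :: "'a \<Rightarrow>\<^sub>0 bit"
  assumes "Poly_Mapping.keys A \<subseteq> S" and "P 0"
    and add: "\<And>k A. k \<in> S \<Longrightarrow> Poly_Mapping.keys A \<subseteq> S \<Longrightarrow> P A \<Longrightarrow> P (Poly_Mapping.single k 1 + A)"
  shows "P A"
proof -
  have "finite (Poly_Mapping.keys A)" by simp
  then show ?thesis using assms(1)
  proof (induction "Poly_Mapping.keys A" arbitrary: A rule: finite_psubset_induct)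
    case (psubset A)
    show ?case
    proof (cases "A = 0")
      case True
      then show ?thesis using assms(2) by simp
    next
      case False
      then obtain k where k: "k \<in> Poly_Mapping.keys A"
        by (metis ex_in_conv keys_eq_empty)
      define B where "B = Poly_Mapping.single k 1 + A"
      have A: "A = Poly_Mapping.single k 1 + B" by (simp add: B_def)
      have "Poly_Mapping.keys B \<subset> Poly_Mapping.keys A"
      proof -
        have "Poly_Mapping.lookup B j = (if j = k then 0 else Poly_Mapping.lookup A j)" for j
          using k by (auto simp: B_def lookup_add lookup_single in_keys_iff)
        then have "Poly_Mapping.keys B = Poly_Mapping.keys A - {k}"
          by (auto simp: in_keys_iff split: if_splits)
        then show ?thesis using k by auto
      qed
      with psubset.hyps(2) psubset.prems have "P B" by blast
      then show ?thesis
        unfolding A using k psubset.prems \<open>Poly_Mapping.keys B \<subset> _\<close> by (intro add) auto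
    qed
  qed
qed

lemma finite_pm_keys_subset:
  assumes "finite S" shows "finite {A :: 'a \<Rightarrow>\<^sub>0 bit. Poly_Mapping.keys A \<subseteq> S}"
proof (rule inj_on_finite[where B = "Pow S"])
  show "inj_on Poly_Mapping.keys {A :: 'a \<Rightarrow>\<^sub>0 bit. Poly_Mapping.keys A \<subseteq> S}"
  proof (rule inj_onI)
    fix A B :: "'a \<Rightarrow>\<^sub>0 bit"
    assume keys_eq: "Poly_Mapping.keys A = Poly_Mapping.keys B"
    show "A = B"
    proof (rule poly_mapping_eqI)
      fix k
      show "Poly_Mapping.lookup A k = Poly_Mapping.lookup B k"
      proof (cases "k \<in> Poly_Mapping.keys A")
        case True
        then show ?thesis using keys_eq by (metis bit_not_zero_iff in_keys_iff)
      next
        case False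
        then show ?thesis using keys_eq by (metis in_keys_iff)
      qed
    qed
  qed
qed (use assms in auto)

section \<open>Pauli operators\<close>

lemma paulis_on_iff: "P \<in> paulis_on Q \<longleftrightarrow> Poly_Mapping.keys P \<subseteq> Q \<times> UNIV"
  by (simp add: paulis_on_def)

lemma paulis_on_zero [simp]: "0 \<in> paulis_on Q"
  by (simp add: paulis_on_iff)

lemma paulis_on_add: "P \<in> paulis_on Q \<Longrightarrow> P' \<in> paulis_on Q \<Longrightarrow> P + P' \<in> paulis_on Q"
  by (simp add: paulis_on_iff keys_add_subset)

lemma paulis_on_single [simp]: "Poly_Mapping.single (q, s) 1 \<in> paulis_on Q \<longleftrightarrow> q \<in> Q"
  by (simp add: paulis_on_iff)

lemma paulis_on_mono: "Q \<subseteq> Q' \<Longrightarrow> P \<in> paulis_on Q \<Longrightarrow> P \<in> paulis_on Q'"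
  by (auto simp: paulis_on_iff)

lemma finite_UNIV_pauli_type [simp]: "finite (UNIV :: pauli_type set)"
proof -
  have "(UNIV :: pauli_type set) = {PX, PZ}" by (auto intro: pauli_type.exhaust)
  then show ?thesis by (metis finite.emptyI finite_insert)
qed

lemma finite_paulis_on: "finite Q \<Longrightarrow> finite (paulis_on Q)"
  by (simp add: paulis_on_def finite_pm_keys_subset)

lemma lookup_paulis_on_eq_0: "P \<in> paulis_on Q \<Longrightarrow> q \<notin> Q \<Longrightarrow> Poly_Mapping.lookup P (q, s) = 0"
  by (metis SigmaD1 in_keys_iff paulis_on_iff subsetD)

lemma pauli_induct [consumes 1, case_names zero add]:
  assumes "P \<in> paulis_on Q" and "R 0"
    and "\<And>q s P. q \<in> Q \<Longrightarrow> P \<in> paulis_on Q \<Longrightarrow> R P \<Longrightarrow> R (Poly_Mapping.single (q, s) 1 + P)"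
  shows "R P"
  using assms(1)[unfolded paulis_on_iff]
proof (induction rule: bit_pm_induct)
  case (add k A)
  then show ?case using assms(3)[of "fst k" A "snd k"] by (simp add: paulis_on_iff mem_Times_iff)
qed (rule assms(2))

text \<open>Summands vanish off the support of either factor, so any finite set covering the support
  of one of them may serve as range. Sums for different second arguments then share a range, which
  is what additivity requires.\<close>

lemma anticomm_eq_sum:
  assumes "finite A" "fst ` Poly_Mapping.keys P \<subseteq> A"
  shows "anticomm P Q = (\<Sum>q\<in>A. Poly_Mapping.lookup P (q, PX) * Poly_Mapping.lookup Q (q, PZ)
    + Poly_Mapping.lookup P (q, PZ) * Poly_Mapping.lookup Q (q, PX))"
proof -
  let ?f = "\<lambda>q. Poly_Mapping.lookup P (q, PX) * Poly_Mapping.lookup Q (q, PZ)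
    + Poly_Mapping.lookup P (q, PZ) * Poly_Mapping.lookup Q (q, PX)"
  have zero: "?f q = 0" if "q \<notin> fst ` Poly_Mapping.keys P" for q
  proof -
    have "Poly_Mapping.lookup P (q, s) = 0" for s
      using that by (metis fst_conv image_eqI in_keys_iff)
    then show ?thesis by simp
  qed
  have "anticomm P Q = sum ?f (fst ` Poly_Mapping.keys P)"
    unfolding anticomm_def by (rule sum.mono_neutral_right) (auto intro: zero simp: image_Un)
  also have "\<dots> = sum ?f A"
    by (rule sum.mono_neutral_left) (use assms zero in auto)
  finally show ?thesis .
qed

lemma anticomm_commute: "anticomm P Q = anticomm Q P"
  unfolding anticomm_def by (rule sum.cong) (auto simp: algebra_simps)

lemma anticomm_add_right: "anticomm P (Q + R) = anticomm P Q + anticomm P R"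
  by (simp add: anticomm_eq_sum[of "fst ` Poly_Mapping.keys P"] lookup_add algebra_simps sum.distrib)

lemma anticomm_add_left: "anticomm (Q + R) P = anticomm Q P + anticomm R P"
  by (metis anticomm_commute anticomm_add_right)

lemma anticomm_zero [simp]: "anticomm 0 P = 0" "anticomm P 0 = 0"
  by (simp_all add: anticomm_eq_sum[of "{}" 0] anticomm_eq_sum[of "fst ` Poly_Mapping.keys P" P])

lemma anticomm_single_left:
  "anticomm (Poly_Mapping.single (q, PX) 1) P = Poly_Mapping.lookup P (q, PZ)"
  "anticomm (Poly_Mapping.single (q, PZ) 1) P = Poly_Mapping.lookup P (q, PX)"
  by (simp_all add: anticomm_eq_sum[of "{q}" "Poly_Mapping.single (q, _) 1"] lookup_single)

lemma anticomm_Zop: "anticomm P (Zop q) = Poly_Mapping.lookup P (q, PX)"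
  by (simp add: Zop_def anticomm_commute[of P] anticomm_single_left)

text \<open>The commutators with X and with Z on a single qubit are the two coefficients of
  \<open>P\<close> there.\<close>

lemma anticomm_nondegenerate:
  assumes "P \<in> paulis_on Q" "\<And>P'. P' \<in> paulis_on Q \<Longrightarrow> anticomm P' P = 0"
  shows "P = 0"
proof (rule poly_mapping_eqI)
  fix k :: "'a \<times> pauli_type"
  obtain q s where k: "k = (q, s)" by force
  show "Poly_Mapping.lookup P k = Poly_Mapping.lookup 0 k"
  proof (cases "q \<in> Q")
    case True
    then show ?thesis
      using assms(2)[of "Poly_Mapping.single (q, PX) 1"] assms(2)[of "Poly_Mapping.single (q, PZ) 1"]
      by (cases s) (simp_all add: k anticomm_single_left)
  next
    case False
    then show ?thesis using assms(1) by (simp add: k lookup_paulis_on_eq_0)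
  qed
qed

lemma relabel_eq_sum:
  assumes "finite A" "Poly_Mapping.keys P \<subseteq> A"
  shows "relabel f P = (\<Sum>(q, s)\<in>A. Poly_Mapping.single (f q, s) (Poly_Mapping.lookup P (q, s)))"
  unfolding relabel_def
  by (rule sum.mono_neutral_left) (use assms in \<open>auto simp: in_keys_iff\<close>)

lemma relabel_add: "relabel f (P + Q) = relabel f P + relabel f Q"
proof -
  let ?A = "Poly_Mapping.keys P \<union> Poly_Mapping.keys Q"
  show ?thesis
    using keys_add[of P Q]
    by (simp add: relabel_eq_sum[of ?A] lookup_add single_add sum.distrib case_prod_beta)
qed

lemma relabel_zero [simp]: "relabel f 0 = 0"
  by (simp add: relabel_def)

lemma relabel_single: "relabel f (Poly_Mapping.single (q, s) 1) = Poly_Mapping.single (f q, s) 1"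
  by (simp add: relabel_def)

lemma relabel_Xop: "relabel f (Xop q) = Xop (f q)"
  and relabel_Zop: "relabel f (Zop q) = Zop (f q)"
  by (simp_all add: Xop_def Zop_def relabel_single)

lemma relabel_sum: "relabel f (sum g I) = (\<Sum>i\<in>I. relabel f (g i))"
  by (induction I rule: infinite_finite_induct) (simp_all add: relabel_add)

lemma relabel_relabel: "relabel f (relabel g P) = relabel (f \<circ> g) P"
proof -
  have "P \<in> paulis_on UNIV" by (simp add: paulis_on_iff)
  then show ?thesis
    by (induction rule: pauli_induct) (simp_all add: relabel_add relabel_single)
qed

lemma relabel_ident:
  assumes "P \<in> paulis_on Q" "\<And>q. q \<in> Q \<Longrightarrow> f q = q" shows "relabel f P = P"
  using assms(1) by (induction rule: pauli_induct) (simp_all add: relabel_add relabel_single assms(2))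

lemma relabel_paulis_on:
  assumes "P \<in> paulis_on Q" shows "relabel f P \<in> paulis_on (f ` Q)"
  using assms by (induction rule: pauli_induct) (simp_all add: relabel_add relabel_single paulis_on_add)

lemma lookup_relabel:
  assumes "P \<in> paulis_on Q" "inj_on f Q" "q \<in> Q"
  shows "Poly_Mapping.lookup (relabel f P) (f q, s) = Poly_Mapping.lookup P (q, s)"
  using assms(1)
  by (induction rule: pauli_induct)
    (auto simp add: relabel_add relabel_single lookup_add lookup_single when_def inj_on_eq_iff[OF assms(2) _ assms(3)])

lemma fst_keys_relabel:
  assumes "P \<in> paulis_on Q" "inj_on f Q"
  shows "fst ` Poly_Mapping.keys (relabel f P) = f ` fst ` Poly_Mapping.keys P"
proof
  show "f ` fst ` Poly_Mapping.keys P \<subseteq> fst ` Poly_Mapping.keys (relabel f P)"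
  proof (clarsimp)
    fix q s assume "(q, s) \<in> Poly_Mapping.keys P"
    moreover from this have "q \<in> Q" using assms(1) by (auto simp: paulis_on_iff)
    ultimately have "(f q, s) \<in> Poly_Mapping.keys (relabel f P)"
      using lookup_relabel[OF assms] by (simp add: in_keys_iff)
    then show "f q \<in> fst ` Poly_Mapping.keys (relabel f P)" by force
  qed
  have "P \<in> paulis_on (fst ` Poly_Mapping.keys P)"
    by (force simp: paulis_on_iff)
  from relabel_paulis_on[OF this, of f]
  show "fst ` Poly_Mapping.keys (relabel f P) \<subseteq> f ` fst ` Poly_Mapping.keys P"
    by (auto simp: paulis_on_iff)
qed

lemma anticomm_singles:
  "anticomm (Poly_Mapping.single (q, s) 1) (Poly_Mapping.single (q', s') 1) = of_bool (q = q' \<and> s \<noteq> s')"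
  by (cases s; cases s') (auto simp: anticomm_single_left lookup_single when_def)

lemma anticomm_relabel:
  assumes "P \<in> paulis_on Q" "P' \<in> paulis_on Q" "inj_on f Q"
  shows "anticomm (relabel f P) (relabel f P') = anticomm P P'"
  using assms(1)
proof (induction rule: pauli_induct)
  case (add q s P)
  have "anticomm (Poly_Mapping.single (f q, s) 1) (relabel f P') = anticomm (Poly_Mapping.single (q, s) 1) P'"
    using assms(2)
    by (induction rule: pauli_induct)
      (simp_all add: relabel_add relabel_single anticomm_add_right anticomm_singles inj_on_eq_iff[OF assms(3) add(1)])
  then show ?case by (simp add: relabel_add relabel_single anticomm_add_left add)
qed simp

lemma bij_betw_relabel:
  assumes "bij_betw f Q Q'" shows "bij_betw (relabel f) (paulis_on Q) (paulis_on Q')"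
proof (rule bij_betw_byWitness[where f' = "relabel (inv_into Q f)"])
  have inv: "inv_into Q f (f q) = q" if "q \<in> Q" for q
    using assms that by (simp add: bij_betw_def)
  have inv': "f (inv_into Q f q) = q" if "q \<in> Q'" for q
    using assms that by (simp add: bij_betw_def f_inv_into_f)
  show "\<forall>P\<in>paulis_on Q. relabel (inv_into Q f) (relabel f P) = P"
    by (auto simp: relabel_relabel inv intro: relabel_ident)
  show "\<forall>P\<in>paulis_on Q'. relabel f (relabel (inv_into Q f) P) = P"
    by (auto simp: relabel_relabel inv' intro: relabel_ident)
  show "relabel f ` paulis_on Q \<subseteq> paulis_on Q'"
    using relabel_paulis_on[of _ Q f] assms by (auto simp: bij_betw_def)
  show "relabel (inv_into Q f) ` paulis_on Q' \<subseteq> paulis_on Q"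
    using relabel_paulis_on[of _ Q' "inv_into Q f"] bij_betw_inv_into[OF assms] by (auto simp: bij_betw_def)
qed

section \<open>Sectors of a stabilizer group\<close>

definition diam_le :: "int \<Rightarrow> (site \<times> 'k) pauli \<Rightarrow> bool" where
  "diam_le r P \<longleftrightarrow> bounded_block r (fst ` Poly_Mapping.keys P)"

lemma diam_leI:
  assumes "\<And>u k s u' k' s'. ((u, k), s) \<in> Poly_Mapping.keys P \<Longrightarrow> ((u', k'), s') \<in> Poly_Mapping.keys P \<Longrightarrow>
    \<bar>fst u - fst u'\<bar> \<le> r \<and> \<bar>snd u - snd u'\<bar> \<le> r"
  shows "diam_le r P"
  unfolding diam_le_def bounded_block_def using assms by fastforce

lemma diam_leD:
  assumes "diam_le r P" "((u, k), s) \<in> Poly_Mapping.keys P" "((u', k'), s') \<in> Poly_Mapping.keys P"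
  shows "\<bar>fst u - fst u'\<bar> \<le> r" "\<bar>snd u - snd u'\<bar> \<le> r"
  using assms unfolding diam_le_def bounded_block_def by (metis fst_conv image_eqI prod.collapse)+

text \<open>
  Unlike a pattern of violated generators, a charge does not refer to a choice of generators.
\<close>

definition charge :: "(site \<times> 'k) pauli set \<Rightarrow> ((site \<times> 'k) pauli \<Rightarrow> bit) \<Rightarrow> bool" where
  "charge S \<phi> \<longleftrightarrow> (\<forall>P\<in>S. \<forall>Q\<in>S. \<phi> (P + Q) = \<phi> P + \<phi> Q) \<and>
     (\<forall>r. finite {P\<in>S. diam_le r P \<and> \<phi> P \<noteq> 0})"

definition same_sector :: "'k set \<Rightarrow> (site \<times> 'k) pauli set \<Rightarrow>
    ((site \<times> 'k) pauli \<Rightarrow> bit) \<Rightarrow> ((site \<times> 'k) pauli \<Rightarrow> bit) \<Rightarrow> bool" where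
  "same_sector K S \<phi> \<psi> \<longleftrightarrow> (\<exists>P\<in>paulis_on (UNIV \<times> K). \<forall>Q\<in>S. \<phi> Q + \<psi> Q = anticomm P Q)"

text \<open>A charge is a total function with arbitrary values outside \<open>S\<close>. Since
  \<open>same_sector\<close> compares on \<open>S\<close> only, its classes absorb this ambiguity
  too. Infinitely many classes would give 0, which is not a power of 4.\<close>

definition num_sectors :: "'k set \<Rightarrow> (site \<times> 'k) pauli set \<Rightarrow> nat" where
  "num_sectors K S = card ((\<lambda>\<phi>. Collect (same_sector K S \<phi>)) ` Collect (charge S))"

lemma same_sector_refl: "same_sector K S \<phi> \<phi>"
  unfolding same_sector_def by (rule bexI[of _ 0]) simp_all

lemma same_sector_sym: "same_sector K S \<phi> \<psi> \<Longrightarrow> same_sector K S \<psi> \<phi>"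
  unfolding same_sector_def by (simp add: add.commute)

lemma same_sector_trans:
  assumes "same_sector K S \<phi> \<psi>" "same_sector K S \<psi> \<chi>" shows "same_sector K S \<phi> \<chi>"
proof -
  obtain P P' where P: "P \<in> paulis_on (UNIV \<times> K)" "\<forall>Q\<in>S. \<phi> Q + \<psi> Q = anticomm P Q"
    and P': "P' \<in> paulis_on (UNIV \<times> K)" "\<forall>Q\<in>S. \<psi> Q + \<chi> Q = anticomm P' Q"
    using assms unfolding same_sector_def by blast
  have "\<phi> Q + \<chi> Q = anticomm (P + P') Q" if "Q \<in> S" for Q
  proof -
    have "\<phi> Q + \<chi> Q = (\<phi> Q + \<psi> Q) + (\<psi> Q + \<chi> Q)"
      by (cases "\<psi> Q"; cases "\<phi> Q"; cases "\<chi> Q") simp_all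
    then show ?thesis using that P(2) P'(2) by (simp add: anticomm_add_left)
  qed
  then show ?thesis unfolding same_sector_def using P(1) P'(1) by (blast intro: paulis_on_add)
qed

lemma Collect_same_sector_eq_iff:
  "Collect (same_sector K S \<phi>) = Collect (same_sector K S \<psi>) \<longleftrightarrow> same_sector K S \<phi> \<psi>"
  by (auto intro: same_sector_refl same_sector_sym same_sector_trans)

text \<open>Compares numbers of classes of objects of different types: \<open>h\<close> matches the
  kernel of \<open>f\<close> with that of \<open>g\<close>, and every class of \<open>g\<close> on
  \<open>Y\<close> is met by the image of \<open>h\<close>, so \<open>h\<close> induces a bijection
  of classes.\<close>

lemma card_image_eq_if_kernels_eq:
  assumes "h ` X \<subseteq> Y" and "\<And>x x'. x \<in> X \<Longrightarrow> x' \<in> X \<Longrightarrow> f x = f x' \<longleftrightarrow> g (h x) = g (h x')"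
    and "\<And>y. y \<in> Y \<Longrightarrow> \<exists>x\<in>X. g (h x) = g y"
  shows "card (f ` X) = card (g ` Y)"
proof -
  have "bij_betw (\<lambda>c. g (h (inv_into X f c))) (f ` X) (g ` Y)"
    unfolding bij_betw_def
  proof
    show "inj_on (\<lambda>c. g (h (inv_into X f c))) (f ` X)"
      by (rule inj_onI) (metis assms(2) f_inv_into_f inv_into_into)
    have *: "g (h (inv_into X f (f x))) = g (h x)" if "x \<in> X" for x
      using that by (metis assms(2) f_inv_into_f imageI inv_into_into)
    show "(\<lambda>c. g (h (inv_into X f c))) ` f ` X = g ` Y"
      using assms(1,3) by (auto simp: image_image *) (metis "*" imageI image_iff)
  qed
  then show ?thesis by (rule bij_betw_same_card)
qed

section \<open>Invariance under locality-preserving symplectic isomorphisms\<close>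

text \<open>Common abstraction of a circuit layer, coarse-graining and renaming of qubits. Diameters
  are controlled in both directions because charges are transported both along \<open>T\<close> and
  along its inverse.\<close>

definition pauli_iso :: "'k set \<Rightarrow> 'l set \<Rightarrow> ((site \<times> 'k) pauli \<Rightarrow> (site \<times> 'l) pauli) \<Rightarrow> bool" where
  "pauli_iso K K' T \<longleftrightarrow>
     (\<forall>P\<in>paulis_on (UNIV \<times> K). \<forall>Q\<in>paulis_on (UNIV \<times> K).
        T (P + Q) = T P + T Q \<and> anticomm (T P) (T Q) = anticomm P Q) \<and>
     bij_betw T (paulis_on (UNIV \<times> K)) (paulis_on (UNIV \<times> K')) \<and>
     (\<forall>r. \<exists>r'. \<forall>P\<in>paulis_on (UNIV \<times> K).
        (diam_le r P \<longrightarrow> diam_le r' (T P)) \<and> (diam_le r (T P) \<longrightarrow> diam_le r' P))"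

text \<open>Charges on the image are pulled back by composing with \<open>T\<close>, charges on
  \<open>S\<close> are pushed forward by its inverse; each direction keeps finiteness by one half of
  the diameter bound. Sectors match because \<open>T\<close> maps the Pauli operators onto the Pauli
  operators and keeps commutators.\<close>

lemma num_sectors_pauli_iso:
  assumes "pauli_iso K K' T" and S: "S \<subseteq> paulis_on (UNIV \<times> K)"
  shows "num_sectors K' (T ` S) = num_sectors K S"
proof -
  let ?V = "paulis_on (UNIV \<times> K)" and ?V' = "paulis_on (UNIV \<times> K')"
  have T_add: "T (P + Q) = T P + T Q" and T_anti: "anticomm (T P) (T Q) = anticomm P Q"
    if "P \<in> ?V" "Q \<in> ?V" for P Q
    using that assms(1) by (auto simp: pauli_iso_def)
  have bij: "bij_betw T ?V ?V'" using assms(1) by (simp add: pauli_iso_def)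
  then have inj: "inj_on T ?V" by (simp add: bij_betw_def)
  have bound: "\<exists>r'. \<forall>P\<in>?V. (diam_le r P \<longrightarrow> diam_le r' (T P)) \<and> (diam_le r (T P) \<longrightarrow> diam_le r' P)" for r
    using assms(1) by (simp add: pauli_iso_def)
  define T' where "T' = inv_into ?V T"
  have T'_T: "T' (T P) = P" if "P \<in> ?V" for P
    using that inj by (simp add: T'_def)
  have pull: "charge S (\<phi> \<circ> T)" if "charge (T ` S) \<phi>" for \<phi>
  proof -
    have "\<phi> (T (P + Q)) = \<phi> (T P) + \<phi> (T Q)" if "P \<in> S" "Q \<in> S" for P Q
    proof -
      have "\<phi> (T P + T Q) = \<phi> (T P) + \<phi> (T Q)"
        using \<open>charge (T ` S) \<phi>\<close> that unfolding charge_def by blast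
      moreover have "T (P + Q) = T P + T Q" using that S by (intro T_add) auto
      ultimately show ?thesis by simp
    qed
    moreover have "finite {P\<in>S. diam_le r P \<and> \<phi> (T P) \<noteq> 0}" for r
    proof -
      obtain r' where r': "\<forall>P\<in>?V. (diam_le r P \<longrightarrow> diam_le r' (T P))" using bound by blast
      have "finite {P\<in>T ` S. diam_le r' P \<and> \<phi> P \<noteq> 0}"
        using \<open>charge (T ` S) \<phi>\<close> unfolding charge_def by blast
      moreover have "T ` {P\<in>S. diam_le r P \<and> \<phi> (T P) \<noteq> 0} \<subseteq> {P\<in>T ` S. diam_le r' P \<and> \<phi> P \<noteq> 0}"
        using r' S by blast
      ultimately have "finite (T ` {P\<in>S. diam_le r P \<and> \<phi> (T P) \<noteq> 0})" by (rule rev_finite_subset)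
      then show ?thesis
        by (rule finite_imageD) (rule inj_on_subset[OF inj], use S in blast)
    qed
    ultimately show ?thesis by (simp add: charge_def)
  qed
  have push: "charge (T ` S) (\<phi> \<circ> T')" if "charge S \<phi>" for \<phi>
  proof -
    have "\<phi> (T' (T P + T Q)) = \<phi> P + \<phi> Q" if "P \<in> S" "Q \<in> S" for P Q
    proof -
      have "T' (T P + T Q) = P + Q"
        using that S T_add[of P Q] T'_T[OF paulis_on_add[of P _ Q]] by auto
      then show ?thesis using \<open>charge S \<phi>\<close> that by (simp add: charge_def)
    qed
    moreover have "finite {P\<in>T ` S. diam_le r P \<and> \<phi> (T' P) \<noteq> 0}" for r
    proof -
      obtain r' where r': "\<forall>P\<in>?V. (diam_le r (T P) \<longrightarrow> diam_le r' P)" using bound by blast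
      have "finite {P\<in>S. diam_le r' P \<and> \<phi> P \<noteq> 0}" using \<open>charge S \<phi>\<close> unfolding charge_def by blast
      moreover have "{P\<in>T ` S. diam_le r P \<and> \<phi> (T' P) \<noteq> 0} \<subseteq> T ` {P\<in>S. diam_le r' P \<and> \<phi> P \<noteq> 0}"
        using r' S T'_T by auto
      ultimately show ?thesis using finite_surj by blast
    qed
    ultimately show ?thesis using S T'_T by (auto simp: charge_def subset_iff)
  qed
  have eq: "same_sector K' (T ` S) \<phi> \<psi> \<longleftrightarrow> same_sector K S (\<phi> \<circ> T) (\<psi> \<circ> T)" for \<phi> \<psi>
  proof -
    have "same_sector K' (T ` S) \<phi> \<psi> \<longleftrightarrow>
        (\<exists>P\<in>T ` ?V. \<forall>Q\<in>S. \<phi> (T Q) + \<psi> (T Q) = anticomm P (T Q))"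
      using bij by (simp add: same_sector_def bij_betw_def)
    also have "\<dots> \<longleftrightarrow> same_sector K S (\<phi> \<circ> T) (\<psi> \<circ> T)"
      unfolding same_sector_def using S T_anti by (auto simp: subset_iff)
    finally show ?thesis .
  qed
  show ?thesis
    unfolding num_sectors_def
  proof (rule card_image_eq_if_kernels_eq[where h = "\<lambda>\<phi>. \<phi> \<circ> T"])
    show "\<exists>\<psi>\<in>Collect (charge (T ` S)). Collect (same_sector K S (\<psi> \<circ> T)) = Collect (same_sector K S \<phi>)"
      if "\<phi> \<in> Collect (charge S)" for \<phi>
    proof
      show "\<phi> \<circ> T' \<in> Collect (charge (T ` S))" using that push by simp
      have "same_sector K S (\<phi> \<circ> T' \<circ> T) \<phi>"
        unfolding same_sector_def by (rule bexI[of _ 0]) (use S T'_T in \<open>auto simp: subset_iff\<close>)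
      then show "Collect (same_sector K S (\<phi> \<circ> T' \<circ> T)) = Collect (same_sector K S \<phi>)"
        by (simp only: Collect_same_sector_eq_iff)
    qed
  qed (use pull eq in \<open>auto simp only: Collect_same_sector_eq_iff mem_Collect_eq\<close>)
qed

text \<open>A diameter is a condition on pairs of qubits, so it is enough to know how
  \<open>f\<close> distorts the distance between the sites of two qubits.\<close>

lemma pauli_iso_relabel:
  fixes f :: "site \<times> 'k \<Rightarrow> site \<times> 'l"
  assumes "bij_betw f (UNIV \<times> K) (UNIV \<times> K')"
    and bound: "\<And>r. \<exists>r'. \<forall>u k u' k'. k \<in> K \<longrightarrow> k' \<in> K \<longrightarrow>
      (\<bar>fst u - fst u'\<bar> \<le> r \<and> \<bar>snd u - snd u'\<bar> \<le> r \<longrightarrow>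
        \<bar>fst (fst (f (u, k))) - fst (fst (f (u', k')))\<bar> \<le> r' \<and>
        \<bar>snd (fst (f (u, k))) - snd (fst (f (u', k')))\<bar> \<le> r') \<and>
      (\<bar>fst (fst (f (u, k))) - fst (fst (f (u', k')))\<bar> \<le> r \<and>
        \<bar>snd (fst (f (u, k))) - snd (fst (f (u', k')))\<bar> \<le> r \<longrightarrow>
        \<bar>fst u - fst u'\<bar> \<le> r' \<and> \<bar>snd u - snd u'\<bar> \<le> r')"
  shows "pauli_iso K K' (relabel f)"
  unfolding pauli_iso_def
proof (intro conjI ballI allI)
  have inj: "inj_on f (UNIV \<times> K)" using assms(1) by (simp add: bij_betw_def)
  show "bij_betw (relabel f) (paulis_on (UNIV \<times> K)) (paulis_on (UNIV \<times> K'))"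
    by (rule bij_betw_relabel[OF assms(1)])
  show "anticomm (relabel f P) (relabel f Q) = anticomm P Q"
    if "P \<in> paulis_on (UNIV \<times> K)" "Q \<in> paulis_on (UNIV \<times> K)" for P Q
    using that inj by (rule anticomm_relabel)
  show "relabel f (P + Q) = relabel f P + relabel f Q" for P Q
    by (rule relabel_add)
  fix r
  obtain r' where r': "\<And>u k u' k'. k \<in> K \<Longrightarrow> k' \<in> K \<Longrightarrow>
      (\<bar>fst u - fst u'\<bar> \<le> r \<and> \<bar>snd u - snd u'\<bar> \<le> r \<longrightarrow>
        \<bar>fst (fst (f (u, k))) - fst (fst (f (u', k')))\<bar> \<le> r' \<and>
        \<bar>snd (fst (f (u, k))) - snd (fst (f (u', k')))\<bar> \<le> r') \<and>
      (\<bar>fst (fst (f (u, k))) - fst (fst (f (u', k')))\<bar> \<le> r \<and>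
        \<bar>snd (fst (f (u, k))) - snd (fst (f (u', k')))\<bar> \<le> r \<longrightarrow>
        \<bar>fst u - fst u'\<bar> \<le> r' \<and> \<bar>snd u - snd u'\<bar> \<le> r')"
    using bound[of r] by blast
  show "\<exists>r'. \<forall>P\<in>paulis_on (UNIV \<times> K). (diam_le r P \<longrightarrow> diam_le r' (relabel f P)) \<and>
      (diam_le r (relabel f P) \<longrightarrow> diam_le r' P)"
  proof (intro exI[of _ r'] ballI)
    fix P :: "(site \<times> 'k) pauli" assume P: "P \<in> paulis_on (UNIV \<times> K)"
    then have K: "k \<in> K" if "((u, k), s) \<in> Poly_Mapping.keys P" for u k s
      using that by (auto simp: paulis_on_iff)
    have keys: "fst ` Poly_Mapping.keys (relabel f P) = f ` fst ` Poly_Mapping.keys P"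
      by (rule fst_keys_relabel[OF P inj])
    have key: "\<exists>u k s'. ((u, k), s') \<in> Poly_Mapping.keys P \<and> q = f (u, k)"
      if "(q, s) \<in> Poly_Mapping.keys (relabel f P)" for q s
    proof -
      from that keys have "q \<in> f ` fst ` Poly_Mapping.keys P" by force
      then show ?thesis by force
    qed
    have key': "\<exists>s'. (f (u, k), s') \<in> Poly_Mapping.keys (relabel f P)"
      if "((u, k), s) \<in> Poly_Mapping.keys P" for u k s
    proof -
      have "f (u, k) \<in> f ` fst ` Poly_Mapping.keys P" using that by force
      with keys have "f (u, k) \<in> fst ` Poly_Mapping.keys (relabel f P)" by simp
      then show ?thesis by force
    qed
    have "diam_le r' (relabel f P)" if "diam_le r P"
    proof (rule diam_leI)
      fix u k s u' k' s'
      assume "((u, k), s) \<in> Poly_Mapping.keys (relabel f P)" "((u', k'), s') \<in> Poly_Mapping.keys (relabel f P)"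
      from key[OF this(1)] key[OF this(2)] obtain v l t v' l' t'
        where *: "((v, l), t) \<in> Poly_Mapping.keys P" "(u, k) = f (v, l)"
          "((v', l'), t') \<in> Poly_Mapping.keys P" "(u', k') = f (v', l')" by blast
      have u: "u = fst (f (v, l))" "u' = fst (f (v', l'))" by (metis *(2,4) fst_conv)+
      show "\<bar>fst u - fst u'\<bar> \<le> r' \<and> \<bar>snd u - snd u'\<bar> \<le> r'"
        unfolding u using r'[OF K[OF *(1)] K[OF *(3)]] diam_leD[OF that *(1,3)] by blast
    qed
    moreover have "diam_le r' P" if "diam_le r (relabel f P)"
    proof (rule diam_leI)
      fix u k s u' k' s'
      assume *: "((u, k), s) \<in> Poly_Mapping.keys P" "((u', k'), s') \<in> Poly_Mapping.keys P"
      from key'[OF *(1)] key'[OF *(2)] obtain t t'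
        where "((fst (f (u, k)), snd (f (u, k))), t) \<in> Poly_Mapping.keys (relabel f P)"
          "((fst (f (u', k')), snd (f (u', k'))), t') \<in> Poly_Mapping.keys (relabel f P)" by auto
      from diam_leD[OF that this]
      show "\<bar>fst u - fst u'\<bar> \<le> r' \<and> \<bar>snd u - snd u'\<bar> \<le> r'"
        using r'[OF K[OF *(1)] K[OF *(2)]] by blast
    qed
    ultimately show "(diam_le r P \<longrightarrow> diam_le r' (relabel f P)) \<and>
      (diam_le r (relabel f P) \<longrightarrow> diam_le r' P)" by blast
  qed
qed

lemma pauli_iso_relabel_apsnd:
  assumes "bij_betw e K K'" shows "pauli_iso K K' (relabel (apsnd e))"
proof (rule pauli_iso_relabel)
  show "bij_betw (apsnd e) (UNIV \<times> K) (UNIV \<times> K')"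
    using bij_betw_map_prod[OF bij_betw_id assms] by (simp add: apsnd_def map_prod_def id_def)
  fix r :: int
  show "\<exists>r'. \<forall>u k u' k'. k \<in> K \<longrightarrow> k' \<in> K \<longrightarrow>
      (\<bar>fst u - fst u'\<bar> \<le> r \<and> \<bar>snd u - snd u'\<bar> \<le> r \<longrightarrow>
        \<bar>fst (fst (apsnd e (u, k))) - fst (fst (apsnd e (u', k')))\<bar> \<le> r' \<and>
        \<bar>snd (fst (apsnd e (u, k))) - snd (fst (apsnd e (u', k')))\<bar> \<le> r') \<and>
      (\<bar>fst (fst (apsnd e (u, k))) - fst (fst (apsnd e (u', k')))\<bar> \<le> r \<and>
        \<bar>snd (fst (apsnd e (u, k))) - snd (fst (apsnd e (u', k')))\<bar> \<le> r \<longrightarrow>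
        \<bar>fst u - fst u'\<bar> \<le> r' \<and> \<bar>snd u - snd u'\<bar> \<le> r')"
    by (intro exI[of _ r]) simp
qed

lemma abs_div_diff_le:
  fixes x y a r :: int
  assumes "a > 0" "\<bar>x - y\<bar> \<le> r" shows "\<bar>x div a - y div a\<bar> \<le> r + 1"
proof -
  have *: "u div a - v div a \<le> r + 1" if "u - v \<le> r" "r \<ge> 0" for u v
  proof -
    have "u \<le> v + r * a"
      using that assms(1) mult_left_mono[of 1 a r] by simp
    then have "u div a \<le> (v + r * a) div a" using assms(1) by (intro zdiv_mono1) auto
    also have "\<dots> = v div a + r" using assms(1) by simp
    finally show ?thesis by simp
  qed
  show ?thesis using *[of x y] *[of y x] assms(2) by linarith
qed

text \<open>The two remainders differ by less than \<open>a\<close>, which accounts for the extra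
  multiple of \<open>a\<close>.\<close>

lemma abs_diff_le_div:
  fixes x y a r :: int
  assumes "a > 0" "\<bar>x div a - y div a\<bar> \<le> r" shows "\<bar>x - y\<bar> \<le> (r + 1) * a"
proof -
  have *: "u - v \<le> (r + 1) * a" if "u div a - v div a \<le> r" for u v
  proof -
    have "u - v = (u div a - v div a) * a + (u mod a - v mod a)"
      by (simp add: algebra_simps div_mult_mod_eq)
    also have "\<dots> \<le> r * a + a"
    proof -
      have "u mod a < a" "v mod a \<ge> 0" using assms(1) by auto
      moreover have "(u div a - v div a) * a \<le> r * a"
        using that assms(1) by (intro mult_right_mono) auto
      ultimately show ?thesis by linarith
    qed
    finally show ?thesis by (simp add: algebra_simps)
  qed
  show ?thesis using *[of x y] *[of y x] assms(2) by linarith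
qed

lemma bij_betw_coarse_label:
  assumes "a > 0" "b > 0"
  shows "bij_betw (coarse_label a b) (UNIV \<times> K) (UNIV \<times> (K \<times> {0..<a} \<times> {0..<b}))"
proof (rule bij_betw_byWitness[where f' = "\<lambda>((X, Y), (k, i, j)). ((X * a + i, Y * b + j), k)"])
qed (use assms in \<open>auto simp: div_mult_mod_eq\<close>)

lemma pauli_iso_coarsen:
  assumes "a > 0" "b > 0"
  shows "pauli_iso K (K \<times> {0..<a} \<times> {0..<b}) (relabel (coarse_label a b))"
proof (rule pauli_iso_relabel[OF bij_betw_coarse_label[OF assms]])
  fix r :: int
  \<comment> \<open>\<open>r + 1\<close> bounds cell distances by site distances; the two products
    bound site distances by cell distances in the x and the y direction.\<close>
  define r' where "r' = max (r + 1) (max ((r + 1) * a) ((r + 1) * b))"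
  show "\<exists>r'. \<forall>u k u' k'. k \<in> K \<longrightarrow> k' \<in> K \<longrightarrow>
      (\<bar>fst u - fst u'\<bar> \<le> r \<and> \<bar>snd u - snd u'\<bar> \<le> r \<longrightarrow>
        \<bar>fst (fst (coarse_label a b (u, k))) - fst (fst (coarse_label a b (u', k')))\<bar> \<le> r' \<and>
        \<bar>snd (fst (coarse_label a b (u, k))) - snd (fst (coarse_label a b (u', k')))\<bar> \<le> r') \<and>
      (\<bar>fst (fst (coarse_label a b (u, k))) - fst (fst (coarse_label a b (u', k')))\<bar> \<le> r \<and>
        \<bar>snd (fst (coarse_label a b (u, k))) - snd (fst (coarse_label a b (u', k')))\<bar> \<le> r \<longrightarrow>
        \<bar>fst u - fst u'\<bar> \<le> r' \<and> \<bar>snd u - snd u'\<bar> \<le> r')"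
    using abs_div_diff_le[OF assms(1)] abs_div_diff_le[OF assms(2)]
      abs_diff_le_div[OF assms(1)] abs_diff_le_div[OF assms(2)]
    by (intro exI[of _ r']) (simp add: r'_def le_max_iff_disj)
qed

text \<open>Each gate acts inside its block, so both \<open>F\<close> and its inverse keep operators
  within \<open>nbh P\<close>, the union of the blocks that meet the support of \<open>P\<close>.
  Blocks have bounded size, so diameters grow by a bounded amount in both directions.\<close>

lemma circuit_layer_pauli_iso:
  assumes "clifford_layer K F" shows "pauli_iso K K F"
proof -
  let ?V = "paulis_on (UNIV \<times> K) :: (site \<times> 'a) pauli set"
  obtain \<B> r0 where part: "partition_on (UNIV \<times> K) \<B>"
    and block: "\<And>B. B \<in> \<B> \<Longrightarrow> bounded_block r0 B"
    and bij: "\<And>B. B \<in> \<B> \<Longrightarrow> bij_betw F (paulis_on B) (paulis_on B)"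
    using assms unfolding clifford_layer_def by blast
  have F_add: "F (P + Q) = F P + F Q" and F_anti: "anticomm (F P) (F Q) = anticomm P Q"
    if "P \<in> ?V" "Q \<in> ?V" for P Q
    using that assms by (auto simp: clifford_layer_def)
  have F_0: "F 0 = 0"
    using F_add[of 0 0] by (metis add_cancel_right_right paulis_on_zero)
  define nbh where "nbh P = \<Union>{B\<in>\<B>. B \<inter> fst ` Poly_Mapping.keys P \<noteq> {}}" for P :: "(site \<times> 'a) pauli"
  have nbh_sub: "nbh P \<subseteq> UNIV \<times> K" for P
    using partition_onD1[OF part] by (auto simp: nbh_def)
  have support: "P \<in> paulis_on (nbh P)" if "P \<in> ?V" for P
    using that partition_onD1[OF part] by (force simp: paulis_on_iff nbh_def)
  have single: "\<exists>B\<in>\<B>. q \<in> B \<and> B \<subseteq> nbh P" if "q \<in> nbh P" for q P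
    using that by (auto simp: nbh_def)
  have image: "F Q \<in> paulis_on (nbh P)" if "Q \<in> paulis_on (nbh P)" for P Q
    using that
  proof (induction rule: pauli_induct)
    case (add q s Q)
    obtain B where B: "B \<in> \<B>" "q \<in> B" "B \<subseteq> nbh P" using single[OF add(1)] by blast
    have "F (Poly_Mapping.single (q, s) 1) \<in> paulis_on B"
      using bij[OF B(1)] B(2) by (metis bij_betwE paulis_on_single)
    moreover have "F (Poly_Mapping.single (q, s) 1 + Q) = F (Poly_Mapping.single (q, s) 1) + F Q"
      using add(1,2) nbh_sub by (intro F_add) (auto intro: paulis_on_mono)
    ultimately show ?case using add(3) B(3) by (auto intro: paulis_on_add paulis_on_mono)
  qed (simp add: F_0)
  \<comment> \<open>Global surjectivity is assembled from the blockwise bijections, one Pauli factor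
    at a time, and the preimage stays within the same blocks.\<close>
  have preimage: "\<exists>R\<in>paulis_on (nbh P). F R = Q" if "Q \<in> paulis_on (nbh P)" for P Q
    using that
  proof (induction rule: pauli_induct)
    case zero
    then show ?case using F_0 by auto
  next
    case (add q s Q)
    obtain B where B: "B \<in> \<B>" "q \<in> B" "B \<subseteq> nbh P" using single[OF add(1)] by blast
    then have "Poly_Mapping.single (q, s) 1 \<in> F ` paulis_on B"
      using bij[OF B(1)] by (simp add: bij_betw_def)
    then obtain R where R: "R \<in> paulis_on B" "F R = Poly_Mapping.single (q, s) 1" by force
    obtain R' where R': "R' \<in> paulis_on (nbh P)" "F R' = Q" using add(3) by blast
    have "R + R' \<in> paulis_on (nbh P)" using R R' B(3) by (auto intro: paulis_on_add paulis_on_mono)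
    moreover have "F (R + R') = Poly_Mapping.single (q, s) 1 + Q"
      using F_add[of R R'] R R' B(3) nbh_sub by (metis paulis_on_mono subset_trans)
    ultimately show ?case by blast
  qed
  \<comment> \<open>Injectivity across blocks comes from the commutator form: operators with the
    same image have a product that commutes with everything.\<close>
  have inj: "inj_on F ?V"
  proof (rule inj_onI)
    fix P Q assume PQ: "P \<in> ?V" "Q \<in> ?V" "F P = F Q"
    have "anticomm R (P + Q) = 0" if "R \<in> ?V" for R
    proof -
      have "anticomm (F R) (F P + F Q) = anticomm R P + anticomm R Q"
        by (simp add: anticomm_add_right F_anti that PQ(1,2))
      then show ?thesis using PQ(3) by (simp add: anticomm_add_right)
    qed
    then have "P + Q = 0" using PQ(1,2) by (intro anticomm_nondegenerate paulis_on_add) auto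
    then show "P = Q" by (simp add: pm_add_eq_0_iff)
  qed
  \<comment> \<open>Each of the two qubits compared lies within \<open>r0\<close> of the support of
    \<open>P\<close>, hence the increase by \<open>2 * r0\<close>.\<close>
  have nbh_diam: "diam_le (r + 2 * r0) Q" if "diam_le r P" "Q \<in> paulis_on (nbh P)" for P Q r
  proof (rule diam_leI)
    have near: "\<exists>v l t. ((v, l), t) \<in> Poly_Mapping.keys P \<and> \<bar>fst u - fst v\<bar> \<le> r0 \<and> \<bar>snd u - snd v\<bar> \<le> r0"
      if "((u, k), s) \<in> Poly_Mapping.keys Q" for u k s
    proof -
      have "(u, k) \<in> nbh P" using that \<open>Q \<in> paulis_on (nbh P)\<close> by (auto simp: paulis_on_iff)
      then obtain B q where B: "B \<in> \<B>" "(u, k) \<in> B" "q \<in> B" "q \<in> fst ` Poly_Mapping.keys P"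
        unfolding nbh_def by blast
      obtain v l t where q: "q = (v, l)" "((v, l), t) \<in> Poly_Mapping.keys P" using B(4) by force
      have "\<bar>fst u - fst v\<bar> \<le> r0 \<and> \<bar>snd u - snd v\<bar> \<le> r0"
        using block[OF B(1)] B(2,3) unfolding bounded_block_def q(1) by (metis prod.collapse)
      then show ?thesis using q(2) by blast
    qed
    fix u k s u' k' s'
    assume "((u, k), s) \<in> Poly_Mapping.keys Q" "((u', k'), s') \<in> Poly_Mapping.keys Q"
    from near[OF this(1)] near[OF this(2)] diam_leD[OF that(1)]
    show "\<bar>fst u - fst u'\<bar> \<le> r + 2 * r0 \<and> \<bar>snd u - snd u'\<bar> \<le> r + 2 * r0"
      by (smt (verit, best))
  qed
  have F_V: "F P \<in> ?V" if "P \<in> ?V" for P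
    by (rule paulis_on_mono[OF nbh_sub image[OF support[OF that]]])
  show ?thesis
    unfolding pauli_iso_def
  proof (intro conjI ballI allI)
    have "?V \<subseteq> F ` ?V"
    proof
      fix P assume "P \<in> ?V"
      then obtain R where "R \<in> paulis_on (nbh P)" "F R = P" using preimage[OF support] by blast
      then show "P \<in> F ` ?V" using paulis_on_mono[OF nbh_sub] by blast
    qed
    then show "bij_betw F ?V ?V" using inj F_V by (auto simp: bij_betw_def)
    fix r :: int
    show "\<exists>r'. \<forall>P\<in>?V. (diam_le r P \<longrightarrow> diam_le r' (F P)) \<and> (diam_le r (F P) \<longrightarrow> diam_le r' P)"
    proof (intro exI[of _ "r + 2 * r0"] ballI conjI impI)
      fix P assume P: "P \<in> ?V"
      show "diam_le (r + 2 * r0) (F P)" if "diam_le r P"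
        using that image[OF support[OF P]] by (rule nbh_diam)
      show "diam_le (r + 2 * r0) P" if r: "diam_le r (F P)"
      proof -
        obtain R where R: "R \<in> paulis_on (nbh (F P))" "F R = F P"
          using preimage[OF support[OF F_V[OF P]]] by blast
        then have "R = P" using inj_onD[OF inj R(2)] P paulis_on_mono[OF nbh_sub R(1)] by blast
        then show ?thesis using nbh_diam[OF r R(1)] by simp
      qed
    qed
  qed (auto simp: F_add F_anti)
qed

lemma num_sectors_clifford_circuit:
  assumes "clifford_circuit K F" "S \<subseteq> paulis_on (UNIV \<times> K)"
  shows "F ` S \<subseteq> paulis_on (UNIV \<times> K) \<and> num_sectors K (F ` S) = num_sectors K S"
  using assms(1)
proof induction
  case (add_layer F G)
  have iso: "pauli_iso K K G" using add_layer(2) by (rule circuit_layer_pauli_iso)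
  have "(\<lambda>P. G (F P)) ` S = G ` F ` S" by auto
  moreover have "G ` F ` S \<subseteq> paulis_on (UNIV \<times> K)"
    using add_layer(3) iso unfolding pauli_iso_def bij_betw_def by blast
  ultimately show ?case using add_layer(3) num_sectors_pauli_iso[OF iso] by metis
qed (use assms(2) in simp)

lemma num_sectors_circuit_equivalent:
  assumes "circuit_equivalent C D" "stab C \<subseteq> paulis_on (UNIV \<times> labels C)"
  shows "num_sectors (labels D) (stab D) = num_sectors (labels C) (stab C)"
proof -
  obtain F e where F: "clifford_circuit (labels C) F" and e: "bij_betw e (labels C) (labels D)"
    and D: "(\<lambda>P. relabel (apsnd e) (F P)) ` stab C = stab D"
    using assms(1) unfolding circuit_equivalent_def by blast
  note F' = num_sectors_clifford_circuit[OF F assms(2)]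
  have "stab D = relabel (apsnd e) ` F ` stab C" unfolding D[symmetric] image_image ..
  then show ?thesis
    using num_sectors_pauli_iso[OF pauli_iso_relabel_apsnd[OF e]] F' by metis
qed

lemma num_sectors_coarsen:
  assumes "a > 0" "b > 0" "stab C \<subseteq> paulis_on (UNIV \<times> labels C)"
  shows "num_sectors (labels (coarsen a b C)) (stab (coarsen a b C)) = num_sectors (labels C) (stab C)"
  unfolding coarsen_def
  using num_sectors_pauli_iso[OF pauli_iso_coarsen[OF assms(1,2)] assms(3)] by simp

lemma stab_coarsen_subset:
  assumes "a > 0" "b > 0" "stab C \<subseteq> paulis_on (UNIV \<times> labels C)"
  shows "stab (coarsen a b C) \<subseteq> paulis_on (UNIV \<times> labels (coarsen a b C))"
  using bij_betw_relabel[OF bij_betw_coarse_label[OF assms(1,2), of "labels C"]] assms(3)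
  unfolding coarsen_def bij_betw_def by auto

section \<open>Ancillary qubits in a product state\<close>

text \<open>Every element is its own inverse, so closure under addition suffices.\<close>

definition additive_subgroup :: "('a \<Rightarrow>\<^sub>0 bit) set \<Rightarrow> bool" where
  "additive_subgroup S \<longleftrightarrow> 0 \<in> S \<and> (\<forall>P\<in>S. \<forall>Q\<in>S. P + Q \<in> S)"

text \<open>The linear extension of \<open>g\<close> over the field of two elements. Besides
  products of generators it provides the maps between patterns, Laurent polynomials and toric
  charges.\<close>

definition combine :: "('i \<Rightarrow> ('b \<Rightarrow>\<^sub>0 bit)) \<Rightarrow> ('i \<Rightarrow>\<^sub>0 bit) \<Rightarrow> ('b \<Rightarrow>\<^sub>0 bit)" where
  "combine g B = (\<Sum>i\<in>Poly_Mapping.keys B. g i)"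

lemma stab_group_eq_combine: "stab_group I g = combine g ` {B. Poly_Mapping.keys B \<subseteq> I}"
proof (rule subset_antisym; rule subsetI)
  fix P assume "P \<in> stab_group I g"
  then obtain F where F: "finite F" "F \<subseteq> I" "P = (\<Sum>i\<in>F. g i)" by (auto simp: stab_group_def)
  define B :: "_ \<Rightarrow>\<^sub>0 bit" where "B = (\<Sum>i\<in>F. Poly_Mapping.single i 1)"
  have "Poly_Mapping.lookup B i = of_bool (i \<in> F)" for i
    using F(1) by (simp add: B_def lookup_sum lookup_single when_def)
  then have "Poly_Mapping.keys B = F" by (auto simp: in_keys_iff)
  then show "P \<in> combine g ` {B. Poly_Mapping.keys B \<subseteq> I}"
    using F by (auto simp: combine_def intro!: image_eqI[of _ _ B])
next
  fix P assume "P \<in> combine g ` {B. Poly_Mapping.keys B \<subseteq> I}"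
  then show "P \<in> stab_group I g" by (auto simp: stab_group_def combine_def)
qed

lemma lookup_combine:
  assumes "finite A" "Poly_Mapping.keys B \<subseteq> A"
  shows "Poly_Mapping.lookup (combine g B) k = (\<Sum>i\<in>A. Poly_Mapping.lookup B i * Poly_Mapping.lookup (g i) k)"
proof -
  have "Poly_Mapping.lookup (combine g B) k =
      (\<Sum>i\<in>Poly_Mapping.keys B. Poly_Mapping.lookup B i * Poly_Mapping.lookup (g i) k)"
    unfolding combine_def lookup_sum by (rule sum.cong) (simp_all add: in_keys_iff)
  also have "\<dots> = (\<Sum>i\<in>A. Poly_Mapping.lookup B i * Poly_Mapping.lookup (g i) k)"
    by (rule sum.mono_neutral_left) (use assms in \<open>auto simp: in_keys_iff\<close>)
  finally show ?thesis .
qed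

lemma combine_add: "combine g (A + B) = combine g A + combine g B"
proof (rule poly_mapping_eqI)
  fix k
  let ?A = "Poly_Mapping.keys A \<union> Poly_Mapping.keys B"
  show "Poly_Mapping.lookup (combine g (A + B)) k = Poly_Mapping.lookup (combine g A + combine g B) k"
    using keys_add[of A B]
    by (simp add: lookup_combine[of ?A] lookup_add algebra_simps sum.distrib)
qed

lemma combine_zero [simp]: "combine g 0 = 0"
  by (simp add: combine_def)

lemma combine_single [simp]: "combine g (Poly_Mapping.single i 1) = g i"
  by (simp add: combine_def)

lemma additive_subgroup_stab_group: "additive_subgroup (stab_group I g)"
  unfolding additive_subgroup_def stab_group_eq_combine
proof (intro conjI ballI)
  show "0 \<in> combine g ` {B. Poly_Mapping.keys B \<subseteq> I}"
    by (rule image_eqI[of _ _ 0]) simp_all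
  fix P Q assume "P \<in> combine g ` {B. Poly_Mapping.keys B \<subseteq> I}" "Q \<in> combine g ` {B. Poly_Mapping.keys B \<subseteq> I}"
  then obtain A B where "P = combine g A" "Q = combine g B"
    and "Poly_Mapping.keys A \<subseteq> I" "Poly_Mapping.keys B \<subseteq> I" by blast
  then show "P + Q \<in> combine g ` {B. Poly_Mapping.keys B \<subseteq> I}"
    by (intro image_eqI[of _ _ "A + B"]) (simp_all add: combine_add keys_add_subset)
qed

lemma stab_group_subset:
  assumes "\<And>i. i \<in> I \<Longrightarrow> g i \<in> paulis_on Q" shows "stab_group I g \<subseteq> paulis_on Q"
proof
  fix P assume "P \<in> stab_group I g"
  then obtain F where F: "F \<subseteq> I" "P = (\<Sum>i\<in>F. g i)" by (auto simp: stab_group_def)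
  show "P \<in> paulis_on Q"
    unfolding paulis_on_iff F(2) by (rule keys_sum_subset) (use F(1) assms in \<open>auto simp: paulis_on_iff\<close>)
qed

lemma generator_in_stab_group: "i \<in> I \<Longrightarrow> g i \<in> stab_group I g"
  unfolding stab_group_eq_combine by (rule image_eqI[of _ _ "Poly_Mapping.single i 1"]) simp_all

lemma combine_sum: "combine g (sum f I) = (\<Sum>i\<in>I. combine g (f i))"
  by (induction I rule: infinite_finite_induct) (simp_all add: combine_add)

lemma finite_sites_near: "finite {v :: site. \<bar>fst v - a\<bar> \<le> r \<and> \<bar>snd v - b\<bar> \<le> r}"
  by (rule finite_subset[of _ "{a - r..a + r} \<times> {b - r..b + r}"]) auto

lemma paulis_on_UNIV: "P \<in> paulis_on UNIV"
  by (simp add: paulis_on_iff)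

lemma inj_apsnd: "inj f \<Longrightarrow> inj (apsnd f)"
  by (auto simp: inj_def)

text \<open>Restriction along \<open>L\<close> forgets the ancillas. It merges no sectors: the
  ancilla stabilizers Z have diameter 0, so two charges differ on finitely many of them, and a
  finite product of X operators accounts for the difference. It is onto because a charge extends by
  0 to the ancillas.\<close>

lemma num_sectors_tensor_trivial:
  fixes C :: "'k code"
  assumes S: "stab C \<subseteq> paulis_on (UNIV \<times> labels C)" "additive_subgroup (stab C)"
  shows "num_sectors (labels (tensor_code C (trivial_code p))) (stab (tensor_code C (trivial_code p))) =
    num_sectors (labels C) (stab C)"
proof -
  define K S T where "K = labels C" and "S = stab C" and "T = stab (trivial_code p)"
  define L :: "(site \<times> 'k) pauli \<Rightarrow> (site \<times> ('k + nat)) pauli" where "L = relabel (apsnd Inl)"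
  define R :: "(site \<times> nat) pauli \<Rightarrow> (site \<times> ('k + nat)) pauli" where "R = relabel (apsnd Inr)"
  define K' where "K' = K <+> {..<p}"
  define S' where "S' = {L P + R Q | P Q. P \<in> S \<and> Q \<in> T}"
  have tensor: "labels (tensor_code C (trivial_code p)) = K'" "stab (tensor_code C (trivial_code p)) = S'"
    by (simp_all add: tensor_code_def K'_def S'_def K_def S_def T_def L_def R_def trivial_code_def)
  have S_V: "S \<subseteq> paulis_on (UNIV \<times> K)" and S0: "0 \<in> S"
    and S_add: "\<And>P Q. P \<in> S \<Longrightarrow> Q \<in> S \<Longrightarrow> P + Q \<in> S"
    using S by (auto simp: S_def K_def additive_subgroup_def)
  have T: "T = stab_group (UNIV \<times> {..<p}) Zop" by (simp add: T_def trivial_code_def)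
  have T0: "0 \<in> T" and T_add: "\<And>P Q. P \<in> T \<Longrightarrow> Q \<in> T \<Longrightarrow> P + Q \<in> T"
    using additive_subgroup_stab_group[of "UNIV \<times> {..<p}" "Zop :: site \<times> nat \<Rightarrow> _"]
    by (auto simp: T additive_subgroup_def)
  have T_V: "T \<subseteq> paulis_on (UNIV \<times> {..<p})"
    unfolding T by (rule stab_group_subset) (simp add: Zop_def mem_Times_iff)
  have [simp]: "L 0 = 0" "R 0 = 0" by (simp_all add: L_def R_def)
  have L_add: "L (P + Q) = L P + L Q" and R_add: "R (P' + Q') = R P' + R Q'" for P Q P' Q'
    by (simp_all add: L_def R_def relabel_add)
  have inj_L: "inj (apsnd Inl :: site \<times> 'k \<Rightarrow> site \<times> ('k + nat))"
    and inj_R: "inj (apsnd Inr :: site \<times> nat \<Rightarrow> site \<times> ('k + nat))"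
    by (simp_all add: inj_apsnd)
  have lookup_L: "Poly_Mapping.lookup (L P) ((u, Inl k), s) = Poly_Mapping.lookup P ((u, k), s)"
    and lookup_L0: "Poly_Mapping.lookup (L P) ((u, Inr k'), s) = 0" for P u k k' s
    using lookup_relabel[OF paulis_on_UNIV inj_L, where P = P and q = "(u, k)" and s = s]
      lookup_paulis_on_eq_0[OF relabel_paulis_on[OF paulis_on_UNIV, where f = "apsnd Inl"],
        where P1 = P and q = "(u, Inr k')" and s = s]
    by (auto simp: L_def image_iff split_paired_Ex)
  have lookup_R: "Poly_Mapping.lookup (R P) ((u, Inr k), s) = Poly_Mapping.lookup P ((u, k), s)"
    and lookup_R0: "Poly_Mapping.lookup (R P) ((u, Inl k'), s) = 0" for P u k k' s
    using lookup_relabel[OF paulis_on_UNIV inj_R, where P = P and q = "(u, k)" and s = s]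
      lookup_paulis_on_eq_0[OF relabel_paulis_on[OF paulis_on_UNIV, where f = "apsnd Inr"],
        where P1 = P and q = "(u, Inl k')" and s = s]
    by (auto simp: R_def image_iff split_paired_Ex)
  have keys_L: "((u, Inl k), s) \<in> Poly_Mapping.keys (L P + R Q) \<longleftrightarrow> ((u, k), s) \<in> Poly_Mapping.keys P"
    and keys_R: "((u, Inr k'), s) \<in> Poly_Mapping.keys (L P + R Q) \<longleftrightarrow> ((u, k'), s) \<in> Poly_Mapping.keys Q"
    for P Q u k k' s
    by (simp_all add: in_keys_iff lookup_add lookup_L lookup_R lookup_L0 lookup_R0)
  have diam_L: "diam_le r P" if "diam_le r (L P + R Q)" for r P Q
  proof (rule diam_leI)
    fix u k s u' k' s'
    assume "((u, k), s) \<in> Poly_Mapping.keys P" "((u', k'), s') \<in> Poly_Mapping.keys P"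
    then have "((u, Inl k), s) \<in> Poly_Mapping.keys (L P + R Q)"
      "((u', Inl k'), s') \<in> Poly_Mapping.keys (L P + R Q)" by (simp_all add: keys_L)
    from diam_leD[OF that this] show "\<bar>fst u - fst u'\<bar> \<le> r \<and> \<bar>snd u - snd u'\<bar> \<le> r" by simp
  qed
  have diam_L': "diam_le r (L P)" if "diam_le r P" for r P
  proof (rule diam_leI)
    fix u k s u' k' s'
    assume *: "((u, k), s) \<in> Poly_Mapping.keys (L P)" "((u', k'), s') \<in> Poly_Mapping.keys (L P)"
    then obtain l l' where "k = Inl l" "k' = Inl l'"
      by (cases k; cases k') (auto simp: in_keys_iff lookup_L0)
    then show "\<bar>fst u - fst u'\<bar> \<le> r \<and> \<bar>snd u - snd u'\<bar> \<le> r"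
      using * diam_leD[OF that] keys_L[of _ _ _ P 0] by simp
  qed
  have anti_L: "anticomm (L P) (L P') = anticomm P P'" and anti_R: "anticomm (R Q) (R Q') = anticomm Q Q'"
    for P P' Q Q'
    unfolding L_def R_def using anticomm_relabel[OF paulis_on_UNIV paulis_on_UNIV inj_L] anticomm_relabel[OF paulis_on_UNIV paulis_on_UNIV inj_R] by auto
  have anti_LR: "anticomm (L P) (R Q) = 0" for P Q
    unfolding anticomm_def
  proof (rule sum.neutral, rule ballI)
    fix q :: "site \<times> ('k + nat)"
    obtain u k where "q = (u, k)" by (rule prod.exhaust)
    then show "Poly_Mapping.lookup (L P) (q, PX) * Poly_Mapping.lookup (R Q) (q, PZ) +
        Poly_Mapping.lookup (L P) (q, PZ) * Poly_Mapping.lookup (R Q) (q, PX) = 0"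
      by (cases k) (simp_all add: lookup_L0 lookup_R0)
  qed
  have anti_sum: "anticomm (L P + R Q) (L P' + R Q') = anticomm P P' + anticomm Q Q'" for P Q P' Q'
    by (simp add: anticomm_add_left anticomm_add_right anti_L anti_R anti_LR anticomm_commute[of "R _" "L _"])
  have L_S': "L P \<in> S'" if "P \<in> S" for P
    using that T0 unfolding S'_def by (metis (mono_tags, lifting) \<open>R 0 = 0\<close> add.right_neutral mem_Collect_eq)
  have R_S': "R Q \<in> S'" if "Q \<in> T" for Q
    using that S0 unfolding S'_def by (metis (mono_tags, lifting) \<open>L 0 = 0\<close> add.left_neutral mem_Collect_eq)
  have decompose: "\<exists>P Q. P \<in> paulis_on (UNIV \<times> K) \<and> Q \<in> paulis_on (UNIV \<times> {..<p}) \<and> P' = L P + R Q"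
    if "P' \<in> paulis_on (UNIV \<times> K')" for P'
    using that
  proof (induction rule: pauli_induct)
    case zero
    have "0 = L 0 + R 0" by simp
    then show ?case using paulis_on_zero by metis
  next
    case (add q s P')
    then obtain P Q where PQ: "P \<in> paulis_on (UNIV \<times> K)" "Q \<in> paulis_on (UNIV \<times> {..<p})" "P' = L P + R Q"
      by blast
    obtain u k where q: "q = (u, k)" by (rule prod.exhaust)
    show ?case
    proof (cases k)
      case (Inl l)
      then have l: "l \<in> K" using add(1) by (auto simp: q K'_def)
      have "Poly_Mapping.single (q, s) 1 + P' = L (Poly_Mapping.single ((u, l), s) 1 + P) + R Q"
        by (simp add: PQ L_add q Inl) (simp add: L_def relabel_single add.assoc)
      moreover have "Poly_Mapping.single ((u, l), s) 1 + P \<in> paulis_on (UNIV \<times> K)"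
        using PQ(1) l by (intro paulis_on_add) simp_all
      ultimately show ?thesis using PQ(2) by blast
    next
      case (Inr l)
      then have l: "l < p" using add(1) by (auto simp: q K'_def)
      have "Poly_Mapping.single (q, s) 1 + P' = L P + R (Poly_Mapping.single ((u, l), s) 1 + Q)"
        by (simp add: PQ R_add q Inr) (simp add: R_def relabel_single add.left_commute)
      moreover have "Poly_Mapping.single ((u, l), s) 1 + Q \<in> paulis_on (UNIV \<times> {..<p})"
        using PQ(2) l by (intro paulis_on_add) simp_all
      ultimately show ?thesis using PQ(1) by blast
    qed
  qed
  have L_V: "L P \<in> paulis_on (UNIV \<times> K')" if "P \<in> paulis_on (UNIV \<times> K)" for P
    unfolding L_def by (rule paulis_on_mono[OF _ relabel_paulis_on[OF that]]) (auto simp: K'_def)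
  have R_V: "R Q \<in> paulis_on (UNIV \<times> K')" if "Q \<in> paulis_on (UNIV \<times> {..<p})" for Q
    unfolding R_def by (rule paulis_on_mono[OF _ relabel_paulis_on[OF that]]) (auto simp: K'_def)
  have charge_split: "\<phi> (L P + R Q) = \<phi> (L P) + \<phi> (R Q)" if "charge S' \<phi>" "P \<in> S" "Q \<in> T" for \<phi> P Q
    using that L_S' R_S' by (simp add: charge_def)
  have pull: "charge S (\<phi> \<circ> L)" if \<phi>: "charge S' \<phi>" for \<phi>
  proof -
    have "\<phi> (L (P + Q)) = \<phi> (L P) + \<phi> (L Q)" if "P \<in> S" "Q \<in> S" for P Q
      using \<phi> L_S'[OF that(1)] L_S'[OF that(2)] unfolding charge_def L_add by blast
    moreover have "finite {P\<in>S. diam_le r P \<and> \<phi> (L P) \<noteq> 0}" for r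
    proof -
      have "finite {P\<in>S'. diam_le r P \<and> \<phi> P \<noteq> 0}" using \<phi> unfolding charge_def by blast
      moreover have "L ` {P\<in>S. diam_le r P \<and> \<phi> (L P) \<noteq> 0} \<subseteq> {P\<in>S'. diam_le r P \<and> \<phi> P \<noteq> 0}"
        using L_S' diam_L' by blast
      ultimately have "finite (L ` {P\<in>S. diam_le r P \<and> \<phi> (L P) \<noteq> 0})" by (rule rev_finite_subset)
      moreover have "inj L"
      proof (rule injI, rule poly_mapping_eqI)
        fix P Q k assume "L P = L Q"
        then show "Poly_Mapping.lookup P k = Poly_Mapping.lookup Q k"
          by (metis lookup_L prod.collapse)
      qed
      ultimately show ?thesis by (meson finite_imageD inj_on_subset subset_UNIV)
    qed
    ultimately show ?thesis by (simp add: charge_def)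
  qed
  have sector: "same_sector K' S' \<phi> \<psi> \<longleftrightarrow> same_sector K S (\<phi> \<circ> L) (\<psi> \<circ> L)"
    if \<phi>: "charge S' \<phi>" and \<psi>: "charge S' \<psi>" for \<phi> \<psi>
  proof
    assume "same_sector K' S' \<phi> \<psi>"
    then obtain P' where P': "P' \<in> paulis_on (UNIV \<times> K')" "\<And>Q. Q \<in> S' \<Longrightarrow> \<phi> Q + \<psi> Q = anticomm P' Q"
      unfolding same_sector_def by blast
    obtain P Q where PQ: "P \<in> paulis_on (UNIV \<times> K)" "P' = L P + R Q" using decompose[OF P'(1)] by blast
    have "\<phi> (L N) + \<psi> (L N) = anticomm P N" if "N \<in> S" for N
      using P'(2)[OF L_S'[OF that]] anti_sum[of P Q N 0] by (simp add: PQ)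
    then show "same_sector K S (\<phi> \<circ> L) (\<psi> \<circ> L)" using PQ(1) by (auto simp: same_sector_def)
  next
    assume "same_sector K S (\<phi> \<circ> L) (\<psi> \<circ> L)"
    then obtain P where P: "P \<in> paulis_on (UNIV \<times> K)" "\<And>N. N \<in> S \<Longrightarrow> \<phi> (L N) + \<psi> (L N) = anticomm P N"
      unfolding same_sector_def by auto
    define D where "D = {q \<in> UNIV \<times> {..<p}. \<phi> (R (Zop q)) + \<psi> (R (Zop q)) \<noteq> 0}"
    have RZ: "R (Zop (u, k)) = Zop (u, Inr k)" for u k by (simp add: R_def relabel_Zop)
    have Z_T: "Zop q \<in> T" if "q \<in> UNIV \<times> {..<p}" for q
      unfolding T using that by (rule generator_in_stab_group)
    have "finite D"
    proof (rule finite_imageD)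
      have "(\<lambda>q. R (Zop q)) ` D \<subseteq>
          {P\<in>S'. diam_le 0 P \<and> \<phi> P \<noteq> 0} \<union> {P\<in>S'. diam_le 0 P \<and> \<psi> P \<noteq> 0}"
      proof (rule image_subsetI)
        fix q assume q: "q \<in> D"
        have "diam_le 0 (R (Zop q))" by (cases q) (simp add: RZ, auto simp: Zop_def intro!: diam_leI)
        moreover have "R (Zop q) \<in> S'" using q by (intro R_S' Z_T) (simp add: D_def)
        ultimately show "R (Zop q) \<in> {P\<in>S'. diam_le 0 P \<and> \<phi> P \<noteq> 0} \<union> {P\<in>S'. diam_le 0 P \<and> \<psi> P \<noteq> 0}"
          using q by (auto simp: D_def)
      qed
      moreover have "finite ({P\<in>S'. diam_le 0 P \<and> \<phi> P \<noteq> 0} \<union> {P\<in>S'. diam_le 0 P \<and> \<psi> P \<noteq> 0})"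
        using \<phi> \<psi> unfolding charge_def by blast
      ultimately show "finite ((\<lambda>q. R (Zop q)) ` D)" by (rule finite_subset)
      show "inj_on (\<lambda>q. R (Zop q)) D"
      proof (rule inj_onI)
        fix q q' assume "R (Zop q) = R (Zop q')"
        then show "q = q'"
          by (cases q; cases q') (simp add: RZ, auto simp: Zop_def dest!: arg_cong[of _ _ Poly_Mapping.keys])
      qed
    qed
    \<comment> \<open>Anticommutes with exactly the Z stabilizers of the ancillas in
      \<open>D\<close>, those on which the two charges differ.\<close>
    define X where "X = (\<Sum>q\<in>D. Xop q)"
    have X_V: "X \<in> paulis_on (UNIV \<times> {..<p})"
      unfolding X_def paulis_on_iff by (rule keys_sum_subset) (auto simp: D_def Xop_def)
    have X_Z: "anticomm X (Zop q) = \<phi> (R (Zop q)) + \<psi> (R (Zop q))" if "q \<in> UNIV \<times> {..<p}" for q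
    proof -
      have "anticomm X (Zop q) = of_bool (q \<in> D)"
        using \<open>finite D\<close> by (simp add: anticomm_Zop X_def lookup_sum Xop_def lookup_single when_def)
      then show ?thesis using that by (auto simp: D_def)
    qed
    have X_T: "anticomm X Q = \<phi> (R Q) + \<psi> (R Q)" if "Q \<in> T" for Q
    proof -
      obtain B where B: "Poly_Mapping.keys B \<subseteq> UNIV \<times> {..<p}" "Q = combine Zop B"
        using \<open>Q \<in> T\<close> unfolding T stab_group_eq_combine by blast
      have "combine Zop B \<in> T \<and> anticomm X (combine Zop B) = \<phi> (R (combine Zop B)) + \<psi> (R (combine Zop B))"
        using B(1)
      proof (induction rule: bit_pm_induct)
        case zero
        have "\<phi> 0 = 0" "\<psi> 0 = 0"
          using charge_split[OF \<phi> S0 T0] charge_split[OF \<psi> S0 T0] by simp_all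
        then show ?case using T0 by simp
      next
        case (add q B)
        have "\<chi> (R (Zop q + combine Zop B)) = \<chi> (R (Zop q)) + \<chi> (R (combine Zop B))"
          if "charge S' \<chi>" for \<chi>
          using that R_S'[OF Z_T[OF add(1)]] R_S'[OF conjunct1[OF add(3)]] unfolding charge_def R_add by blast
        from this[OF \<phi>] this[OF \<psi>] show ?case
          using add(3) X_Z[OF add(1)] T_add[OF Z_T[OF add(1)] conjunct1[OF add(3)]]
          by (simp add: combine_add anticomm_add_right add.assoc add.left_commute)
      qed
      then show ?thesis using B(2) by simp
    qed
    have "\<phi> Q' + \<psi> Q' = anticomm (L P + R X) Q'" if "Q' \<in> S'" for Q'
    proof -
      obtain N Q where NQ: "N \<in> S" "Q \<in> T" "Q' = L N + R Q" using \<open>Q' \<in> S'\<close> by (auto simp: S'_def)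
      have "\<phi> Q' + \<psi> Q' = (\<phi> (L N) + \<psi> (L N)) + (\<phi> (R Q) + \<psi> (R Q))"
        unfolding NQ(3) charge_split[OF \<phi> NQ(1,2)] charge_split[OF \<psi> NQ(1,2)] by (simp only: ac_simps)
      also have "\<dots> = anticomm (L P + R X) Q'"
        unfolding NQ(3) anti_sum P(2)[OF NQ(1)] X_T[OF NQ(2)] ..
      finally show ?thesis .
    qed
    moreover have "L P + R X \<in> paulis_on (UNIV \<times> K')"
      by (intro paulis_on_add L_V R_V P(1) X_V)
    ultimately show "same_sector K' S' \<phi> \<psi>" unfolding same_sector_def by blast
  qed
  have extend: "\<exists>\<psi>. charge S' \<psi> \<and> (\<forall>P. \<psi> (L P) = \<phi> P)" if \<phi>: "charge S \<phi>" for \<phi>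
  proof -
    \<comment> \<open>\<open>pr\<close> drops the ancilla factor, so
      \<open>\<phi> \<circ> pr\<close> is the extension of the charge by 0.\<close>
    define pr :: "(site \<times> ('k + nat)) pauli \<Rightarrow> (site \<times> 'k) pauli"
      where "pr P' = (THE P. \<forall>u k s. Poly_Mapping.lookup P ((u, k), s) = Poly_Mapping.lookup P' ((u, Inl k), s))" for P'
    have pr: "pr (L P + R Q) = P" for P Q
      unfolding pr_def
      by (rule the_equality) (auto simp: lookup_add lookup_L lookup_R0 intro!: poly_mapping_eqI)
    have pr_L: "pr (L P) = P" for P using pr[of P 0] by simp
    have "charge S' (\<phi> \<circ> pr)"
      unfolding charge_def
    proof (intro conjI ballI allI)
      fix P' Q' assume "P' \<in> S'" "Q' \<in> S'"
      then obtain P Q M N where *: "P \<in> S" "M \<in> S" "P' = L P + R Q" "Q' = L M + R N" by (auto simp: S'_def)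
      have "P' + Q' = L (P + M) + R (Q + N)" by (simp add: * L_add R_add ac_simps)
      then have "(\<phi> \<circ> pr) (P' + Q') = \<phi> (P + M)" by (simp add: pr)
      also have "\<dots> = \<phi> P + \<phi> M" using \<phi> *(1,2) by (simp add: charge_def)
      finally show "(\<phi> \<circ> pr) (P' + Q') = (\<phi> \<circ> pr) P' + (\<phi> \<circ> pr) Q'" by (simp add: *(3,4) pr)
    next
      fix r
      define E where "E = {P\<in>S. diam_le r P \<and> \<phi> P \<noteq> 0}"
      have "finite E" using \<phi> unfolding charge_def E_def by blast
      \<comment> \<open>In an operator of diameter at most \<open>r\<close> whose part
        \<open>P\<close> is not the identity, the ancilla part lies within \<open>r\<close> of the
        sites of \<open>P\<close>, which leaves finitely many possibilities.\<close>
      define box where "box P = (\<Union>u\<in>fst ` fst ` Poly_Mapping.keys P. {v. \<bar>fst v - fst u\<bar> \<le> r \<and> \<bar>snd v - snd u\<bar> \<le> r}) \<times> {..<p}"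
        for P :: "(site \<times> 'k) pauli"
      have "finite (box P)" for P
        unfolding box_def by (intro finite_cartesian_product finite_UN_I finite_imageI finite_keys finite_sites_near) simp
      \<comment> \<open>A nonzero charge thus forces \<open>P \<noteq> 0\<close>, so that the box
        has a centre; operators on the ancillas alone have charge 0.\<close>
      have "\<phi> 0 = 0" using \<phi> S0 unfolding charge_def by (metis add.left_neutral bit_add_self)
      have "{P'\<in>S'. diam_le r P' \<and> (\<phi> \<circ> pr) P' \<noteq> 0} \<subseteq> (\<lambda>(P, Q). L P + R Q) ` (SIGMA P:E. paulis_on (box P))"
      proof
        fix P' assume "P' \<in> {P'\<in>S'. diam_le r P' \<and> (\<phi> \<circ> pr) P' \<noteq> 0}"
        then obtain P Q where *: "P \<in> S" "Q \<in> T" "P' = L P + R Q" and r: "diam_le r P'" and nz: "\<phi> P \<noteq> 0"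
          by (auto simp: S'_def pr)
        have "P \<in> E" using * r nz diam_L by (auto simp: E_def)
        have "P \<noteq> 0" using nz \<open>\<phi> 0 = 0\<close> by metis
        then obtain u k s where k: "((u, k), s) \<in> Poly_Mapping.keys P"
          by (metis all_not_in_conv keys_eq_empty surj_pair)
        have "Q \<in> paulis_on (box P)"
          unfolding paulis_on_iff
        proof
          fix x assume x: "x \<in> Poly_Mapping.keys Q"
          obtain v l t where vl: "x = ((v, l), t)" by (metis prod.collapse)
          have "l < p" using subsetD[OF T_V *(2)] x by (auto simp: paulis_on_iff vl)
          moreover have "((v, Inr l), t) \<in> Poly_Mapping.keys P'" "((u, Inl k), s) \<in> Poly_Mapping.keys P'"
            unfolding *(3) keys_L keys_R using x k by (simp_all add: vl)
          from diam_leD[OF r this] have "\<bar>fst v - fst u\<bar> \<le> r" "\<bar>snd v - snd u\<bar> \<le> r" .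
          moreover have "u \<in> fst ` fst ` Poly_Mapping.keys P" using k by force
          ultimately show "x \<in> box P \<times> UNIV" unfolding box_def vl by blast
        qed
        then show "P' \<in> (\<lambda>(P, Q). L P + R Q) ` (SIGMA P:E. paulis_on (box P))"
          using *(3) \<open>P \<in> E\<close> by force
      qed
      moreover have "finite (SIGMA P:E. paulis_on (box P))"
        using \<open>finite E\<close> \<open>\<And>P. finite (box P)\<close> by (intro finite_SigmaI finite_paulis_on) 
      ultimately show "finite {P'\<in>S'. diam_le r P' \<and> (\<phi> \<circ> pr) P' \<noteq> 0}"
        by (meson finite_imageI finite_subset)
    qed
    then show ?thesis using pr_L by (intro exI[of _ "\<phi> \<circ> pr"]) simp
  qed
  have "num_sectors K' S' = num_sectors K S"
    unfolding num_sectors_def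
  proof (rule card_image_eq_if_kernels_eq[where h = "\<lambda>\<phi>. \<phi> \<circ> L"])
    show "\<exists>\<psi>\<in>Collect (charge S'). Collect (same_sector K S (\<psi> \<circ> L)) = Collect (same_sector K S \<phi>)"
      if "\<phi> \<in> Collect (charge S)" for \<phi>
    proof -
      obtain \<psi> where \<psi>: "charge S' \<psi>" "\<And>P. \<psi> (L P) = \<phi> P" using extend[of \<phi>] \<open>\<phi> \<in> Collect (charge S)\<close> by auto
      then have "\<psi> \<circ> L = \<phi>" by (simp add: fun_eq_iff)
      then show ?thesis using \<psi>(1) by auto
    qed
  qed (use pull sector in \<open>auto simp only: Collect_same_sector_eq_iff mem_Collect_eq\<close>)
  then show ?thesis by (simp add: tensor K_def S_def)
qed

lemma stab_tensor_trivial_subset: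
  assumes "stab C \<subseteq> paulis_on (UNIV \<times> labels C)"
  shows "stab (tensor_code C (trivial_code p)) \<subseteq> paulis_on (UNIV \<times> labels (tensor_code C (trivial_code p)))"
proof -
  have "relabel (apsnd Inl) P + relabel (apsnd Inr) Q \<in> paulis_on (UNIV \<times> (labels C <+> {..<p}))"
    if "P \<in> stab C" "Q \<in> stab_group (UNIV \<times> {..<p}) Zop" for P and Q :: "(site \<times> nat) pauli"
  proof (rule paulis_on_add)
    have "stab_group (UNIV \<times> {..<p}) Zop \<subseteq> paulis_on (UNIV \<times> {..<p} :: (site \<times> nat) set)"
      by (rule stab_group_subset) (simp add: Zop_def mem_Times_iff)
    then have Q: "Q \<in> paulis_on (UNIV \<times> {..<p})" using that(2) by blast
    have P: "P \<in> paulis_on (UNIV \<times> labels C)" using that(1) assms by blast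
    show "relabel (apsnd Inl) P \<in> paulis_on (UNIV \<times> (labels C <+> {..<p}))"
      by (rule paulis_on_mono[OF _ relabel_paulis_on[OF P]]) auto
    show "relabel (apsnd Inr) Q \<in> paulis_on (UNIV \<times> (labels C <+> {..<p}))"
      by (rule paulis_on_mono[OF _ relabel_paulis_on[OF Q]]) auto
  qed
  then show ?thesis by (auto simp: tensor_code_def trivial_code_def)
qed

section \<open>Sectors of a translation-invariant code and patterns of violated generators\<close>

text \<open>Independence makes the coefficients of a stabilizer unique, so arbitrary values on
  generators extend to a homomorphism. Covariance and finiteness of the types reduce statements
  about all stabilizers of a given size to finitely many of them. The cubic and the toric code are
  both instances.\<close>

locale local_generators =
  fixes K :: "'k set" and J :: "'j set" and g :: "site \<times> 'j \<Rightarrow> (site \<times> 'k) pauli"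
  assumes finite_labels: "finite K" and finite_types: "finite J"
    and support: "j \<in> J \<Longrightarrow> g (u, j) \<in> paulis_on (UNIV \<times> K)"
    and covariant: "j \<in> J \<Longrightarrow> g (u + v, j) = relabel (apfst ((+) v)) (g (u, j))"
    and independent: "Poly_Mapping.keys B \<subseteq> UNIV \<times> J \<Longrightarrow> combine g B = 0 \<Longrightarrow> B = 0"
begin

definition "gens = (UNIV \<times> J :: (site \<times> 'j) set)"
definition "S = stab_group gens g"
definition "coef = inv_into {B. Poly_Mapping.keys B \<subseteq> gens} (combine g)"

text \<open>The parity of the generators in the unique factorization of \<open>P\<close> that the
  pattern marks as violated: the value forced by additivity.\<close>

definition pattern_charge :: "(site \<times> 'j \<Rightarrow>\<^sub>0 bit) \<Rightarrow> (site \<times> 'k) pauli \<Rightarrow> bit" where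
  "pattern_charge A P = (\<Sum>i\<in>Poly_Mapping.keys A. Poly_Mapping.lookup (coef P) i)"

lemma S_subset: "S \<subseteq> paulis_on (UNIV \<times> K)"
  unfolding S_def by (rule stab_group_subset) (auto simp: gens_def support)

lemma S_subgroup: "additive_subgroup S"
  unfolding S_def by (rule additive_subgroup_stab_group)

lemma inj_on_combine: "inj_on (combine g) {B. Poly_Mapping.keys B \<subseteq> gens}"
proof (rule inj_onI)
  fix A B assume "A \<in> {B. Poly_Mapping.keys B \<subseteq> gens}" "B \<in> {B. Poly_Mapping.keys B \<subseteq> gens}"
    and "combine g A = combine g B"
  then have "Poly_Mapping.keys (A + B) \<subseteq> UNIV \<times> J" "combine g (A + B) = 0"
    by (simp_all add: gens_def combine_add keys_add_subset)
  then have "A + B = 0" by (rule independent)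
  then show "A = B" by (simp add: pm_add_eq_0_iff)
qed

lemma coef_combine: "Poly_Mapping.keys B \<subseteq> gens \<Longrightarrow> coef (combine g B) = B"
  unfolding coef_def using inj_on_combine by simp

lemma combine_coef:
  assumes "P \<in> S" shows "Poly_Mapping.keys (coef P) \<subseteq> gens" "combine g (coef P) = P"
  using assms inv_into_into[of P "combine g" "{B. Poly_Mapping.keys B \<subseteq> gens}"]
    f_inv_into_f[of P "combine g" "{B. Poly_Mapping.keys B \<subseteq> gens}"]
  by (auto simp: coef_def S_def stab_group_eq_combine)

lemma coef_add: "P \<in> S \<Longrightarrow> Q \<in> S \<Longrightarrow> coef (P + Q) = coef P + coef Q"
  using coef_combine[of "coef P + coef Q"] combine_coef[of P] combine_coef[of Q]
  by (simp add: combine_add keys_add_subset)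

lemma pattern_charge_add:
  "P \<in> S \<Longrightarrow> Q \<in> S \<Longrightarrow> pattern_charge A (P + Q) = pattern_charge A P + pattern_charge A Q"
  by (simp add: pattern_charge_def coef_add lookup_add sum.distrib)

lemma pattern_charge_generator:
  assumes "i \<in> gens" shows "pattern_charge A (g i) = Poly_Mapping.lookup A i"
proof -
  have "coef (g i) = Poly_Mapping.single i 1"
    using coef_combine[of "Poly_Mapping.single i 1"] assms by simp
  then show ?thesis
    by (simp add: pattern_charge_def lookup_single when_def in_keys_iff)
qed

lemma generator_in_S: "i \<in> gens \<Longrightarrow> g i \<in> S"
  unfolding S_def by (rule generator_in_stab_group)

lemma S_induct [consumes 1, case_names zero add]:
  assumes "P \<in> S" "R 0" "\<And>i P. i \<in> gens \<Longrightarrow> P \<in> S \<Longrightarrow> R P \<Longrightarrow> R (g i + P)" shows "R P"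
proof -
  have "combine g B \<in> S \<and> R (combine g B)" if "Poly_Mapping.keys B \<subseteq> gens" for B
    using that
  proof (induction rule: bit_pm_induct)
    case zero
    then show ?case using assms(2) S_subgroup by (simp add: additive_subgroup_def)
  next
    case (add i B)
    then show ?case using assms(3) S_subgroup generator_in_S[of i]
      by (simp add: additive_subgroup_def combine_add)
  qed
  then show ?thesis using combine_coef[OF assms(1)] by metis
qed

lemma additive_eqI:
  assumes "\<And>P Q. P \<in> S \<Longrightarrow> Q \<in> S \<Longrightarrow> \<phi> (P + Q) = \<phi> P + \<phi> Q"
    and "\<And>P Q. P \<in> S \<Longrightarrow> Q \<in> S \<Longrightarrow> \<psi> (P + Q) = \<psi> P + (\<psi> Q :: bit)"
    and "\<And>i. i \<in> gens \<Longrightarrow> \<phi> (g i) = \<psi> (g i)" and "P \<in> S"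
  shows "\<phi> P = (\<psi> P :: bit)"
  using assms(4)
proof (induction rule: S_induct)
  case zero
  have "0 \<in> S" using S_subgroup by (simp add: additive_subgroup_def)
  then have "\<phi> 0 = 0" "\<psi> 0 = 0"
    using assms(1)[of 0 0] assms(2)[of 0 0] by (simp_all add: bit_add_eq_0_iff)
  then show ?case by simp
qed (simp add: assms generator_in_S)

lemma diam_le_generators: "\<exists>r. \<forall>i\<in>gens. diam_le r (g i)"
proof -
  define A where "A = (\<Union>j\<in>J. fst ` fst ` Poly_Mapping.keys (g (0, j)))"
  have "finite A" using finite_types by (simp add: A_def)
  \<comment> \<open>\<open>insert 0\<close> keeps the maximum defined when \<open>A\<close> is
    empty, as for zero toric codes.\<close>
  define r where "r = Max (insert 0 ((\<lambda>(u, v). max \<bar>fst u - fst v\<bar> \<bar>snd u - snd v\<bar>) ` (A \<times> A)))"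
  have r: "\<bar>fst u - fst v\<bar> \<le> r \<and> \<bar>snd u - snd v\<bar> \<le> r" if "u \<in> A" "v \<in> A" for u v
  proof -
    have "max \<bar>fst u - fst v\<bar> \<bar>snd u - snd v\<bar> \<le> r"
      unfolding r_def using that \<open>finite A\<close> by (intro Max_ge) auto
    then show ?thesis by simp
  qed
  have "diam_le r (g (v, j))" if "j \<in> J" for v j
  proof (rule diam_leI)
    have near: "u - v \<in> A" if "((u, k), s) \<in> Poly_Mapping.keys (g (v, j))" for u k s
    proof -
      have "(u, k) \<in> fst ` Poly_Mapping.keys (relabel (apfst ((+) v)) (g (0, j)))"
        using covariant[OF \<open>j \<in> J\<close>, of 0 v] that by force
      also have "\<dots> = apfst ((+) v) ` fst ` Poly_Mapping.keys (g (0, j))"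
        by (rule fst_keys_relabel[OF paulis_on_UNIV]) (auto simp: inj_def)
      finally show ?thesis using \<open>j \<in> J\<close> by (force simp: A_def)
    qed
    fix u k s u' k' s'
    assume "((u, k), s) \<in> Poly_Mapping.keys (g (v, j))" "((u', k'), s') \<in> Poly_Mapping.keys (g (v, j))"
    from r[OF near[OF this(1)] near[OF this(2)]]
    show "\<bar>fst u - fst u'\<bar> \<le> r \<and> \<bar>snd u - snd u'\<bar> \<le> r" by simp
  qed
  then show ?thesis by (intro exI[of _ r]) (auto simp: gens_def)
qed

text \<open>The action on coefficient vectors that corresponds under \<open>combine\<close> to
  translating operators. By uniqueness, the coefficients of a translated stabilizer are the
  translated coefficients.\<close>

definition shift :: "site \<Rightarrow> (site \<times> 'j \<Rightarrow>\<^sub>0 bit) \<Rightarrow> (site \<times> 'j \<Rightarrow>\<^sub>0 bit)" where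
  "shift v B = (\<Sum>i\<in>Poly_Mapping.keys B. Poly_Mapping.single (apfst ((+) v) i) 1)"

lemma keys_shift: "Poly_Mapping.keys (shift v B) \<subseteq> apfst ((+) v) ` Poly_Mapping.keys B"
  unfolding shift_def by (rule keys_sum_subset) auto

lemma combine_shift:
  assumes "Poly_Mapping.keys B \<subseteq> gens"
  shows "combine g (shift v B) = relabel (apfst ((+) v)) (combine g B)"
proof -
  have "combine g (shift v B) = (\<Sum>i\<in>Poly_Mapping.keys B. g (apfst ((+) v) i))"
    by (simp add: shift_def combine_sum)
  also have "\<dots> = (\<Sum>i\<in>Poly_Mapping.keys B. relabel (apfst ((+) v)) (g i))"
  proof (rule sum.cong)
    fix i assume "i \<in> Poly_Mapping.keys B"
    then obtain u j where "i = (u, j)" "j \<in> J" using assms by (auto simp: gens_def)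
    then show "g (apfst ((+) v) i) = relabel (apfst ((+) v)) (g i)"
      using covariant[of j u v] by (simp add: add.commute)
  qed simp
  finally show ?thesis by (simp add: combine_def relabel_sum)
qed

text \<open>
  Up to translation there are only finitely many stabilizers of each size, so a stabilizer
  violated by a finite pattern is one of finitely many translates.
\<close>

lemma charge_pattern_charge: "charge S (pattern_charge A)"
  unfolding charge_def
proof (intro conjI ballI allI)
  show "pattern_charge A (P + Q) = pattern_charge A P + pattern_charge A Q" if "P \<in> S" "Q \<in> S" for P Q
    using that by (rule pattern_charge_add)
  fix r :: int
  \<comment> \<open>\<open>E\<close> contains a translate of every nonzero stabilizer of diameter at
    most \<open>r\<close>, namely one that brings a site of its support to the origin.\<close>
  define E where "E = S \<inter> paulis_on ({v. \<bar>fst v - 0\<bar> \<le> r \<and> \<bar>snd v - 0\<bar> \<le> r} \<times> K)"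
  have "finite E"
    unfolding E_def by (intro finite_Int disjI2 finite_paulis_on finite_cartesian_product finite_sites_near finite_labels)
  define tr where "tr v = relabel (apfst ((+) v) :: site \<times> 'k \<Rightarrow> _)" for v :: site
  have tr_tr: "tr v (tr (- v) P) = P" for v P
    unfolding tr_def relabel_relabel by (rule relabel_ident[OF paulis_on_UNIV]) auto
  have "{P\<in>S. diam_le r P \<and> pattern_charge A P \<noteq> 0} \<subseteq>
    (\<lambda>(P, i, j). tr (fst i - fst j) P) ` (SIGMA P:E. Poly_Mapping.keys A \<times> Poly_Mapping.keys (coef P))"
  proof
    fix P assume "P \<in> {P\<in>S. diam_le r P \<and> pattern_charge A P \<noteq> 0}"
    then have P: "P \<in> S" "diam_le r P" "pattern_charge A P \<noteq> 0" by auto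
    have "P \<noteq> 0"
    proof
      assume "P = 0"
      then have "pattern_charge A P = pattern_charge A P + pattern_charge A P"
        using pattern_charge_add[of P P A] P(1) by simp
      then show False using P(3) by (simp only: bit_add_self)
    qed
    then obtain x where "x \<in> Poly_Mapping.keys P"
      by (metis all_not_in_conv keys_eq_empty)
    then obtain v k s where v: "((v, k), s) \<in> Poly_Mapping.keys P"
      by (metis prod.collapse)
    define Q where "Q = tr (- v) P"
    have P_eq: "P = tr v Q" by (simp add: Q_def tr_tr)
    have Q_eq: "Q = combine g (shift (- v) (coef P))"
      using combine_coef[OF P(1)] by (simp add: combine_shift Q_def tr_def)
    have "Poly_Mapping.keys (shift (- v) (coef P)) \<subseteq> gens"
      using keys_shift[of "- v" "coef P"] combine_coef(1)[OF P(1)] by (force simp: gens_def)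
    then have "Q \<in> S" unfolding Q_eq S_def stab_group_eq_combine by blast
    have "fst ` Poly_Mapping.keys Q = apfst ((+) (- v)) ` fst ` Poly_Mapping.keys P"
      unfolding Q_def tr_def by (rule fst_keys_relabel[OF paulis_on_UNIV]) (auto simp: inj_def)
    moreover have "apfst ((+) (- v)) ` fst ` Poly_Mapping.keys P \<subseteq>
        {v. \<bar>fst v - 0\<bar> \<le> r \<and> \<bar>snd v - 0\<bar> \<le> r} \<times> K"
    proof (rule image_subsetI)
      fix q assume "q \<in> fst ` Poly_Mapping.keys P"
      then obtain u l t where u: "q = (u, l)" "((u, l), t) \<in> Poly_Mapping.keys P" by force
      then have "l \<in> K" using subsetD[OF S_subset P(1)] by (auto simp: paulis_on_iff)
      then show "apfst ((+) (- v)) q \<in> {v. \<bar>fst v - 0\<bar> \<le> r \<and> \<bar>snd v - 0\<bar> \<le> r} \<times> K"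
        using diam_leD[OF P(2) u(2) v] by (simp add: u(1))
    qed
    ultimately have "fst ` Poly_Mapping.keys Q \<subseteq> {v. \<bar>fst v - 0\<bar> \<le> r \<and> \<bar>snd v - 0\<bar> \<le> r} \<times> K" by simp
    then have "Q \<in> paulis_on ({v. \<bar>fst v - 0\<bar> \<le> r \<and> \<bar>snd v - 0\<bar> \<le> r} \<times> K)"
      unfolding paulis_on_iff image_subset_iff by (intro subsetI) (simp only: mem_Times_iff UNIV_I)
    then have "Q \<in> E" using \<open>Q \<in> S\<close> by (simp add: E_def)
    have "P = combine g (shift v (coef Q))"
      using combine_coef[OF \<open>Q \<in> S\<close>] by (simp add: combine_shift P_eq tr_def)
    moreover have "Poly_Mapping.keys (shift v (coef Q)) \<subseteq> gens"
      using keys_shift[of v "coef Q"] combine_coef(1)[OF \<open>Q \<in> S\<close>] by (force simp: gens_def)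
    ultimately have coef_P: "coef P = shift v (coef Q)" using coef_combine by simp
    obtain i where i: "i \<in> Poly_Mapping.keys A" "Poly_Mapping.lookup (coef P) i \<noteq> 0"
      using P(3) unfolding pattern_charge_def by (meson sum.neutral)
    then have "i \<in> Poly_Mapping.keys (coef P)" by (simp add: in_keys_iff)
    then obtain j where j: "j \<in> Poly_Mapping.keys (coef Q)" "i = apfst ((+) v) j"
      using keys_shift[of v "coef Q"] unfolding coef_P by blast
    \<comment> \<open>A generator common to the pattern and to the translated coefficients fixes the
      translation, which leaves finitely many \<open>v\<close> for each representative.\<close>
    then have "v = fst i - fst j" by simp
    then have "P = (\<lambda>(P, i, j). tr (fst i - fst j) P) (Q, i, j)" using P_eq by simp
    moreover have "(Q, i, j) \<in> (SIGMA P:E. Poly_Mapping.keys A \<times> Poly_Mapping.keys (coef P))"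
      using \<open>Q \<in> E\<close> i(1) j(1) by simp
    ultimately show "P \<in> (\<lambda>(P, i, j). tr (fst i - fst j) P) `
        (SIGMA P:E. Poly_Mapping.keys A \<times> Poly_Mapping.keys (coef P))" by (rule image_eqI)
  qed
  moreover have "finite (SIGMA P:E. Poly_Mapping.keys A \<times> Poly_Mapping.keys (coef P))"
    using \<open>finite E\<close> by (intro finite_SigmaI) auto
  ultimately show "finite {P\<in>S. diam_le r P \<and> pattern_charge A P \<noteq> 0}"
    by (meson finite_imageI finite_subset)
qed

text \<open>All generators have diameter at most one common \<open>r\<close>, so a charge is nonzero
  on only finitely many of them; these form the pattern.\<close>

lemma charge_eq_pattern_charge:
  assumes "charge S \<phi>"
  shows "\<exists>A. Poly_Mapping.keys A \<subseteq> gens \<and> (\<forall>P\<in>S. pattern_charge A P = \<phi> P)"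
proof -
  obtain r where r: "\<And>i. i \<in> gens \<Longrightarrow> diam_le r (g i)" using diam_le_generators by blast
  define D where "D = {i\<in>gens. \<phi> (g i) \<noteq> 0}"
  have "finite D"
  proof (rule finite_imageD)
    have "g ` D \<subseteq> {P\<in>S. diam_le r P \<and> \<phi> P \<noteq> 0}" using r generator_in_S by (auto simp: D_def)
    then show "finite (g ` D)" using assms unfolding charge_def by (meson finite_subset)
    show "inj_on g D"
    proof (rule inj_onI)
      fix i j assume "i \<in> D" "j \<in> D" "g i = g j"
      then have "Poly_Mapping.single i (1 :: bit) = Poly_Mapping.single j 1"
        by (intro inj_onD[OF inj_on_combine]) (auto simp: D_def)
      then show "i = j" by (metis inj_on_def keys_single one_neq_zero the_elem_eq)
    qed
  qed
  define A :: "site \<times> 'j \<Rightarrow>\<^sub>0 bit" where "A = (\<Sum>i\<in>D. Poly_Mapping.single i 1)"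
  have A: "Poly_Mapping.lookup A i = of_bool (i \<in> D)" for i
    using \<open>finite D\<close> by (simp add: A_def lookup_sum lookup_single when_def)
  have "Poly_Mapping.keys A \<subseteq> gens" by (auto simp: in_keys_iff A D_def)
  moreover have "pattern_charge A P = \<phi> P" if "P \<in> S" for P
    using pattern_charge_add _ _ that
  proof (rule additive_eqI)
    show "\<phi> (P + Q) = \<phi> P + \<phi> Q" if "P \<in> S" "Q \<in> S" for P Q
      using that assms by (simp add: charge_def)
    show "pattern_charge A (g i) = \<phi> (g i)" if "i \<in> gens" for i
      using that by (auto simp: pattern_charge_generator A D_def)
  qed
  ultimately show ?thesis by blast
qed

lemma same_sector_pattern_charge_iff:
  assumes "Poly_Mapping.keys A \<subseteq> gens" "Poly_Mapping.keys B \<subseteq> gens"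
  shows "same_sector K S (pattern_charge A) (pattern_charge B) \<longleftrightarrow>
    A + B \<in> created_patterns (UNIV \<times> K) gens g"
proof -
  have "(\<forall>Q\<in>S. pattern_charge A Q + pattern_charge B Q = anticomm P Q) \<longleftrightarrow>
      (\<forall>i\<in>gens. Poly_Mapping.lookup (A + B) i = anticomm P (g i))" for P
  proof
    assume *: "\<forall>Q\<in>S. pattern_charge A Q + pattern_charge B Q = anticomm P Q"
    show "\<forall>i\<in>gens. Poly_Mapping.lookup (A + B) i = anticomm P (g i)"
    proof
      fix i assume "i \<in> gens"
      then show "Poly_Mapping.lookup (A + B) i = anticomm P (g i)"
        using * generator_in_S[of i] by (simp add: lookup_add flip: pattern_charge_generator)
    qed
  next
    assume *: "\<forall>i\<in>gens. Poly_Mapping.lookup (A + B) i = anticomm P (g i)"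
    show "\<forall>Q\<in>S. pattern_charge A Q + pattern_charge B Q = anticomm P Q"
    proof
      fix Q assume "Q \<in> S"
      show "pattern_charge A Q + pattern_charge B Q = anticomm P Q"
        by (rule additive_eqI[where \<phi> = "\<lambda>Q. pattern_charge A Q + pattern_charge B Q" and \<psi> = "anticomm P"])
          (use * \<open>Q \<in> S\<close> in \<open>simp_all add: pattern_charge_add anticomm_add_right pattern_charge_generator lookup_add ac_simps\<close>)
    qed
  qed
  moreover have "Poly_Mapping.keys (A + B) \<subseteq> gens" using assms by (rule keys_add_subset)
  ultimately show ?thesis by (simp add: same_sector_def created_patterns_def)
qed

end

section \<open>The anyon group as a set of cosets\<close>

lemma additive_subgroup_created_patterns: "additive_subgroup (created_patterns Q I g)"
  unfolding additive_subgroup_def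
proof (intro conjI ballI)
  show "0 \<in> created_patterns Q I g"
    unfolding created_patterns_def by (auto intro!: bexI[of _ 0])
  fix A B assume "A \<in> created_patterns Q I g" "B \<in> created_patterns Q I g"
  then obtain P P' where P: "P \<in> paulis_on Q" "\<forall>i\<in>I. Poly_Mapping.lookup A i = anticomm P (g i)"
    and P': "P' \<in> paulis_on Q" "\<forall>i\<in>I. Poly_Mapping.lookup B i = anticomm P' (g i)"
    and AB: "Poly_Mapping.keys A \<subseteq> I" "Poly_Mapping.keys B \<subseteq> I"
    unfolding created_patterns_def by blast
  have "\<forall>i\<in>I. Poly_Mapping.lookup (A + B) i = anticomm (P + P') (g i)"
    using P P' by (simp add: lookup_add anticomm_add_left)
  moreover have "P + P' \<in> paulis_on Q" using P(1) P'(1) by (rule paulis_on_add)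
  ultimately show "A + B \<in> created_patterns Q I g"
    using keys_add_subset[OF AB] unfolding created_patterns_def by blast
qed

lemma order_anyon_group:
  "order (anyon_group Q I g) =
    card ((#>\<^bsub>pattern_group I\<^esub>) (created_patterns Q I g) ` {A. Poly_Mapping.keys A \<subseteq> I})"
proof -
  have "carrier (anyon_group Q I g) =
      (#>\<^bsub>pattern_group I\<^esub>) (created_patterns Q I g) ` {A. Poly_Mapping.keys A \<subseteq> I}"
    by (auto simp: anyon_group_def FactGroup_def RCOSETS_def pattern_group_def)
  then show ?thesis by (simp add: Coset.order_def)
qed

lemma coset_created_patterns_eq_iff:
  "created_patterns Q I g #>\<^bsub>pattern_group I\<^esub> A = created_patterns Q I g #>\<^bsub>pattern_group I\<^esub> B \<longleftrightarrow>
    A + B \<in> created_patterns Q I g"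
proof -
  let ?H = "created_patterns Q I g"
  have H0: "0 \<in> ?H" and H_add: "\<And>M N. M \<in> ?H \<Longrightarrow> N \<in> ?H \<Longrightarrow> M + N \<in> ?H"
    using additive_subgroup_created_patterns[of Q I g] by (auto simp: additive_subgroup_def)
  have coset: "?H #>\<^bsub>pattern_group I\<^esub> A = {M. M + A \<in> ?H}" for A
  proof -
    have "\<exists>N\<in>?H. M = N + A" if "M + A \<in> ?H" for M
      by (rule bexI[OF _ that]) (simp add: add.assoc)
    then show ?thesis by (auto simp: r_coset_def pattern_group_def add.assoc)
  qed
  show ?thesis
  proof
    assume "?H #>\<^bsub>pattern_group I\<^esub> A = ?H #>\<^bsub>pattern_group I\<^esub> B"
    moreover have "A \<in> {M. M + A \<in> ?H}" using H0 by simp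
    ultimately show "A + B \<in> ?H" unfolding coset by blast
  next
    assume *: "A + B \<in> ?H"
    have "M + A \<in> ?H \<longleftrightarrow> M + B \<in> ?H" for M
      using H_add[OF _ *, of "M + A"] H_add[OF _ *, of "M + B"]
      by (metis add.assoc add.commute pm_add_self_left)
    then show "?H #>\<^bsub>pattern_group I\<^esub> A = ?H #>\<^bsub>pattern_group I\<^esub> B" unfolding coset by blast
  qed
qed

text \<open>A complete invariant of patterns modulo created patterns counts the anyons by its
  values. For the toric code this is the total charge, for the cubic code a pair of normal
  forms.\<close>

lemma order_anyon_group_eq_card:
  assumes "\<And>A B. Poly_Mapping.keys A \<subseteq> I \<Longrightarrow> Poly_Mapping.keys B \<subseteq> I \<Longrightarrow>
    f A = f B \<longleftrightarrow> A + B \<in> created_patterns Q I g"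
  shows "order (anyon_group Q I g) = card (f ` {A. Poly_Mapping.keys A \<subseteq> I})"
  unfolding order_anyon_group
  by (rule card_image_eq_if_kernels_eq[where h = "\<lambda>A. A"])
    (use assms in \<open>auto simp: coset_created_patterns_eq_iff\<close>)

text \<open>\<open>pattern_charge\<close> induces a bijection from anyon types to sectors, which
  links the invariant description to the one by generators.\<close>

lemma (in local_generators) num_sectors_eq_order_anyon_group:
  "num_sectors K S = order (anyon_group (UNIV \<times> K) gens g)"
  unfolding order_anyon_group num_sectors_def
proof (rule card_image_eq_if_kernels_eq[where h = pattern_charge, symmetric])
  show "pattern_charge ` {A. Poly_Mapping.keys A \<subseteq> gens} \<subseteq> Collect (charge S)"
    using charge_pattern_charge by auto
  show "created_patterns (UNIV \<times> K) gens g #>\<^bsub>pattern_group gens\<^esub> A =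
      created_patterns (UNIV \<times> K) gens g #>\<^bsub>pattern_group gens\<^esub> B \<longleftrightarrow>
      Collect (same_sector K S (pattern_charge A)) = Collect (same_sector K S (pattern_charge B))"
    if "A \<in> {A. Poly_Mapping.keys A \<subseteq> gens}" "B \<in> {A. Poly_Mapping.keys A \<subseteq> gens}" for A B
    using that by (simp add: coset_created_patterns_eq_iff Collect_same_sector_eq_iff same_sector_pattern_charge_iff)
  show "\<exists>A\<in>{A. Poly_Mapping.keys A \<subseteq> gens}.
      Collect (same_sector K S (pattern_charge A)) = Collect (same_sector K S \<phi>)"
    if "\<phi> \<in> Collect (charge S)" for \<phi>
  proof -
    obtain A where A: "Poly_Mapping.keys A \<subseteq> gens" "\<forall>P\<in>S. pattern_charge A P = \<phi> P"
      using charge_eq_pattern_charge[of \<phi>] \<open>\<phi> \<in> Collect (charge S)\<close> by blast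
    then have "same_sector K S (pattern_charge A) \<phi>"
      unfolding same_sector_def by (intro bexI[of _ 0]) simp_all
    then show ?thesis using A(1) by (auto simp only: Collect_same_sector_eq_iff mem_Collect_eq)
  qed
qed

text \<open>A leading-term argument: a nonempty product of generators contains one with a Pauli
  factor that no other generator in the product can cancel.\<close>

lemma independent_if_extremal:
  assumes "\<And>F. finite F \<Longrightarrow> F \<noteq> {} \<Longrightarrow> F \<subseteq> I \<Longrightarrow>
    \<exists>i\<in>F. \<exists>k. Poly_Mapping.lookup (g i) k \<noteq> 0 \<and> (\<forall>j\<in>F. j \<noteq> i \<longrightarrow> Poly_Mapping.lookup (g j) k = 0)"
    and "Poly_Mapping.keys B \<subseteq> I" "combine g B = 0"
  shows "B = 0"
proof (rule ccontr)
  assume "B \<noteq> 0"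
  then obtain i k where i: "i \<in> Poly_Mapping.keys B" "Poly_Mapping.lookup (g i) k \<noteq> 0"
    and others: "\<forall>j\<in>Poly_Mapping.keys B. j \<noteq> i \<longrightarrow> Poly_Mapping.lookup (g j) k = 0"
    using assms(1)[of "Poly_Mapping.keys B"] assms(2) by auto
  have "Poly_Mapping.lookup (combine g B) k =
      Poly_Mapping.lookup (g i) k + (\<Sum>j\<in>Poly_Mapping.keys B - {i}. Poly_Mapping.lookup (g j) k)"
    unfolding combine_def lookup_sum by (rule sum.remove) (use i(1) in auto)
  also have "(\<Sum>j\<in>Poly_Mapping.keys B - {i}. Poly_Mapping.lookup (g j) k) = 0"
    by (rule sum.neutral) (use others in auto)
  finally show False using i(2) assms(3) by simp
qed

section \<open>Factorization of the compactification polynomial\<close>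

lemma bit_poly_two [simp]: "(2 :: bit poly) = 0"
  by (metis bit_2_eq_0 numeral_poly pCons_0_0)

lemma bit_poly_add_self [simp]: "p + p = 0" for p :: "bit poly"
  by (metis bit_poly_two mult_2 mult_zero_left)

lemma bit_poly_minus: "- p = p" for p :: "bit poly"
  by (metis add_eq_0_iff bit_poly_add_self)

lemma bit_poly_diff: "p - q = p + q" for p q :: "bit poly"
  by (metis bit_poly_minus diff_conv_add_uminus)

lemma bit_poly_frobenius: "(p + q) ^ 2 ^ i = p ^ 2 ^ i + q ^ 2 ^ i" for p q :: "bit poly"
proof (induction i)
  case (Suc i)
  have sq: "x ^ 2 ^ Suc i = (x ^ 2 ^ i)\<^sup>2" for x :: "bit poly"
    by (simp only: power_Suc2 power_mult)
  show ?case
    unfolding sq Suc.IH power2_sum by simp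
qed simp

abbreviation zP :: "bit poly" where "zP \<equiv> [:0, 1:]"

definition wP :: "bit poly" where "wP = 1 + zP + zP\<^sup>2"

lemma wP_eq: "wP = [:1, 1, 1:]"
  by (simp add: wP_def power2_eq_square one_pCons)

lemma degree_wP: "degree wP = 2" and wP_nonzero: "wP \<noteq> 0"
  by (simp_all add: wP_eq)

lemma zP_cubed: "zP ^ 3 - 1 = (zP - 1) * wP"
  unfolding wP_def by algebra

lemma wP_dvd_zP_power_3: "wP dvd zP ^ (3 * k) - 1"
proof -
  have "zP ^ 3 - 1 dvd (zP ^ 3) ^ k - 1"
    by (simp add: power_diff_1_eq)
  then show ?thesis by (metis dvd_trans dvd_triv_right power_mult zP_cubed)
qed

text \<open>Since -1 = 1, this says that \<open>zP\<close> and \<open>zP - 1\<close> are inverse to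
  each other modulo \<open>wP\<close>; the explicit Bezout coefficients come from it.\<close>

lemma zP_quadratic: "zP * (zP - 1) = wP - 1"
proof -
  have "wP - 1 = zP * (zP - 1) + 2 * zP" unfolding wP_def by algebra
  then show ?thesis by simp
qed

text \<open>
  On the quotient $1 + z + z^2$ acts as the unit $xy$, so its primary part splits off and only
  the coprime factor \<open>m\<close> contributes.
\<close>

lemma compactification_factorization:
  fixes L i l :: nat
  assumes "L \<ge> 1" and L: "L = 2 ^ i * l" and "odd l"
  shows "\<exists>m e s q. zP ^ L - 1 = m * wP ^ e \<and> m * s + wP * q = 1 \<and> m \<noteq> 0 \<and>
    2 * degree m = (if 3 dvd L then 2 * L - 2 ^ (i + 2) else 2 * L)"
proof -
  have deg: "degree (zP ^ n - 1) = n" and nz: "zP ^ n - 1 \<noteq> 0" if "n \<ge> 1" for n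
  proof -
    have z: "zP ^ n = monom 1 n" by (simp add: monom_altdef)
    have "degree (monom 1 n + (- 1 :: bit poly)) = n"
      using that by (subst degree_add_eq_left) (simp_all add: degree_monom_eq)
    then show "degree (zP ^ n - 1) = n" by (simp add: z)
    then show "zP ^ n - 1 \<noteq> 0" using that by auto
  qed
  show ?thesis
  proof (cases "3 dvd L")
    case False
    \<comment> \<open>\<open>zP ^ 3\<close> is 1 modulo \<open>wP\<close>, so only the residue of
      the exponent matters.\<close>
    define r where "r = L mod 3"
    have r: "r = 1 \<or> r = 2" using False unfolding r_def by presburger
    have "L = 3 * (L div 3) + r" by (simp add: r_def)
    then have "zP ^ L - zP ^ r = zP ^ r * (zP ^ (3 * (L div 3)) - 1)"
      by (metis mult.commute mult.right_neutral power_add right_diff_distrib)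
    then have 1: "wP dvd zP ^ L - zP ^ r" using wP_dvd_zP_power_3 by simp
    \<comment> \<open>\<open>zP ^ r\<close> is inverse to \<open>zP ^ r - 1\<close> modulo
      \<open>wP\<close>; the case \<open>r = 2\<close> is the square of the case
      \<open>r = 1\<close>. It becomes the Bezout coefficient \<open>s\<close>, with
      \<open>e = 0\<close>.\<close>
    have 2: "wP dvd (zP ^ r - 1) * zP ^ r - 1"
      using r
    proof
      assume "r = 1"
      then have "(zP ^ r - 1) * zP ^ r - 1 = zP * (zP - 1) - 1" by (simp add: mult.commute)
      also have "\<dots> = wP - 2" by (simp only: zP_quadratic) simp
      finally show ?thesis by simp
    next
      assume "r = 2"
      have "(zP ^ 2 - 1) * zP ^ 2 - 1 = (zP * (zP - 1)) ^ 2 + 2 * (zP ^ 3 - zP ^ 2) - 1"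
        by algebra
      also have "\<dots> = (wP - 1) ^ 2 + 2 * (zP ^ 3 - zP ^ 2) - 1" by (simp only: zP_quadratic)
      also have "\<dots> = (wP - 1) ^ 2 - 1" by simp
      also have "\<dots> = wP * (wP - 2)" by algebra
      finally show ?thesis unfolding \<open>r = 2\<close> by simp
    qed
    have eq: "(zP ^ L - 1) * zP ^ r - 1 = (zP ^ L - zP ^ r) * zP ^ r + ((zP ^ r - 1) * zP ^ r - 1)"
      by algebra
    have "wP dvd (zP ^ L - 1) * zP ^ r - 1"
      unfolding eq by (intro dvd_add dvd_mult2 1 2)
    then obtain c where c: "(zP ^ L - 1) * zP ^ r - 1 = wP * c" by (elim dvdE)
    then have "(zP ^ L - 1) * zP ^ r + wP * (- c) = 1" by (simp add: algebra_simps)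
    then show ?thesis
      using deg[OF assms(1)] nz[OF assms(1)] False
      by (intro exI[of _ "zP ^ L - 1"] exI[of _ 0] exI[of _ "zP ^ r"] exI[of _ "- c"]) simp
  next
    case True
    have "coprime 3 (2 ^ i :: nat)" by simp
    then have "3 dvd l" using True by (simp add: L coprime_dvd_mult_right_iff)
    then obtain k where k: "l = 3 * k" by (elim dvdE)
    then have "odd k" using assms(3) by simp
    \<comment> \<open>The quotient of \<open>zP ^ l - 1\<close> by \<open>zP ^ 3 - 1\<close>. Each
      of its \<open>k\<close> terms is 1 modulo \<open>wP\<close> and \<open>k\<close> is odd, so
      \<open>\<Sigma>\<close> is 1 modulo \<open>wP\<close>: the factor \<open>wP\<close> occurs
      only once in \<open>zP ^ l - 1\<close>.\<close>
    define \<Sigma> where "\<Sigma> = (\<Sum>j<k. (zP ^ 3) ^ j)"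
    define m0 where "m0 = (zP - 1) * \<Sigma>"
    have "zP ^ l - 1 = (zP ^ 3) ^ k - 1" by (simp only: k power_mult)
    also have "\<dots> = (zP ^ 3 - 1) * \<Sigma>" unfolding \<Sigma>_def by (rule power_diff_1_eq)
    also have "\<dots> = m0 * wP" unfolding zP_cubed m0_def by (simp only: ac_simps)
    finally have fac: "zP ^ l + 1 = m0 * wP" by (simp only: bit_poly_diff)
    have "wP dvd (\<Sum>j<k. (zP ^ 3) ^ j - 1)"
      by (rule dvd_sum) (metis power_mult wP_dvd_zP_power_3)
    also have "(\<Sum>j<k. (zP ^ 3) ^ j - 1) = \<Sigma> - of_nat k" by (simp add: \<Sigma>_def sum_subtractf)
    also have "of_nat k = (1 :: bit poly)"
    proof -
      obtain h where "k = 2 * h + 1" using \<open>odd k\<close> by (elim oddE)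
      then show ?thesis by (simp only: of_nat_add of_nat_mult) simp
    qed
    finally obtain a where a: "\<Sigma> - 1 = wP * a" by (elim dvdE)
    \<comment> \<open>\<open>m0\<close> is \<open>zP - 1\<close> modulo \<open>wP\<close>, with
      inverse \<open>zP\<close>. Raising this identity to the power \<open>2 ^ i\<close> turns it
      into the Bezout relation for \<open>m\<close>.\<close>
    have "m0 * zP = (zP * (zP - 1)) * (1 + (\<Sigma> - 1))" unfolding m0_def by algebra
    also have "\<dots> = (wP - 1) * (1 + wP * a)" by (simp only: zP_quadratic a)
    also have "\<dots> = (1 + wP * (1 + wP * a - a)) - 2" by algebra
    also have "\<dots> = 1 + wP * (1 + wP * a - a)" by simp
    finally have unit: "m0 * zP = 1 + wP * (1 + wP * a - a)" .
    define m where "m = m0 ^ 2 ^ i"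
    have "zP ^ L - 1 = (zP ^ l) ^ 2 ^ i + 1 ^ 2 ^ i"
      by (simp add: L bit_poly_diff mult.commute[of "2 ^ i"] power_mult)
    also have "\<dots> = m * wP ^ 2 ^ i"
      by (simp only: bit_poly_frobenius[symmetric] fac m_def power_mult_distrib)
    finally have m: "zP ^ L - 1 = m * wP ^ 2 ^ i" .
    have "m * zP ^ 2 ^ i = 1 + wP ^ 2 ^ i * (1 + wP * a - a) ^ 2 ^ i"
      unfolding m_def power_mult_distrib[symmetric] unit bit_poly_frobenius by simp
    moreover have "wP ^ 2 ^ i = wP * wP ^ (2 ^ i - 1)"
      by (metis power_Suc Suc_pred' zero_less_power pos2)
    ultimately have "m * zP ^ 2 ^ i + wP * (wP ^ (2 ^ i - 1) * (1 + wP * a - a) ^ 2 ^ i) = 1"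
      by (simp add: mult.assoc)
    moreover have "m \<noteq> 0" using m nz[OF assms(1)] by auto
    \<comment> \<open>The removed factor has degree \<open>2 * 2 ^ i\<close>; doubling it gives the
      constant \<open>2 ^ (i + 2)\<close>.\<close>
    moreover have "L = degree m + 2 * 2 ^ i"
      using deg[OF assms(1)] \<open>m \<noteq> 0\<close> unfolding m
      by (simp add: degree_mult_eq wP_nonzero degree_power_eq degree_wP)
    ultimately show ?thesis
      using m True
      by (intro exI[of _ m] exI[of _ "2 ^ i"] exI[of _ "zP ^ 2 ^ i"]
          exI[of _ "wP ^ (2 ^ i - 1) * (1 + wP * a - a) ^ 2 ^ i"]) simp
  qed
qed

text \<open>As \<open>degree 0 = 0\<close>, the zero polynomial is listed separately; for
  \<open>n = 0\<close> it is the only element. This is the condition met by remainders modulo a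
  polynomial of degree \<open>n\<close>. The induction splits off the constant coefficient.\<close>

lemma card_bit_poly_degree_less: "card {p :: bit poly. p = 0 \<or> degree p < n} = 2 ^ n"
proof (induction n)
  case 0
  have "{p :: bit poly. p = 0 \<or> degree p < 0} = {0}" by auto
  then show ?case by simp
next
  case (Suc n)
  have "bij_betw (\<lambda>(a, p). pCons a p) (UNIV \<times> {p :: bit poly. p = 0 \<or> degree p < n})
    {p. p = 0 \<or> degree p < Suc n}"
  proof (rule bij_betw_byWitness[where f' = "\<lambda>p. (coeff p 0, poly_shift (Suc 0) p)"])
    have shift: "poly_shift (Suc 0) (pCons a p) = p" for a and p :: "bit poly"
      by (rule poly_eqI) (simp add: coeff_poly_shift)
    then show "\<forall>x\<in>UNIV \<times> {p :: bit poly. p = 0 \<or> degree p < n}.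
        (\<lambda>p. (coeff p 0, poly_shift (Suc 0) p)) ((\<lambda>(a, p). pCons a p) x) = x" by auto
    have split: "p = pCons (coeff p 0) (poly_shift (Suc 0) p)" for p :: "bit poly"
      by (metis coeff_pCons_0 pCons_cases shift)
    then show "\<forall>p\<in>{p :: bit poly. p = 0 \<or> degree p < Suc n}.
        (\<lambda>(a, p). pCons a p) (coeff p 0, poly_shift (Suc 0) p) = p" by auto
    show "(\<lambda>(a, p). pCons a p) ` (UNIV \<times> {p :: bit poly. p = 0 \<or> degree p < n}) \<subseteq> {p. p = 0 \<or> degree p < Suc n}"
      by (auto simp: degree_pCons_eq_if split: if_splits)
    show "(\<lambda>p. (coeff p 0, poly_shift (Suc 0) p)) ` {p :: bit poly. p = 0 \<or> degree p < Suc n} \<subseteq>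
        UNIV \<times> {p. p = 0 \<or> degree p < n}"
    proof (rule image_subsetI)
      fix p :: "bit poly" assume p: "p \<in> {p. p = 0 \<or> degree p < Suc n}"
      have "poly_shift (Suc 0) p = 0 \<or> degree (poly_shift (Suc 0) p) < n"
      proof (cases "poly_shift (Suc 0) p = 0")
        case False
        then have "degree p = Suc (degree (poly_shift (Suc 0) p))"
          by (subst split) (simp add: degree_pCons_eq)
        then show ?thesis using p by auto
      qed simp
      then show "(coeff p 0, poly_shift (Suc 0) p) \<in> UNIV \<times> {p. p = 0 \<or> degree p < n}" by simp
    qed
  qed
  then have "card ((UNIV :: bit set) \<times> {p :: bit poly. p = 0 \<or> degree p < n}) = card {p :: bit poly. p = 0 \<or> degree p < Suc n}"
    by (rule bij_betw_same_card)
  moreover have "(UNIV :: bit set) = {0, 1}" using bit.exhaust by auto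
  then have "card (UNIV :: bit set) = card {0, 1 :: bit}" by (rule arg_cong)
  then have "card (UNIV :: bit set) = 2" by simp
  ultimately show ?case using Suc.IH by (simp add: card_cartesian_product)
qed

section \<open>The quotient of the Laurent polynomial ring\<close>

text \<open>The group algebra of the integer lattice over the field of two elements, with
  convolution as product. Negative powers of z are present as well, which does not change the
  quotient: z is a unit modulo z^L - 1.\<close>

type_synonym laurent = "(int \<times> int \<times> int) \<Rightarrow>\<^sub>0 bit"

definition mon :: "int \<times> int \<times> int \<Rightarrow> laurent" where
  "mon k = Poly_Mapping.single k 1"

abbreviation "X \<equiv> mon (1, 0, 0)"
abbreviation "Y \<equiv> mon (0, 1, 0)"
abbreviation "Z \<equiv> mon (0, 0, 1)"

lemma mon_mult: "mon k * mon l = mon (k + l)"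
  by (simp add: mon_def mult_single)

lemma mon_zero: "mon (0, 0, 0) = 1"
  unfolding mon_def by (metis single_one zero_prod_def)

lemma mon_power: "mon (a, b, c) ^ n = mon (int n * a, int n * b, int n * c)"
  by (induction n) (simp_all add: mon_zero mon_mult algebra_simps)

lemma laurent_induct [case_names zero add]:
  assumes "R 0" "\<And>k t. R t \<Longrightarrow> R (mon k + t)" shows "R (t :: laurent)"
proof -
  have "Poly_Mapping.keys t \<subseteq> UNIV" by simp
  then show ?thesis by (induction rule: bit_pm_induct) (use assms in \<open>auto simp: mon_def\<close>)
qed

text \<open>The first two generators list the offsets of the factors of an X-generator on the second
  and on the first qubit of a site; the third expresses periodicity in z.\<close>

definition cubic_ideal :: "nat \<Rightarrow> laurent set" where
  "cubic_ideal L = {(1 + X + Y + Z) * u + (1 + X * Y + Y * Z + Z * X) * v + (Z ^ L - 1) * t | u v t. True}"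

lemma cubic_ideal_zero [simp]: "0 \<in> cubic_ideal L"
  unfolding cubic_ideal_def by (intro CollectI exI[of _ 0]) simp

lemma cubic_ideal_add: "s \<in> cubic_ideal L \<Longrightarrow> t \<in> cubic_ideal L \<Longrightarrow> s + t \<in> cubic_ideal L"
proof -
  assume "s \<in> cubic_ideal L" "t \<in> cubic_ideal L"
  then obtain u v w u' v' w'
    where st: "s = (1 + X + Y + Z) * u + (1 + X * Y + Y * Z + Z * X) * v + (Z ^ L - 1) * w"
      "t = (1 + X + Y + Z) * u' + (1 + X * Y + Y * Z + Z * X) * v' + (Z ^ L - 1) * w'"
    unfolding cubic_ideal_def by blast
  have "s + t = (1 + X + Y + Z) * (u + u') + (1 + X * Y + Y * Z + Z * X) * (v + v') + (Z ^ L - 1) * (w + w')"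
    unfolding st by (simp add: algebra_simps)
  then show ?thesis unfolding cubic_ideal_def by blast
qed

lemma cubic_ideal_mult: "t \<in> cubic_ideal L \<Longrightarrow> s * t \<in> cubic_ideal L"
proof -
  assume "t \<in> cubic_ideal L"
  then obtain u v w where t: "t = (1 + X + Y + Z) * u + (1 + X * Y + Y * Z + Z * X) * v + (Z ^ L - 1) * w"
    unfolding cubic_ideal_def by blast
  have "s * t = (1 + X + Y + Z) * (s * u) + (1 + X * Y + Y * Z + Z * X) * (s * v) + (Z ^ L - 1) * (s * w)"
    unfolding t by (simp add: algebra_simps)
  then show ?thesis unfolding cubic_ideal_def by blast
qed

lemma cubic_ideal_generators:
  "1 + X + Y + Z \<in> cubic_ideal L" "1 + X * Y + Y * Z + Z * X \<in> cubic_ideal L" "Z ^ L - 1 \<in> cubic_ideal L"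
proof -
  have "1 + X + Y + Z = (1 + X + Y + Z) * 1 + (1 + X * Y + Y * Z + Z * X) * 0 + (Z ^ L - 1) * 0" by simp
  then show "1 + X + Y + Z \<in> cubic_ideal L" unfolding cubic_ideal_def by blast
  have "1 + X * Y + Y * Z + Z * X = (1 + X + Y + Z) * 0 + (1 + X * Y + Y * Z + Z * X) * 1 + (Z ^ L - 1) * 0" by simp
  then show "1 + X * Y + Y * Z + Z * X \<in> cubic_ideal L" unfolding cubic_ideal_def by blast
  have "Z ^ L - 1 = (1 + X + Y + Z) * 0 + (1 + X * Y + Y * Z + Z * X) * 0 + (Z ^ L - 1) * 1" by simp
  then show "Z ^ L - 1 \<in> cubic_ideal L" unfolding cubic_ideal_def by blast
qed

text \<open>
  \<open>Quad p q\<close> stands for \<open>p + q x\<close>, where \<open>x\<close> is a root of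
  $x^2 = (1 + z) x + (1 + z + z^2)$; this equation results from eliminating \<open>y\<close>.
\<close>

datatype quad = Quad (qre: "bit poly") (qim: "bit poly")

instantiation quad :: comm_ring_1
begin

definition zero_quad :: quad where "0 = Quad 0 0"
definition one_quad :: quad where "1 = Quad 1 0"
definition plus_quad :: "quad \<Rightarrow> quad \<Rightarrow> quad" where
  "a + b = Quad (qre a + qre b) (qim a + qim b)"
definition uminus_quad :: "quad \<Rightarrow> quad" where "- a = Quad (- qre a) (- qim a)"
definition minus_quad :: "quad \<Rightarrow> quad \<Rightarrow> quad" where
  "a - b = Quad (qre a - qre b) (qim a - qim b)"
definition times_quad :: "quad \<Rightarrow> quad \<Rightarrow> quad" where
  "a * b = Quad (qre a * qre b + wP * (qim a * qim b))
     (qre a * qim b + qim a * qre b + (1 + zP) * (qim a * qim b))"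

instance
proof
  fix a b c :: quad
  show "a * b * c = a * (b * c)"
    unfolding times_quad_def quad.sel quad.inject by (intro conjI; algebra)
  show "a * b = b * a"
    unfolding times_quad_def quad.inject by (intro conjI; algebra)
  show "(a + b) * c = a * c + b * c"
    unfolding times_quad_def plus_quad_def quad.sel quad.inject by (intro conjI; algebra)
qed (simp_all add: zero_quad_def one_quad_def plus_quad_def uminus_quad_def minus_quad_def times_quad_def add_ac)

end

lemma quad_simps:
  "Quad p q + Quad p' q' = Quad (p + p') (q + q')"
  "Quad p q - Quad p' q' = Quad (p - p') (q - q')"
  "Quad p q * Quad p' q' = Quad (p * p' + wP * (q * q')) (p * q' + q * p' + (1 + zP) * (q * q'))"
  by (simp_all add: plus_quad_def minus_quad_def times_quad_def)

lemma quad_two: "a + a = 0" for a :: quad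
  by (simp add: plus_quad_def zero_quad_def)

text \<open>Divisibility by a scalar is coefficientwise, so congruence modulo \<open>m\<close> can
  stand in for a quotient of the quadratic ring.\<close>

lemma Quad_dvd_iff: "Quad m 0 dvd a \<longleftrightarrow> m dvd qre a \<and> m dvd qim a"
proof
  assume "Quad m 0 dvd a"
  then obtain b where "a = Quad m 0 * b" by (elim dvdE)
  then show "m dvd qre a \<and> m dvd qim a" by (simp add: times_quad_def)
next
  assume "m dvd qre a \<and> m dvd qim a"
  then obtain p q where "qre a = m * p" "qim a = m * q" by (auto elim!: dvdE)
  then have "a = Quad m 0 * Quad p q" by (cases a) (simp add: quad_simps)
  then show "Quad m 0 dvd a" by simp
qed

section \<open>Laurent representatives of elements of the quadratic ring\<close>

definition ev :: "bit poly \<Rightarrow> laurent" where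
  "ev p = poly (map_poly (Poly_Mapping.single 0) p) Z"

lemma ev_zero [simp]: "ev 0 = 0"
  by (simp add: ev_def)

lemma ev_pCons: "ev (pCons a p) = Poly_Mapping.single 0 a + Z * ev p"
  by (simp add: ev_def map_poly_pCons)

lemma ev_add: "ev (p + q) = ev p + ev q"
  by (induction p q rule: poly_induct2) (simp_all add: ev_pCons single_add algebra_simps)

lemma ev_smult: "ev (smult a p) = Poly_Mapping.single 0 a * ev p"
  by (induction p) (simp_all add: ev_pCons mult_single algebra_simps)

lemma ev_mult: "ev (p * q) = ev p * ev q"
  by (induction p) (simp_all add: ev_pCons ev_add ev_smult algebra_simps)

lemma ev_one [simp]: "ev 1 = 1"
  by (simp add: one_pCons ev_pCons)

lemma ev_zP: "ev zP = Z"
  by (simp add: ev_pCons)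

lemma ev_power: "ev (p ^ n) = ev p ^ n"
  by (induction n) (simp_all add: ev_mult)

lemma ev_wP: "ev wP = 1 + Z + Z\<^sup>2"
  by (simp add: wP_def ev_add ev_power ev_zP del: pCons_one)

definition lift :: "quad \<Rightarrow> laurent" where
  "lift a = ev (qre a) + ev (qim a) * X"

lemma lift_add: "lift (a + b) = lift a + lift b"
  by (simp add: lift_def plus_quad_def ev_add algebra_simps)

text \<open>The defect is a multiple of the quadratic relation for \<open>X\<close>, so
  \<open>lift\<close> is multiplicative modulo the ideal.\<close>

lemma lift_mult: "lift a * lift b + lift (a * b) \<in> cubic_ideal L"
proof -
  \<comment> \<open>\<open>X + Z\<close> is the coefficient of \<open>Y\<close> in the second
    generator of the ideal, so this combination eliminates \<open>Y\<close>.\<close>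
  have "X\<^sup>2 + (1 + Z) * X + (1 + Z + Z\<^sup>2) = (X + Z) * (1 + X + Y + Z) + 1 * (1 + X * Y + Y * Z + Z * X)"
    by (simp add: algebra_simps power2_eq_square)
  also have "\<dots> \<in> cubic_ideal L"
    by (intro cubic_ideal_add cubic_ideal_mult cubic_ideal_generators)
  finally have "ev (qim a) * ev (qim b) * (X\<^sup>2 + (1 + Z) * X + (1 + Z + Z\<^sup>2)) \<in> cubic_ideal L"
    by (rule cubic_ideal_mult)
  moreover have "lift a * lift b + lift (a * b) =
      ev (qim a) * ev (qim b) * (X\<^sup>2 + (1 + Z) * X + (1 + Z + Z\<^sup>2))"
    unfolding lift_def times_quad_def quad.sel ev_add ev_mult ev_wP ev_zP ev_one
    by (simp add: algebra_simps power2_eq_square)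
  ultimately show ?thesis by simp
qed

lemma lift_Quad: "lift (Quad p q) = ev p + ev q * X"
  by (simp add: lift_def)

text \<open>Applied to the values of x, y, z in the quadratic ring: it turns a sum evaluated term by
  term back into multiples of the three relations, with \<open>r + 1\<close> in place of
  \<open>r - 1\<close>.\<close>

lemma regroup:
  "(u + x * u + y * u + z * u) + (v + x * (y * v) + y * (z * v) + z * (x * v)) + (r * w + w) =
    (1 + x + y + z) * u + (1 + x * y + y * z + z * x) * v + (r + 1) * w"
  for u v w x y z r :: "'a :: comm_ring_1"
  by (simp add: algebra_simps)

locale cubic_quotient =
  fixes L :: nat and m s q :: "bit poly" and e :: nat
  assumes L: "L \<ge> 1" and factorization: "zP ^ L - 1 = m * wP ^ e" and bezout: "m * s + wP * q = 1"
    and m_nonzero: "m \<noteq> 0"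
begin

section \<open>Reduction of Laurent polynomials to the quadratic ring\<close>

abbreviation "I \<equiv> cubic_ideal L"

text \<open>Says that the quadratic ring reaches the class of \<open>t\<close>. Such elements form a
  subring, so the point is to show that it contains the inverses of the variables.\<close>

definition "reducible t \<longleftrightarrow> (\<exists>a. t + lift a \<in> I)"

lemma cong_trans: "r + t \<in> I \<Longrightarrow> t + u \<in> I \<Longrightarrow> r + u \<in> I" for r t u
  using cubic_ideal_add[of "r + t" L "t + u"] by (simp add: add.assoc)

lemma cong_mult:
  assumes "r + r' \<in> I" "t + t' \<in> I" shows "r * t + r' * t' \<in> I"
proof -
  have "r * t + r' * t' = t * (r + r') + r' * (t + t')" by (simp add: algebra_simps)
  then show ?thesis using assms by (simp add: cubic_ideal_add cubic_ideal_mult)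
qed

lemma reducible_cong: "r + t \<in> I \<Longrightarrow> reducible t \<Longrightarrow> reducible r"
  unfolding reducible_def using cong_trans by blast

lemma reducible_lift: "reducible (lift a)"
  unfolding reducible_def by (rule exI[of _ a]) simp

lemma reducible_add: "reducible r \<Longrightarrow> reducible t \<Longrightarrow> reducible (r + t)"
proof -
  assume "reducible r" "reducible t"
  then obtain a b where "r + lift a \<in> I" "t + lift b \<in> I" unfolding reducible_def by blast
  then have "(r + lift a) + (t + lift b) \<in> I" by (rule cubic_ideal_add)
  then have "(r + t) + lift (a + b) \<in> I" by (simp add: lift_add ac_simps)
  then show ?thesis unfolding reducible_def by blast
qed

lemma reducible_mult: "reducible r \<Longrightarrow> reducible t \<Longrightarrow> reducible (r * t)"
proof -
  assume "reducible r" "reducible t"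
  then obtain a b where "r + lift a \<in> I" "t + lift b \<in> I" unfolding reducible_def by blast
  then have "r * t + lift a * lift b \<in> I" by (rule cong_mult)
  then have "r * t + lift (a * b) \<in> I" using lift_mult by (rule cong_trans)
  then show ?thesis unfolding reducible_def by blast
qed

lemma reducible_power: "reducible t \<Longrightarrow> reducible (t ^ n)"
proof (induction n)
  case 0
  have "lift 1 = 1" by (simp add: lift_def one_quad_def)
  then show ?case using reducible_lift[of 1] by simp
qed (simp add: reducible_mult)

lemma reducible_X: "reducible X"
  using reducible_lift[of "Quad 0 1"] by (simp add: lift_Quad)

lemma reducible_ev: "reducible (ev p)"
  using reducible_lift[of "Quad p 0"] by (simp add: lift_Quad)

lemma reducible_Z: "reducible Z"
  using reducible_ev[of zP] by (simp only: ev_zP)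

lemma reducible_Y: "reducible Y"
proof (rule reducible_cong)
  show "Y + (1 + X + Z) \<in> I"
    using cubic_ideal_generators(1)[of L] by (simp add: ac_simps)
  show "reducible (1 + X + Z)"
    using reducible_ev[of 1] by (intro reducible_add reducible_X reducible_Z) simp
qed

lemma XY_cong: "X * Y + ev wP \<in> I"
proof -
  have "X * Y + ev wP = Z * (1 + X + Y + Z) + 1 * (1 + X * Y + Y * Z + Z * X)"
    by (simp add: ev_wP algebra_simps power2_eq_square)
  then show ?thesis
    by (simp only:) (intro cubic_ideal_add cubic_ideal_mult cubic_ideal_generators)
qed

lemma ev_factorization: "ev m * ev wP ^ e = Z ^ L - 1"
  using arg_cong[OF factorization, of ev] by (simp add: bit_poly_diff pm_minus_eq_plus ev_add ev_mult ev_power ev_zP del: pCons_one)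

lemma ev_wP_power_cong: "ev wP ^ n + (X * Y) ^ n \<in> I"
proof (induction n)
  case (Suc n)
  have "ev wP + X * Y \<in> I" using XY_cong by (simp add: add.commute)
  then have "ev wP * ev wP ^ n + (X * Y) * (X * Y) ^ n \<in> I" using Suc.IH by (rule cong_mult)
  then show ?case by simp
qed simp

text \<open>\<open>m * wP ^ e\<close> is \<open>zP ^ L - 1\<close>, and modulo the ideal
  \<open>wP\<close> is the invertible monomial \<open>X * Y\<close>; multiplying by the inverse of
  its power removes the second factor.\<close>

lemma ev_m_in_ideal: "ev m \<in> I"
proof -
  have "ev m * ev wP ^ e + ev m * (X * Y) ^ e \<in> I"
    using ev_wP_power_cong by (intro cong_mult) simp_all
  moreover have "ev m * ev wP ^ e \<in> I" unfolding ev_factorization by (rule cubic_ideal_generators)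
  ultimately have "ev m * (X * Y) ^ e \<in> I"
    using cubic_ideal_add[of "ev m * ev wP ^ e" L "ev m * ev wP ^ e + ev m * (X * Y) ^ e"] by simp
  then have "mon (- int e, - int e, 0) * (ev m * (X * Y) ^ e) \<in> I" by (rule cubic_ideal_mult)
  moreover have "mon (- int e, - int e, 0) * (ev m * (X * Y) ^ e) = ev m"
  proof -
    have "mon (- int e, - int e, 0) * (X * Y) ^ e = 1"
      by (simp add: mon_mult mon_power mon_zero)
    then show ?thesis by (simp only: mult.left_commute[of _ "ev m"] mult_1_right)
  qed
  ultimately show ?thesis by simp
qed

lemma ev_wP_inverse: "ev wP * ev q + 1 \<in> I"
proof -
  have "ev m * ev s + ev wP * ev q = 1"
    using arg_cong[OF bezout, of ev] by (simp add: ev_add ev_mult)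
  then have "ev wP * ev q + 1 = ev s * ev m"
    by (metis add.commute mult.commute pm_add_self_left)
  then show ?thesis by (simp add: cubic_ideal_mult ev_m_in_ideal)
qed

lemma XY_inverse: "X * Y * ev q + 1 \<in> I"
proof (rule cong_trans)
  show "X * Y * ev q + ev wP * ev q \<in> I"
    using XY_cong by (intro cong_mult) simp_all
qed (rule ev_wP_inverse)

text \<open>Inverses are unique: an inverse \<open>t\<close> of \<open>u\<close> modulo the ideal is
  congruent to the true inverse \<open>v\<close>.\<close>

lemma reducible_inverse:
  assumes "u * v = 1" "u * t + 1 \<in> I" "reducible t" shows "reducible v"
proof (rule reducible_cong)
  have "v * (u * t + 1) \<in> I" using assms(2) by (rule cubic_ideal_mult)
  moreover have "v * (u * t + 1) = (u * v) * t + v" by (simp add: algebra_simps)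
  ultimately show "v + t \<in> I" using assms(1) by (simp add: add.commute)
qed (rule assms(3))

lemma reducible_mon: "reducible (mon k)"
proof -
  obtain a b c where k: "k = (a, b, c)" by (metis prod.collapse)
  \<comment> \<open>The product of x and y has inverse \<open>q\<close> modulo the ideal, so
    \<open>Y * ev q\<close> represents 1/x and \<open>X * ev q\<close> represents 1/y; periodicity
    gives \<open>Z ^ (L - 1)\<close> for 1/z.\<close>
  have X': "reducible (mon (- 1, 0, 0))"
  proof (rule reducible_inverse[of X])
    show "X * (Y * ev q) + 1 \<in> I" using XY_inverse by (simp add: mult.assoc)
  qed (simp_all add: mon_mult mon_zero reducible_mult reducible_Y reducible_ev)
  have Y': "reducible (mon (0, - 1, 0))"
  proof (rule reducible_inverse[of Y])
    show "Y * (X * ev q) + 1 \<in> I" using XY_inverse by (simp add: ac_simps)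
  qed (simp_all add: mon_mult mon_zero reducible_mult reducible_X reducible_ev)
  have Z': "reducible (mon (0, 0, - 1))"
  proof (rule reducible_inverse[of Z])
    have "Z * Z ^ (L - 1) = Z ^ L" using L by (metis Suc_diff_1 less_eq_Suc_le One_nat_def power_Suc)
    then show "Z * Z ^ (L - 1) + 1 \<in> I"
      using cubic_ideal_generators(3)[of L] by (simp add: pm_minus_eq_plus)
  qed (simp_all add: mon_mult mon_zero reducible_power reducible_Z)
  have "mon k = mon (a, 0, 0) * mon (0, b, 0) * mon (0, 0, c)" by (simp add: k mon_mult)
  moreover have "reducible (mon (a, 0, 0))"
    using reducible_power[OF reducible_X, of "nat a"] reducible_power[OF X', of "nat (- a)"]
    by (cases "a \<ge> 0") (simp_all add: mon_power)
  moreover have "reducible (mon (0, b, 0))"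
    using reducible_power[OF reducible_Y, of "nat b"] reducible_power[OF Y', of "nat (- b)"]
    by (cases "b \<ge> 0") (simp_all add: mon_power)
  moreover have "reducible (mon (0, 0, c))"
    using reducible_power[OF reducible_Z, of "nat c"] reducible_power[OF Z', of "nat (- c)"]
    by (cases "c \<ge> 0") (simp_all add: mon_power)
  ultimately show ?thesis by (simp add: reducible_mult)
qed

lemma reducible: "reducible t"
proof (induction t rule: laurent_induct)
  case zero
  have "lift 0 = 0" by (simp add: lift_def zero_quad_def)
  then show ?case using reducible_lift[of 0] by simp
qed (simp add: reducible_add reducible_mon)

section \<open>Evaluation of Laurent polynomials in the quadratic ring modulo
  \<open>m\<close>\<close>

abbreviation "M \<equiv> Quad m 0"
definition "xQ = Quad 0 1"
text \<open>The value forced by 1 + x + y + z = 0.\<close>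

definition "yQ = Quad (1 + zP) 1"
definition "zQ = Quad zP 0"

definition qcong :: "quad \<Rightarrow> quad \<Rightarrow> bool" where "qcong a b \<longleftrightarrow> M dvd a + b"

lemma qcong_refl [simp]: "qcong a a"
  by (simp add: qcong_def quad_two)

lemma qcong_sym: "qcong a b \<Longrightarrow> qcong b a"
  by (simp add: qcong_def add.commute)

lemma quad_two_left [simp]: "a + (a + b) = b" "a + a = 0" for a b :: quad
  by (simp_all add: quad_two flip: add.assoc)

lemma qcong_trans [trans]: "qcong a b \<Longrightarrow> qcong b c \<Longrightarrow> qcong a c"
  unfolding qcong_def using dvd_add[of M "a + b" "b + c"] by (simp add: add.assoc)

lemma qcong_add: "qcong a b \<Longrightarrow> qcong c d \<Longrightarrow> qcong (a + c) (b + d)"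
  unfolding qcong_def using dvd_add[of M "a + b" "c + d"] by (simp add: ac_simps)

lemma qcong_mult_left: "qcong a b \<Longrightarrow> qcong (c * a) (c * b)"
  unfolding qcong_def by (simp flip: distrib_left)

lemma qcong_mult: "qcong a b \<Longrightarrow> qcong c d \<Longrightarrow> qcong (a * c) (b * d)"
  by (metis mult.commute qcong_mult_left qcong_trans)

text \<open>Inverses modulo \<open>m\<close> of the three values: \<open>xQ * yQ\<close> is
  \<open>wP\<close>, which \<open>q\<close> inverts by the Bezout relation, and
  \<open>zQ ^ L\<close> is 1 because \<open>m\<close> divides \<open>zP ^ L - 1\<close>.\<close>

definition "x'Q = yQ * Quad q 0"
definition "y'Q = xQ * Quad q 0"
definition "z'Q = zQ ^ (L - 1)"

lemma Quad_bezout: "qcong (Quad (wP * q) 0) 1"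
proof -
  have "wP * q + 1 = m * s" using bezout by (metis add.commute add.left_commute bit_poly_add_self add.right_neutral)
  then show ?thesis by (simp add: qcong_def Quad_dvd_iff one_quad_def plus_quad_def)
qed

lemma xQ_yQ: "xQ * yQ = Quad wP 0"
  by (simp add: xQ_def yQ_def quad_simps algebra_simps)

lemma x'Q: "qcong (xQ * x'Q) 1"
  unfolding x'Q_def mult.assoc[symmetric] xQ_yQ using Quad_bezout by (simp add: quad_simps)

lemma y'Q: "qcong (yQ * y'Q) 1"
  unfolding y'Q_def mult.assoc[symmetric] mult.commute[of yQ] xQ_yQ using Quad_bezout by (simp add: quad_simps)

lemma zQ_power: "zQ ^ n = Quad (zP ^ n) 0"
  by (induction n) (simp_all add: one_quad_def zQ_def quad_simps)

lemma zQ_L: "qcong (zQ ^ L) 1"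
  using factorization by (simp add: qcong_def zQ_power Quad_dvd_iff one_quad_def plus_quad_def bit_poly_diff)

lemma z'Q: "qcong (zQ * z'Q) 1"
proof -
  have "zQ * z'Q = zQ ^ L" unfolding z'Q_def using L by (metis Suc_diff_1 less_eq_Suc_le One_nat_def power_Suc)
  then show ?thesis using zQ_L by simp
qed

text \<open>Integer powers with a prescribed inverse \<open>a'\<close>. In the applications it is an
  inverse only up to \<open>qcong\<close>, so the exponent law is stated up to
  \<open>qcong\<close>.\<close>

definition pw :: "quad \<Rightarrow> quad \<Rightarrow> int \<Rightarrow> quad" where
  "pw a a' n = (if n \<ge> 0 then a ^ nat n else a' ^ nat (- n))"

lemma pw_add_1:
  assumes "qcong (a * a') 1" shows "qcong (pw a a' (n + 1)) (a * pw a a' n)"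
proof (cases "n \<ge> 0")
  case True
  then have "nat (n + 1) = Suc (nat n)" by simp
  then show ?thesis using True by (simp add: pw_def)
next
  case False
  then have "nat (- n) = Suc (nat (- (n + 1)))" by simp
  then have "a * pw a a' n = (a * a') * a' ^ nat (- (n + 1))" using False by (simp add: pw_def mult.assoc)
  moreover have "pw a a' (n + 1) = 1 * a' ^ nat (- (n + 1))" using False by (simp add: pw_def)
  ultimately show ?thesis using assms by (metis qcong_mult qcong_refl qcong_sym)
qed

definition mon_value :: "int \<times> int \<times> int \<Rightarrow> quad" where
  "mon_value = (\<lambda>(a, b, c). pw xQ x'Q a * (pw yQ y'Q b * pw zQ z'Q c))"

lemma mon_value_shift:
  "qcong (mon_value ((1, 0, 0) + k)) (xQ * mon_value k)"
  "qcong (mon_value ((0, 1, 0) + k)) (yQ * mon_value k)"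
  "qcong (mon_value ((0, 0, 1) + k)) (zQ * mon_value k)"
proof -
  obtain a b c where k: "k = (a, b, c)" by (metis prod.collapse)
  show "qcong (mon_value ((1, 0, 0) + k)) (xQ * mon_value k)"
    using qcong_mult[OF pw_add_1[OF x'Q, of a] qcong_refl[of "pw yQ y'Q b * pw zQ z'Q c"]]
    by (simp add: mon_value_def k ac_simps)
  show "qcong (mon_value ((0, 1, 0) + k)) (yQ * mon_value k)"
    using qcong_mult[OF pw_add_1[OF y'Q, of b] qcong_refl[of "pw xQ x'Q a * pw zQ z'Q c"]]
    by (simp add: mon_value_def k ac_simps)
  show "qcong (mon_value ((0, 0, 1) + k)) (zQ * mon_value k)"
    using qcong_mult[OF pw_add_1[OF z'Q, of c] qcong_refl[of "pw xQ x'Q a * pw yQ y'Q b"]]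
    by (simp add: mon_value_def k ac_simps)
qed

definition val :: "laurent \<Rightarrow> quad" where
  "val t = (\<Sum>k\<in>Poly_Mapping.keys t. mon_value k)"

lemma val_mon: "val (mon k) = mon_value k"
  by (simp add: val_def mon_def)

lemma val_zero [simp]: "val 0 = 0"
  by (simp add: val_def)

lemma val_add: "val (r + t) = val r + val t"
proof -
  \<comment> \<open>Extends the sum from the support to any finite superset, so that both summands
    share an index set. Monomials common to both then cancel, as \<open>a + a = 0\<close> in the
    quadratic ring.\<close>
  have expand: "val u = (\<Sum>k\<in>A. if Poly_Mapping.lookup u k = 1 then mon_value k else 0)"
    if "finite A" "Poly_Mapping.keys u \<subseteq> A" for u A
  proof -
    have "val u = (\<Sum>k\<in>Poly_Mapping.keys u. if Poly_Mapping.lookup u k = 1 then mon_value k else 0)"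
      unfolding val_def by (rule sum.cong) (auto simp: in_keys_iff)
    also have "\<dots> = (\<Sum>k\<in>A. if Poly_Mapping.lookup u k = 1 then mon_value k else 0)"
      by (rule sum.mono_neutral_left) (use that in \<open>auto simp: in_keys_iff\<close>)
    finally show ?thesis .
  qed
  let ?A = "Poly_Mapping.keys r \<union> Poly_Mapping.keys t"
  have "val (r + t) = (\<Sum>k\<in>?A. if Poly_Mapping.lookup (r + t) k = 1 then mon_value k else 0)"
    by (rule expand) (use keys_add[of r t] in auto)
  also have "\<dots> = (\<Sum>k\<in>?A. (if Poly_Mapping.lookup r k = 1 then mon_value k else 0) +
      (if Poly_Mapping.lookup t k = 1 then mon_value k else 0))"
  proof (rule sum.cong)
    fix k
    show "(if Poly_Mapping.lookup (r + t) k = 1 then mon_value k else 0) =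
        (if Poly_Mapping.lookup r k = 1 then mon_value k else 0) +
        (if Poly_Mapping.lookup t k = 1 then mon_value k else 0)"
      by (cases "Poly_Mapping.lookup r k"; cases "Poly_Mapping.lookup t k") (simp_all add: lookup_add)
  qed simp
  also have "\<dots> = val r + val t" by (simp add: sum.distrib expand[of ?A])
  finally show ?thesis .
qed

lemma val_mon_mult:
  assumes "\<And>k. qcong (mon_value (l + k)) (a * mon_value k)"
  shows "qcong (val (mon l * t)) (a * val t)"
proof (induction t rule: laurent_induct)
  case (add k t)
  then show ?case
    using qcong_add[OF assms[of k] add] by (simp add: val_add distrib_left mon_mult val_mon)
qed simp

lemma val_X: "qcong (val (X * t)) (xQ * val t)"
  and val_Y: "qcong (val (Y * t)) (yQ * val t)"
  and val_Z: "qcong (val (Z * t)) (zQ * val t)"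
  by (rule val_mon_mult mon_value_shift)+

lemma val_Z_power: "qcong (val (Z ^ n * t)) (zQ ^ n * val t)"
proof (induction n)
  case (Suc n)
  have "qcong (val (Z * (Z ^ n * t))) (zQ * val (Z ^ n * t))" by (rule val_Z)
  also have "qcong \<dots> (zQ * (zQ ^ n * val t))" by (rule qcong_mult_left[OF Suc.IH])
  finally show ?case by (simp add: mult.assoc)
qed simp

text \<open>The values of x, y, z satisfy the first two relations exactly and periodicity modulo
  \<open>m\<close>, so evaluation descends to the quotient.\<close>

lemma val_ideal:
  assumes "t \<in> I" shows "qcong (val t) 0"
proof -
  obtain u v w where t: "t = (1 + X + Y + Z) * u + (1 + X * Y + Y * Z + Z * X) * v + (Z ^ L - 1) * w"
    using assms unfolding cubic_ideal_def by blast
  have 1: "val t = (val u + val (X * u) + val (Y * u) + val (Z * u)) +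
      (val v + val (X * (Y * v)) + val (Y * (Z * v)) + val (Z * (X * v))) + (val (Z ^ L * w) + val w)"
    unfolding t by (simp add: distrib_right val_add pm_minus_eq_plus mult.assoc)
  have XY: "qcong (val (X * (Y * v))) (xQ * (yQ * val v))"
    by (rule qcong_trans[OF val_X qcong_mult_left[OF val_Y]])
  have YZ: "qcong (val (Y * (Z * v))) (yQ * (zQ * val v))"
    by (rule qcong_trans[OF val_Y qcong_mult_left[OF val_Z]])
  have ZX: "qcong (val (Z * (X * v))) (zQ * (xQ * val v))"
    by (rule qcong_trans[OF val_Z qcong_mult_left[OF val_X]])
  have 2: "qcong (val t) ((val u + xQ * val u + yQ * val u + zQ * val u) +
      (val v + xQ * (yQ * val v) + yQ * (zQ * val v) + zQ * (xQ * val v)) + (zQ ^ L * val w + val w))"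
    unfolding 1 by (intro qcong_add XY YZ ZX val_X val_Y val_Z val_Z_power) simp_all
  have "1 + xQ + yQ + zQ = 0"
    by (simp only: xQ_def yQ_def zQ_def one_quad_def zero_quad_def quad_simps)
      (simp add: one_pCons del: pCons_one)
  moreover have "1 + xQ * yQ + yQ * zQ + zQ * xQ = 0"
    by (simp only: xQ_yQ, simp only: xQ_def yQ_def zQ_def one_quad_def zero_quad_def quad_simps)
      (simp add: wP_eq one_pCons del: pCons_one)
  ultimately have 3: "qcong (val t) ((zQ ^ L + 1) * val w)"
    using 2 unfolding regroup by simp
  have "qcong ((zQ ^ L + 1) * val w) ((1 + 1) * val w)"
    by (intro qcong_mult qcong_add zQ_L qcong_refl)
  then have "qcong ((zQ ^ L + 1) * val w) 0" by (simp add: quad_two)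
  with 3 show ?thesis by (rule qcong_trans)
qed

lemma mon_value_zero: "mon_value (0, 0, 0) = 1"
  by (simp add: mon_value_def pw_def)

lemma val_ev: "qcong (val (ev p)) (Quad p 0)"
proof (induction p)
  case 0
  show ?case by (simp flip: zero_quad_def)
next
  case (pCons a p)
  have "qcong (val (Z * ev p)) (zQ * Quad p 0)"
    using val_Z qcong_mult_left[OF pCons.IH] by (rule qcong_trans)
  moreover have "val (Poly_Mapping.single 0 a) = Quad [:a:] 0"
  proof (cases "a = 1")
    case True
    have "Poly_Mapping.single 0 (1 :: bit) = mon (0, 0, 0)" by (simp add: mon_def zero_prod_def)
    then have "val (Poly_Mapping.single 0 a) = mon_value (0, 0, 0)" by (simp only: True val_mon)
    then show ?thesis by (simp only: True mon_value_zero one_quad_def pCons_one)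
  qed (simp add: zero_quad_def)
  ultimately have "qcong (val (ev (pCons a p))) (Quad [:a:] 0 + zQ * Quad p 0)"
    by (simp add: ev_pCons val_add qcong_add)
  then show ?case by (simp add: zQ_def quad_simps)
qed

lemma val_lift: "qcong (val (lift a)) a"
proof -
  have "val (lift a) = val (ev (qre a)) + val (X * ev (qim a))"
    by (simp add: lift_def val_add mult.commute)
  also have "qcong \<dots> (Quad (qre a) 0 + xQ * Quad (qim a) 0)"
    by (intro qcong_add val_ev qcong_trans[OF val_X qcong_mult_left])
  also have "\<dots> = a" by (cases a) (simp add: xQ_def quad_simps)
  finally show ?thesis .
qed

text \<open>Injectivity on the quotient: \<open>t\<close> reduces to some \<open>lift a\<close>,
  whose evaluation is \<open>a\<close> modulo \<open>m\<close>. If this vanishes,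
  \<open>lift a\<close> is a multiple of \<open>ev m\<close>, which lies in the ideal.\<close>

lemma val_cong_zero_iff: "qcong (val t) 0 \<longleftrightarrow> t \<in> I"
proof
  assume t: "qcong (val t) 0"
  obtain a where a: "t + lift a \<in> I" using reducible[of t] unfolding reducible_def by blast
  have "qcong (val t + val (lift a)) 0" using val_ideal[OF a] by (simp add: val_add)
  with qcong_add[OF this t] have "qcong (val (lift a)) 0" by (simp add: ac_simps)
  then have "qcong a 0" using val_lift qcong_sym qcong_trans by blast
  then obtain p r where "qre a = m * p" "qim a = m * r"
    by (auto simp: qcong_def Quad_dvd_iff elim!: dvdE)
  then have "lift a = (ev p + ev r * X) * ev m" by (simp add: lift_def ev_mult algebra_simps)
  then have "lift a \<in> I" using ev_m_in_ideal by (simp add: cubic_ideal_mult)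
  then have "(t + lift a) + lift a \<in> I" by (rule cubic_ideal_add[OF a])
  then show "t \<in> I" by (simp add: add.assoc)
qed (rule val_ideal)

text \<open>Remainders turn congruence modulo \<open>m\<close> into equality, so that classes can be
  counted as values.\<close>

definition nf :: "laurent \<Rightarrow> bit poly \<times> bit poly" where
  "nf t = (qre (val t) mod m, qim (val t) mod m)"

lemma nf_eq_iff: "nf t = nf t' \<longleftrightarrow> t + t' \<in> I"
proof -
  have "nf t = nf t' \<longleftrightarrow> m dvd qre (val t) - qre (val t') \<and> m dvd qim (val t) - qim (val t')"
    by (simp add: nf_def mod_eq_dvd_iff)
  also have "\<dots> \<longleftrightarrow> qcong (val (t + t')) 0"
    by (simp add: qcong_def Quad_dvd_iff val_add plus_quad_def bit_poly_diff zero_quad_def)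
  finally show ?thesis by (simp add: val_cong_zero_iff)
qed

lemma range_nf: "range nf = {p. p = 0 \<or> degree p < degree m} \<times> {p. p = 0 \<or> degree p < degree m}"
proof (rule subset_antisym)
  show "range nf \<subseteq> {p. p = 0 \<or> degree p < degree m} \<times> {p. p = 0 \<or> degree p < degree m}"
    using degree_mod_less[OF m_nonzero] by (auto simp: nf_def)
  show "{p. p = 0 \<or> degree p < degree m} \<times> {p. p = 0 \<or> degree p < degree m} \<subseteq> range nf"
  proof
    fix x :: "bit poly \<times> bit poly" assume "x \<in> {p. p = 0 \<or> degree p < degree m} \<times> {p. p = 0 \<or> degree p < degree m}"
    then obtain p r where x: "x = (p, r)" and "p mod m = p" "r mod m = r"
      by (auto simp: mod_poly_less)
    have "m dvd qre (val (lift (Quad p r))) - p" "m dvd qim (val (lift (Quad p r))) - r"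
      using val_lift[of "Quad p r"] by (auto simp: qcong_def Quad_dvd_iff plus_quad_def bit_poly_diff)
    then have "nf (lift (Quad p r)) = (p mod m, r mod m)" by (simp add: nf_def mod_eq_dvd_iff)
    then show "x \<in> range nf" using \<open>p mod m = p\<close> \<open>r mod m = r\<close> by (metis x rangeI)
  qed
qed

lemma card_range_nf: "card (range nf) = 2 ^ (2 * degree m)"
  by (simp add: range_nf card_cartesian_product card_bit_poly_degree_less mult_2 power_add)

end

lemma ex_cubic_normal_form:
  fixes L i l :: nat
  assumes "L \<ge> 1" "L = 2 ^ i * l" "odd l"
  shows "\<exists>nf :: laurent \<Rightarrow> bit poly \<times> bit poly. (\<forall>t t'. nf t = nf t' \<longleftrightarrow> t + t' \<in> cubic_ideal L) \<and>
    card (range nf) = 2 ^ (if 3 dvd L then 2 * L - 2 ^ (i + 2) else 2 * L)"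
proof -
  obtain m e s q where *: "zP ^ L - 1 = m * wP ^ e" "m * s + wP * q = 1" "m \<noteq> 0"
    and deg: "2 * degree m = (if 3 dvd L then 2 * L - 2 ^ (i + 2) else 2 * L)"
    using compactification_factorization[OF assms] by blast
  interpret cubic_quotient L m s q e by standard (use * assms(1) in auto)
  show ?thesis using nf_eq_iff card_range_nf unfolding deg by blast
qed

section \<open>Anyons of the compactified cubic code\<close>

text \<open>Created patterns are sums of patterns created on single qubits, so membership in an
  additive subgroup can be tested there. The values on \<open>I\<close> determine a pattern, since
  its support lies in \<open>I\<close>.\<close>

lemma created_patterns_subset:
  assumes "additive_subgroup H"
    and single: "\<And>q s. q \<in> Q \<Longrightarrow> \<exists>A\<in>H. Poly_Mapping.keys A \<subseteq> I \<and>
      (\<forall>i\<in>I. Poly_Mapping.lookup A i = anticomm (Poly_Mapping.single (q, s) 1) (g i))"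
  shows "created_patterns Q I g \<subseteq> H"
proof
  fix A assume "A \<in> created_patterns Q I g"
  then obtain P where A: "Poly_Mapping.keys A \<subseteq> I" and P: "P \<in> paulis_on Q"
    "\<forall>i\<in>I. Poly_Mapping.lookup A i = anticomm P (g i)" unfolding created_patterns_def by blast
  have "\<exists>B\<in>H. Poly_Mapping.keys B \<subseteq> I \<and> (\<forall>i\<in>I. Poly_Mapping.lookup B i = anticomm P (g i))"
    using P(1)
  proof (induction rule: pauli_induct)
    case zero
    show ?case using assms(1) by (intro bexI[of _ 0]) (simp_all add: additive_subgroup_def)
  next
    case (add q s P)
    obtain B where B: "B \<in> H" "Poly_Mapping.keys B \<subseteq> I" "\<forall>i\<in>I. Poly_Mapping.lookup B i = anticomm P (g i)"
      using add(3) by blast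
    obtain C where C: "C \<in> H" "Poly_Mapping.keys C \<subseteq> I"
      "\<forall>i\<in>I. Poly_Mapping.lookup C i = anticomm (Poly_Mapping.single (q, s) 1) (g i)"
      using single[OF add(1)] by blast
    have "C + B \<in> H" using assms(1) B(1) C(1) by (simp add: additive_subgroup_def)
    moreover have "Poly_Mapping.keys (C + B) \<subseteq> I" using C(2) B(2) by (rule keys_add_subset)
    ultimately show ?case using B(3) C(3) by (intro bexI[of _ "C + B"]) (simp_all add: lookup_add anticomm_add_left)
  qed
  then obtain B where B: "B \<in> H" "Poly_Mapping.keys B \<subseteq> I" "\<forall>i\<in>I. Poly_Mapping.lookup B i = anticomm P (g i)"
    by blast
  have "A = B"
  proof (rule poly_mapping_eqI)
    fix i
    show "Poly_Mapping.lookup A i = Poly_Mapping.lookup B i"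
    proof (cases "i \<in> I")
      case True
      then show ?thesis using B(3) P(2) by simp
    next
      case False
      then have "i \<notin> Poly_Mapping.keys A" "i \<notin> Poly_Mapping.keys B" using A B(2) by blast+
      then show ?thesis by (simp only: not_in_keys_iff_lookup_eq_zero)
    qed
  qed
  then show "A \<in> H" using B(1) by simp
qed

lemma created_patterns_if_single_qubit:
  assumes "q \<in> Q" "Poly_Mapping.keys A \<subseteq> I"
    and "\<And>i. i \<in> I \<Longrightarrow> Poly_Mapping.lookup A i = anticomm (Poly_Mapping.single (q, s) 1) (g i)"
  shows "A \<in> created_patterns Q I g"
  unfolding created_patterns_def using assms by (auto intro!: bexI[of _ "Poly_Mapping.single (q, s) 1"])

section \<open>Independence of the generators of the compactified code\<close>

lemma Xop_in_paulis_on [simp]: "Xop q \<in> paulis_on Q \<longleftrightarrow> q \<in> Q"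
  and Zop_in_paulis_on [simp]: "Zop q \<in> paulis_on Q \<longleftrightarrow> q \<in> Q"
  by (simp_all add: Xop_def Zop_def)

lemma lookup_Xop: "Poly_Mapping.lookup (Xop q) (q', s) = of_bool (q = q' \<and> s = PX)"
  and lookup_Zop: "Poly_Mapping.lookup (Zop q) (q', s) = of_bool (q = q' \<and> s = PZ)"
  by (auto simp: Xop_def Zop_def lookup_single when_def)

lemma ex_max_on: "finite F \<Longrightarrow> F \<noteq> {} \<Longrightarrow> \<exists>i\<in>F. \<forall>j\<in>F. f j \<le> (f i :: int)"
proof -
  assume F: "finite F" "F \<noteq> {}"
  then have "Max (f ` F) \<in> f ` F" by (intro Max_in) simp_all
  then obtain i where "i \<in> F" "f i = Max (f ` F)" by auto
  then show ?thesis using F(1) by (intro bexI[of _ i]) simp_all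
qed

lemma compact_gen_simps:
  "compact_gen L ((x, y), (z, PX)) =
     Xop ((x, y), (z mod int L, First)) + Xop ((x + 1, y + 1), (z mod int L, First)) +
     Xop ((x, y + 1), ((z + 1) mod int L, First)) + Xop ((x + 1, y), ((z + 1) mod int L, First)) +
     Xop ((x, y), (z mod int L, Second)) + Xop ((x + 1, y), (z mod int L, Second)) +
     Xop ((x, y + 1), (z mod int L, Second)) + Xop ((x, y), ((z + 1) mod int L, Second))"
  "compact_gen L ((x, y), (z, PZ)) =
     Zop ((x + 1, y + 1), ((z + 1) mod int L, First)) + Zop ((x + 1, y + 1), (z mod int L, First)) +
     Zop ((x, y + 1), ((z + 1) mod int L, First)) + Zop ((x + 1, y), ((z + 1) mod int L, First)) +
     Zop ((x + 1, y + 1), ((z + 1) mod int L, Second)) + Zop ((x + 1, y), (z mod int L, Second)) +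
     Zop ((x, y + 1), (z mod int L, Second)) + Zop ((x, y), ((z + 1) mod int L, Second))"
  by (simp_all add: relabel_add relabel_Xop relabel_Zop)

lemma compact_gen_extremal:
  assumes "finite F" "F \<noteq> {}" "F \<subseteq> compact_gens L"
  shows "\<exists>i\<in>F. \<exists>k. Poly_Mapping.lookup (compact_gen L i) k \<noteq> 0 \<and>
    (\<forall>j\<in>F. j \<noteq> i \<longrightarrow> Poly_Mapping.lookup (compact_gen L j) k = 0)"
proof (cases "\<exists>i\<in>F. snd (snd i) = PX")
  case True
  let ?G = "{i\<in>F. snd (snd i) = PX}"
  have "finite ?G" using assms(1) by simp
  moreover have "?G \<noteq> {}" using True by blast
  ultimately have "\<exists>i\<in>?G. \<forall>j\<in>?G. fst (fst j) \<le> fst (fst i)" by (rule ex_max_on)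
  then obtain i
    where i: "i \<in> F" "snd (snd i) = PX" and max: "\<And>j. j \<in> F \<Longrightarrow> snd (snd j) = PX \<Longrightarrow> fst (fst j) \<le> fst (fst i)"
    by blast
  obtain x y z t where xyz': "i = ((x, y), (z, t))" by (metis prod.collapse)
  with i(2) have xyz: "i = ((x, y), (z, PX))" by simp
  have z: "z mod int L = z" using subsetD[OF assms(3) i(1)] by (simp add: xyz compact_gens_def)
  \<comment> \<open>With \<open>x\<close> maximal, no other X-generator reaches this qubit. It
    carries the only second-qubit factor at \<open>x + 1\<close>, so wrapping cannot cancel it even
    for small \<open>L\<close>.\<close>
  have "Poly_Mapping.lookup (compact_gen L i) (((x + 1, y), (z, Second)), PX) \<noteq> 0"
    by (simp add: xyz compact_gen_simps lookup_add lookup_Xop z del: compact_gen.simps)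
  moreover have "Poly_Mapping.lookup (compact_gen L j) (((x + 1, y), (z, Second)), PX) = 0"
    if "j \<in> F" "j \<noteq> i" for j
  proof -
    obtain x' y' z' t where j: "j = ((x', y'), (z', t))" by (metis prod.collapse)
    have z': "z' mod int L = z'" using subsetD[OF assms(3) that(1)] by (simp add: j compact_gens_def)
    show ?thesis
    proof (cases t)
      case PX
      then have "x' \<le> x" using max[OF that(1)] by (simp add: j xyz)
      moreover have "\<not> (x' = x \<and> y' = y \<and> z' = z)" using that(2) by (auto simp: j xyz PX)
      ultimately show ?thesis
        by (auto simp: j PX compact_gen_simps lookup_add lookup_Xop z' simp del: compact_gen.simps)
    next
      case PZ
      then show ?thesis
        by (simp add: j compact_gen_simps lookup_add lookup_Zop del: compact_gen.simps)
    qed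
  qed
  ultimately show ?thesis using i(1) by blast
next
  case False
  then have Z: "snd (snd j) = PZ" if "j \<in> F" for j using that by (cases "snd (snd j)") auto
  from ex_max_on[OF assms(1,2), of "\<lambda>i. - fst (fst i)"] obtain i
    where i: "i \<in> F" and "\<forall>j\<in>F. - fst (fst j) \<le> - fst (fst i)"
    by blast
  then have min: "fst (fst i) \<le> fst (fst j)" if "j \<in> F" for j using that by (meson neg_le_iff_le)
  obtain x y z t where xyz': "i = ((x, y), (z, t))" by (metis prod.collapse)
  with Z[OF i] have xyz: "i = ((x, y), (z, PZ))" by simp
  have "0 \<le> z" "z < int L" using subsetD[OF assms(3) i] by (simp_all add: xyz compact_gens_def)
  \<comment> \<open>The mirror image for Z-generators: with \<open>x\<close> minimal, this is the
    only first-qubit factor at \<open>x\<close>.\<close>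
  have "Poly_Mapping.lookup (compact_gen L i) (((x, y + 1), ((z + 1) mod int L, First)), PZ) \<noteq> 0"
    by (simp add: xyz compact_gen_simps lookup_add lookup_Zop del: compact_gen.simps)
  moreover have "Poly_Mapping.lookup (compact_gen L j) (((x, y + 1), ((z + 1) mod int L, First)), PZ) = 0"
    if "j \<in> F" "j \<noteq> i" for j
  proof -
    obtain x' y' z' t' where j': "j = ((x', y'), (z', t'))" by (metis prod.collapse)
    with Z[OF that(1)] have j: "j = ((x', y'), (z', PZ))" by simp
    have z': "0 \<le> z'" "z' < int L" using subsetD[OF assms(3) that(1)] by (simp_all add: j compact_gens_def)
    have "x \<le> x'" using min[OF that(1)] by (simp add: j xyz)
    moreover have "\<not> (x' = x \<and> y' = y \<and> (z' + 1) mod int L = (z + 1) mod int L)"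
    proof
      assume *: "x' = x \<and> y' = y \<and> (z' + 1) mod int L = (z + 1) mod int L"
      then have "(z' + 1 - 1) mod int L = (z + 1 - 1) mod int L" by (metis mod_diff_left_eq)
      then have "z' = z" using z' \<open>0 \<le> z\<close> \<open>z < int L\<close> by simp
      then show False using * that(2) by (simp add: j xyz)
    qed
    ultimately show ?thesis
      by (auto simp: j compact_gen_simps lookup_add lookup_Zop simp del: compact_gen.simps)
  qed
  ultimately show ?thesis using i by blast
qed

lemma local_generators_cubic:
  assumes "L \<ge> 1"
  shows "local_generators (compact_labels L) ({0..<int L} \<times> UNIV) (compact_gen L)"
proof
  show "finite (compact_labels L)"
  proof -
    have "(UNIV :: slot set) = {First, Second}" using slot.exhaust by auto
    then have "finite (UNIV :: slot set)" by (metis finite.emptyI finite_insert)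
    then show ?thesis by (simp add: compact_labels_def)
  qed
  show "finite ({0..<int L} \<times> (UNIV :: pauli_type set))" by simp
  fix u :: site and j :: "int \<times> pauli_type" assume "j \<in> {0..<int L} \<times> UNIV"
  obtain x y z t where uj: "u = (x, y)" "j = (z, t)" by (metis prod.collapse)
  have "0 \<le> c mod int L" "c mod int L < int L" for c using assms by simp_all
  then show "compact_gen L (u, j) \<in> paulis_on (UNIV \<times> compact_labels L)"
    unfolding uj by (cases t) (auto simp: compact_gen_simps compact_labels_def simp del: compact_gen.simps intro!: paulis_on_add)
  fix v :: site
  obtain a b where v: "v = (a, b)" by (metis prod.collapse)
  show "compact_gen L (u + v, j) = relabel (apfst ((+) v)) (compact_gen L (u, j))"
    unfolding uj v
    by (cases t) (simp_all add: compact_gen_simps relabel_add relabel_Xop relabel_Zop ac_simps del: compact_gen.simps)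
next
  fix B :: "site \<times> int \<times> pauli_type \<Rightarrow>\<^sub>0 bit"
  assume "Poly_Mapping.keys B \<subseteq> UNIV \<times> {0..<int L} \<times> UNIV" "combine (compact_gen L) B = 0"
  then show "B = 0"
    using independent_if_extremal[OF compact_gen_extremal] by (simp add: compact_gens_def)
qed

section \<open>Patterns of violated generators as Laurent polynomials\<close>

locale compact_cubic =
  fixes L :: nat assumes L: "L \<ge> 1"
begin

text \<open>
  The offsets of the Z-generators are those of the X-generators reflected, with the two qubits
  of a site exchanged and up to a common shift. Reflecting the patterns of X-generators therefore
  gives the same ideal for both types.
\<close>

definition orient :: "pauli_type \<Rightarrow> int" where "orient t = (if t = PX then - 1 else 1)"

lemma orient_orient [simp]: "orient t * (orient t * a) = a"
  by (simp add: orient_def)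

lemma orient_simps [simp]: "orient PX = - 1" "orient PZ = 1"
  by (simp_all add: orient_def)

text \<open>Wrapping the z exponent sends multiples of \<open>Z ^ L - 1\<close> to the zero pattern.
  \<open>of_pattern\<close> chooses one height for each generator: taken over both types it is an
  exact inverse on patterns, while on Laurent polynomials it is an inverse modulo the ideal.\<close>

definition to_pattern :: "pauli_type \<Rightarrow> laurent \<Rightarrow> (site \<times> (int \<times> pauli_type) \<Rightarrow>\<^sub>0 bit)" where
  "to_pattern t = combine (\<lambda>(a, b, c).
     Poly_Mapping.single ((orient t * a, orient t * b), (orient t * c mod int L, t)) 1)"

definition of_pattern :: "pauli_type \<Rightarrow> (site \<times> (int \<times> pauli_type) \<Rightarrow>\<^sub>0 bit) \<Rightarrow> laurent" where
  "of_pattern t = combine (\<lambda>((x, y), (z, t')). if t' = t then mon (orient t * x, orient t * y, orient t * z) else 0)"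

lemma to_pattern_add: "to_pattern t (r + s) = to_pattern t r + to_pattern t s"
  and of_pattern_add: "of_pattern t (A + B) = of_pattern t A + of_pattern t B"
  by (simp_all add: to_pattern_def of_pattern_def combine_add)

lemma to_pattern_zero [simp]: "to_pattern t 0 = 0"
  and of_pattern_zero [simp]: "of_pattern t 0 = 0"
  by (simp_all add: to_pattern_def of_pattern_def)

lemma to_pattern_mon: "to_pattern t (mon (a, b, c)) =
    Poly_Mapping.single ((orient t * a, orient t * b), (orient t * c mod int L, t)) 1"
  by (simp add: to_pattern_def mon_def)

lemma of_pattern_single: "of_pattern t (Poly_Mapping.single ((x, y), (z, t')) 1) =
    (if t' = t then mon (orient t * x, orient t * y, orient t * z) else 0)"
  by (simp add: of_pattern_def)

lemma mod_bounds: "0 \<le> c mod int L" "c mod int L < int L"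
  using L by simp_all

lemma keys_to_pattern: "Poly_Mapping.keys (to_pattern t r) \<subseteq> compact_gens L"
  unfolding to_pattern_def combine_def
  by (rule keys_sum_subset) (auto simp: compact_gens_def mod_bounds split: if_splits)

lemma mon_cong_nat: "mon (a, b, c) + mon (a, b, c + int L * int n) \<in> cubic_ideal L"
proof -
  have "(Z ^ L) ^ n - 1 = (Z ^ L - 1) * (\<Sum>i<n. (Z ^ L) ^ i)" by (rule power_diff_1_eq)
  then have "(Z ^ L) ^ n - 1 \<in> cubic_ideal L"
    by (metis cubic_ideal_generators(3) cubic_ideal_mult mult.commute)
  then have "mon (a, b, c) * ((Z ^ L) ^ n - 1) \<in> cubic_ideal L" by (rule cubic_ideal_mult)
  then show ?thesis by (simp add: pm_minus_eq_plus algebra_simps mon_power mon_mult)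
qed

lemma mon_cong:
  assumes "c mod int L = c' mod int L" shows "mon (a, b, c) + mon (a, b, c') \<in> cubic_ideal L"
proof -
  obtain k where k: "c' = c + int L * k"
    using assms by (metis mod_eq_dvd_iff dvdE add.commute diff_add_cancel)
  show ?thesis
  proof (cases "k \<ge> 0")
    case True
    then show ?thesis using mon_cong_nat[of a b c "nat k"] by (simp add: k)
  next
    case False
    then have "c = c' + int L * int (nat (- k))" by (simp add: k)
    then show ?thesis using mon_cong_nat[of a b c' "nat (- k)"] by (simp add: add.commute)
  qed
qed

lemma of_pattern_to_pattern: "of_pattern t (to_pattern t r) + r \<in> cubic_ideal L"
proof (induction r rule: laurent_induct)
  case (add k r)
  obtain a b c where k: "k = (a, b, c)" by (metis prod.collapse)
  have "(orient t * (orient t * c mod int L)) mod int L = c mod int L"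
    by (simp add: mod_mult_right_eq)
  then have "of_pattern t (to_pattern t (mon k)) + mon k \<in> cubic_ideal L"
    by (simp add: k to_pattern_mon of_pattern_single mon_cong)
  from cubic_ideal_add[OF this add] show ?case
    by (simp add: to_pattern_add of_pattern_add ac_simps)
qed simp

lemma of_pattern_to_pattern_other:
  assumes "t \<noteq> t'" shows "of_pattern t (to_pattern t' r) = 0"
proof (induction r rule: laurent_induct)
  case (add k r)
  obtain a b c where "k = (a, b, c)" by (metis prod.collapse)
  then show ?case using add assms by (simp add: to_pattern_add of_pattern_add to_pattern_mon of_pattern_single)
qed simp

lemma to_pattern_of_pattern:
  assumes "Poly_Mapping.keys A \<subseteq> compact_gens L"
  shows "to_pattern PX (of_pattern PX A) + to_pattern PZ (of_pattern PZ A) = A"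
  using assms
proof (induction rule: bit_pm_induct)
  case (add i A)
  obtain x y z t where i: "i = ((x, y), (z, t))" by (metis prod.collapse)
  have z: "z mod int L = z" using add(1) by (auto simp: i compact_gens_def)
  have "to_pattern PX (of_pattern PX (Poly_Mapping.single i 1)) +
      to_pattern PZ (of_pattern PZ (Poly_Mapping.single i 1)) = Poly_Mapping.single i 1"
    by (cases t) (simp_all add: i of_pattern_single to_pattern_mon z)
  moreover have "to_pattern PX (of_pattern PX (Poly_Mapping.single i 1 + A)) +
      to_pattern PZ (of_pattern PZ (Poly_Mapping.single i 1 + A)) =
      (to_pattern PX (of_pattern PX (Poly_Mapping.single i 1)) + to_pattern PZ (of_pattern PZ (Poly_Mapping.single i 1))) +
      (to_pattern PX (of_pattern PX A) + to_pattern PZ (of_pattern PZ A))"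
    by (simp only: of_pattern_add to_pattern_add ac_simps)
  ultimately show ?case using add(3) by simp
qed simp

lemma to_pattern_periodic: "to_pattern t ((Z ^ L - 1) * r) = 0"
proof (induction r rule: laurent_induct)
  case (add k r)
  obtain a b c where k: "k = (a, b, c)" by (metis prod.collapse)
  have "(Z ^ L - 1) * mon k = mon (a, b, c + int L) + mon (a, b, c)"
    by (simp add: k pm_minus_eq_plus distrib_right mon_power mon_mult add.commute)
  moreover have "orient t * (c + int L) mod int L = orient t * c mod int L"
    by (cases t) simp_all
  ultimately have "to_pattern t ((Z ^ L - 1) * mon k) = 0"
    by (simp add: to_pattern_add to_pattern_mon)
  then show ?case using add by (simp add: distrib_left to_pattern_add)
qed simp

abbreviation "F \<equiv> 1 + X + Y + Z"
abbreviation "G \<equiv> 1 + X * Y + Y * Z + Z * X"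

text \<open>A Pauli operator at p meets the generators at p minus an offset. For X-generators the
  reflection by \<open>orient\<close> turns this into the monomial of -p times the offsets. The
  offsets of Z-generators are (1,1,1) minus those in \<open>F\<close> and \<open>G\<close>, which
  gives p - (1,1,1) and exchanges the qubits.\<close>

definition single_qubit_pattern ::
    "int \<times> int \<times> int \<Rightarrow> slot \<Rightarrow> pauli_type \<Rightarrow> (site \<times> (int \<times> pauli_type) \<Rightarrow>\<^sub>0 bit)" where
  "single_qubit_pattern = (\<lambda>(x, y, z) s t.
     (if t = PZ then to_pattern PX (mon (- x, - y, - z) * (if s = First then G else F))
      else to_pattern PZ (mon (x - 1, y - 1, z - 1) * (if s = First then F else G))))"

lemma mod_shift_iff:
  assumes "0 \<le> z'" "z' < int L" shows "(z' + 1) mod int L = z mod int L \<longleftrightarrow> (z - 1) mod int L = z'"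
proof -
  have "(z' + 1) mod int L = z mod int L \<longleftrightarrow> int L dvd z' - (z - 1)"
    by (simp add: mod_eq_dvd_iff algebra_simps)
  also have "\<dots> \<longleftrightarrow> z' mod int L = (z - 1) mod int L" by (simp add: mod_eq_dvd_iff)
  finally show ?thesis using assms by auto
qed

lemma lookup_single_qubit_pattern:
  assumes "i \<in> compact_gens L"
  shows "Poly_Mapping.lookup (single_qubit_pattern (x, y, z) s t) i =
    anticomm (Poly_Mapping.single (((x, y), (z mod int L, s)), t) 1) (compact_gen L i)"
proof -
  obtain x' y' z' t' where i: "i = ((x', y'), (z', t'))" by (metis prod.collapse)
  have z': "0 \<le> z'" "z' < int L" using assms by (auto simp: i compact_gens_def)
  have z'_mod: "z' mod int L = z'" using z' by simp
  have single: "Poly_Mapping.lookup (Poly_Mapping.single k 1) k' = (of_bool (k = k') :: bit)"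
    for k k' :: "site \<times> (int \<times> pauli_type)"
    by (simp add: lookup_single when_def)
  note defs = single_qubit_pattern_def distrib_left mon_mult to_pattern_add to_pattern_mon lookup_add single
    compact_gen_simps anticomm_single_left lookup_Xop lookup_Zop
  note eqs = mod_shift_iff[OF z'] z'_mod
  show ?thesis
    by (cases s; cases t; cases t')
      (simp_all add: i defs eqs del: compact_gen.simps, auto simp: eqs)
qed

end

context compact_cubic
begin

lemma of_pattern_eq_0_if_to_pattern:
  "of_pattern PZ (to_pattern PX r) = 0" "of_pattern PX (to_pattern PZ r) = 0"
  by (simp_all add: of_pattern_to_pattern_other)

lemma of_pattern_to_pattern_in_ideal:
  assumes "r \<in> cubic_ideal L" shows "of_pattern t (to_pattern t' r) \<in> cubic_ideal L"
proof (cases "t = t'")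
  case True
  then show ?thesis
    using cubic_ideal_add[OF of_pattern_to_pattern[of t r] assms] by (simp add: add.assoc)
qed (simp add: of_pattern_to_pattern_other)

lemma single_qubit_pattern_in_ideal: "of_pattern t' (single_qubit_pattern (x, y, z) s t) \<in> cubic_ideal L"
proof -
  have "mon k * F \<in> cubic_ideal L" "mon k * G \<in> cubic_ideal L" for k
    by (intro cubic_ideal_mult cubic_ideal_generators)+
  then show ?thesis
    unfolding single_qubit_pattern_def prod.case
    by (cases t; cases s; simp only: if_True if_False pauli_type.distinct slot.distinct simp_thms)
      (intro of_pattern_to_pattern_in_ideal; assumption)+
qed

lemma keys_single_qubit_pattern: "Poly_Mapping.keys (single_qubit_pattern (x, y, z) s t) \<subseteq> compact_gens L"
  by (simp add: single_qubit_pattern_def keys_to_pattern)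

lemma single_qubit_pattern_created:
  "single_qubit_pattern (x, y, z) s t \<in> created_patterns (UNIV \<times> compact_labels L) (compact_gens L) (compact_gen L)"
proof (rule created_patterns_if_single_qubit)
  show "((x, y), (z mod int L, s)) \<in> UNIV \<times> compact_labels L"
    by (simp add: compact_labels_def mod_bounds)
qed (rule keys_single_qubit_pattern lookup_single_qubit_pattern)+

text \<open>Monomial multiples of \<open>F\<close> and \<open>G\<close> are patterns of a single
  Pauli operator on one of the two qubits of a site, and multiples of \<open>Z ^ L - 1\<close> give
  the zero pattern.\<close>

lemma to_pattern_created:
  assumes "r \<in> cubic_ideal L"
  shows "to_pattern t r \<in> created_patterns (UNIV \<times> compact_labels L) (compact_gens L) (compact_gen L)"
    (is "_ \<in> ?C")
proof -
  have C0: "0 \<in> ?C" and C_add: "\<And>A B. A \<in> ?C \<Longrightarrow> B \<in> ?C \<Longrightarrow> A + B \<in> ?C"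
    using additive_subgroup_created_patterns[of "UNIV \<times> compact_labels L" "compact_gens L" "compact_gen L"]
    by (auto simp: additive_subgroup_def)
  have mon: "to_pattern t (mon k * F) \<in> ?C \<and> to_pattern t (mon k * G) \<in> ?C" for k
  proof -
    obtain a b c where k: "k = (a, b, c)" by (metis prod.collapse)
    show ?thesis
    proof (cases t)
      case PX
      then show ?thesis
        using single_qubit_pattern_created[of "- a" "- b" "- c" First PZ]
          single_qubit_pattern_created[of "- a" "- b" "- c" Second PZ]
        by (simp add: single_qubit_pattern_def k)
    next
      case PZ
      then show ?thesis
        \<comment> \<open>Adding 1 to each coordinate undoes the shift by (1,1,1).\<close>
        using single_qubit_pattern_created[of "a + 1" "b + 1" "c + 1" First PX]
          single_qubit_pattern_created[of "a + 1" "b + 1" "c + 1" Second PX]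
        by (simp add: single_qubit_pattern_def k)
    qed
  qed
  have "to_pattern t (F * u) \<in> ?C" for u
  proof (induction u rule: laurent_induct)
    case (add k u)
    then show ?case
      using C_add[OF conjunct1[OF mon[of k]] add] by (simp add: distrib_left to_pattern_add mult.commute[of _ "mon k"])
  qed (simp add: C0)
  moreover have "to_pattern t (G * u) \<in> ?C" for u
  proof (induction u rule: laurent_induct)
    case (add k u)
    then show ?case
      using C_add[OF conjunct2[OF mon[of k]] add] by (simp add: distrib_left to_pattern_add mult.commute[of _ "mon k"])
  qed (simp add: C0)
  moreover obtain u v w where "r = F * u + G * v + (Z ^ L - 1) * w"
    using assms unfolding cubic_ideal_def by blast
  ultimately show ?thesis by (simp only: to_pattern_add to_pattern_periodic add_0_right C_add)
qed

text \<open>Necessity is checked on single qubits. For sufficiency, \<open>A\<close> is rebuilt from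
  its two polynomials, each of which yields a created pattern.\<close>

lemma created_patterns_iff:
  assumes "Poly_Mapping.keys A \<subseteq> compact_gens L"
  shows "A \<in> created_patterns (UNIV \<times> compact_labels L) (compact_gens L) (compact_gen L) \<longleftrightarrow>
    of_pattern PX A \<in> cubic_ideal L \<and> of_pattern PZ A \<in> cubic_ideal L"
proof
  let ?H = "{A. of_pattern PX A \<in> cubic_ideal L \<and> of_pattern PZ A \<in> cubic_ideal L}"
  have "created_patterns (UNIV \<times> compact_labels L) (compact_gens L) (compact_gen L) \<subseteq> ?H"
  proof (rule created_patterns_subset)
    show "additive_subgroup ?H"
      by (simp add: additive_subgroup_def of_pattern_add cubic_ideal_add)
    fix q :: "site \<times> (int \<times> slot)" and t
    assume "q \<in> UNIV \<times> compact_labels L"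
    moreover obtain x y z s where q: "q = ((x, y), (z, s))" by (metis prod.collapse)
    ultimately have "z mod int L = z" by (simp add: compact_labels_def)
    then have "\<forall>i\<in>compact_gens L. Poly_Mapping.lookup (single_qubit_pattern (x, y, z) s t) i =
        anticomm (Poly_Mapping.single (q, t) 1) (compact_gen L i)"
      using lookup_single_qubit_pattern[of _ x y z s t] by (simp add: q)
    then show "\<exists>A\<in>?H. Poly_Mapping.keys A \<subseteq> compact_gens L \<and> (\<forall>i\<in>compact_gens L.
        Poly_Mapping.lookup A i = anticomm (Poly_Mapping.single (q, t) 1) (compact_gen L i))"
      using keys_single_qubit_pattern single_qubit_pattern_in_ideal
      by (intro bexI[of _ "single_qubit_pattern (x, y, z) s t"]) simp_all
  qed
  then show "of_pattern PX A \<in> cubic_ideal L \<and> of_pattern PZ A \<in> cubic_ideal L"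
    if "A \<in> created_patterns (UNIV \<times> compact_labels L) (compact_gens L) (compact_gen L)"
    using that by blast
next
  assume "of_pattern PX A \<in> cubic_ideal L \<and> of_pattern PZ A \<in> cubic_ideal L"
  then have "to_pattern PX (of_pattern PX A) + to_pattern PZ (of_pattern PZ A) \<in>
      created_patterns (UNIV \<times> compact_labels L) (compact_gens L) (compact_gen L)"
    using additive_subgroup_created_patterns to_pattern_created unfolding additive_subgroup_def by blast
  then show "A \<in> created_patterns (UNIV \<times> compact_labels L) (compact_gens L) (compact_gen L)"
    by (simp add: to_pattern_of_pattern[OF assms])
qed

text \<open>The normal forms for the two types can be prescribed independently, hence the
  square.\<close>

lemma order_compact_cubic_anyons_eq_square:
  assumes nf: "\<And>r r'. nf r = nf r' \<longleftrightarrow> r + r' \<in> cubic_ideal L"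
  shows "order (compact_cubic_anyons L) = card (range nf) * card (range nf)"
proof -
  let ?f = "\<lambda>A. (nf (of_pattern PX A), nf (of_pattern PZ A))"
  have "order (compact_cubic_anyons L) = card (?f ` {A. Poly_Mapping.keys A \<subseteq> compact_gens L})"
    unfolding compact_cubic_anyons_def
  proof (rule order_anyon_group_eq_card)
    fix A B :: "site \<times> (int \<times> pauli_type) \<Rightarrow>\<^sub>0 bit"
    assume AB: "Poly_Mapping.keys A \<subseteq> compact_gens L" "Poly_Mapping.keys B \<subseteq> compact_gens L"
    show "?f A = ?f B \<longleftrightarrow>
        A + B \<in> created_patterns (UNIV \<times> compact_labels L) (compact_gens L) (compact_gen L)"
      by (simp add: created_patterns_iff keys_add_subset AB nf of_pattern_add)
  qed
  also have "?f ` {A. Poly_Mapping.keys A \<subseteq> compact_gens L} = range nf \<times> range nf"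
  proof (rule subset_antisym)
    show "?f ` {A. Poly_Mapping.keys A \<subseteq> compact_gens L} \<subseteq> range nf \<times> range nf" by blast
    show "range nf \<times> range nf \<subseteq> ?f ` {A. Poly_Mapping.keys A \<subseteq> compact_gens L}"
    proof
      fix p assume "p \<in> range nf \<times> range nf"
      then obtain r r' where p: "p = (nf r, nf r')" by blast
      define A where "A = to_pattern PX r + to_pattern PZ r'"
      have "nf (of_pattern PX A) = nf r" "nf (of_pattern PZ A) = nf r'"
        by (simp_all add: nf A_def of_pattern_add of_pattern_eq_0_if_to_pattern of_pattern_to_pattern)
      moreover have "Poly_Mapping.keys A \<subseteq> compact_gens L"
        unfolding A_def by (intro keys_add_subset keys_to_pattern)
      ultimately show "p \<in> ?f ` {A. Poly_Mapping.keys A \<subseteq> compact_gens L}"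
        unfolding p by (intro image_eqI[of _ _ A]) simp_all
    qed
  qed
  finally show ?thesis by (simp add: card_cartesian_product)
qed

end

lemma order_compact_cubic_anyons:
  fixes L i l :: nat
  assumes "L \<ge> 1" "L = 2 ^ i * l" "odd l"
  shows "order (compact_cubic_anyons L) = 4 ^ (if 3 dvd L then 2 * L - 2 ^ (i + 2) else 2 * L)"
proof -
  interpret compact_cubic L by standard (rule assms(1))
  obtain nf :: "laurent \<Rightarrow> bit poly \<times> bit poly" where "\<And>t t'. nf t = nf t' \<longleftrightarrow> t + t' \<in> cubic_ideal L"
    and card: "card (range nf) = 2 ^ (if 3 dvd L then 2 * L - 2 ^ (i + 2) else 2 * L)"
    using ex_cubic_normal_form[OF assms] by blast
  then have "order (compact_cubic_anyons L) = card (range nf) * card (range nf)"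
    by (intro order_compact_cubic_anyons_eq_square)
  moreover have "(2 :: nat) ^ k * 2 ^ k = 4 ^ k" for k
    by (simp flip: power_mult_distrib)
  ultimately show ?thesis by (simp only: card)
qed

section \<open>Anyons of the toric code\<close>

lemma UNIV_edge: "(UNIV :: edge set) = {Horiz, Vert}"
  using edge.exhaust by auto

lemma UNIV_pauli_type: "(UNIV :: pauli_type set) = {PX, PZ}"
  using pauli_type.exhaust by auto

lemma toric_gen_extremal:
  assumes "finite F" "F \<noteq> {}"
  shows "\<exists>i\<in>F. \<exists>k. Poly_Mapping.lookup (toric_gen i) k \<noteq> 0 \<and>
    (\<forall>j\<in>F. j \<noteq> i \<longrightarrow> Poly_Mapping.lookup (toric_gen j) k = 0)"
proof (cases "\<exists>i\<in>F. snd (snd i) = PX")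
  case True
  let ?G = "{i\<in>F. snd (snd i) = PX}"
  have "finite ?G" using assms(1) by simp
  moreover have "?G \<noteq> {}" using True by blast
  ultimately have "\<exists>i\<in>?G. \<forall>j\<in>?G. - fst (fst j) \<le> - fst (fst i)" by (rule ex_max_on)
  then obtain i where i: "i \<in> F" "snd (snd i) = PX"
    and "\<And>j. j \<in> F \<Longrightarrow> snd (snd j) = PX \<Longrightarrow> - fst (fst j) \<le> - fst (fst i)"
    by blast
  then have min: "fst (fst i) \<le> fst (fst j)" if "j \<in> F" "snd (snd j) = PX" for j
    using that by (meson neg_le_iff_le)
  obtain x y c t where i': "i = ((x, y), (c, t))" by (metis prod.collapse)
  with i(2) have i_eq: "i = ((x, y), (c, PX))" by simp
  \<comment> \<open>With \<open>x\<close> minimal, no other X-generator contains its left horizontal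
    edge.\<close>
  have "Poly_Mapping.lookup (toric_gen i) (((x - 1, y), (c, Horiz)), PX) \<noteq> 0"
    by (simp add: i_eq lookup_add lookup_Xop)
  moreover have "Poly_Mapping.lookup (toric_gen j) (((x - 1, y), (c, Horiz)), PX) = 0"
    if "j \<in> F" "j \<noteq> i" for j
  proof -
    obtain x' y' c' t' where j: "j = ((x', y'), (c', t'))" by (metis prod.collapse)
    show ?thesis
    proof (cases t')
      case PX
      then have "x \<le> x'" using min[OF that(1)] by (simp add: j i_eq)
      then show ?thesis using that(2) by (auto simp: j i_eq PX lookup_add lookup_Xop)
    next
      case PZ
      then show ?thesis by (simp add: j lookup_add lookup_Zop)
    qed
  qed
  ultimately show ?thesis using i(1) by blast
next
  case False
  then have Z: "snd (snd j) = PZ" if "j \<in> F" for j using that by (cases "snd (snd j)") auto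
  from ex_max_on[OF assms, of "\<lambda>i. snd (fst i)"] obtain i
    where i: "i \<in> F" and max: "\<And>j. j \<in> F \<Longrightarrow> snd (fst j) \<le> snd (fst i)" by blast
  obtain x y c t where i': "i = ((x, y), (c, t))" by (metis prod.collapse)
  with Z[OF i] have i_eq: "i = ((x, y), (c, PZ))" by simp
  \<comment> \<open>With \<open>y\<close> maximal, no other Z-generator contains its upper
    horizontal edge.\<close>
  have "Poly_Mapping.lookup (toric_gen i) (((x, y + 1), (c, Horiz)), PZ) \<noteq> 0"
    by (simp add: i_eq lookup_add lookup_Zop)
  moreover have "Poly_Mapping.lookup (toric_gen j) (((x, y + 1), (c, Horiz)), PZ) = 0"
    if "j \<in> F" "j \<noteq> i" for j
  proof -
    obtain x' y' c' t' where j': "j = ((x', y'), (c', t'))" by (metis prod.collapse)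
    with Z[OF that(1)] have j: "j = ((x', y'), (c', PZ))" by simp
    have "y' \<le> y" using max[OF that(1)] by (simp add: j i_eq)
    then show ?thesis using that(2) by (auto simp: j i_eq lookup_add lookup_Zop)
  qed
  ultimately show ?thesis using i by blast
qed

lemma local_generators_toric:
  "local_generators ({..<n} \<times> UNIV) ({..<n} \<times> UNIV) toric_gen"
proof
  show "finite ({..<n} \<times> (UNIV :: edge set))" by (simp add: UNIV_edge)
  show "finite ({..<n} \<times> (UNIV :: pauli_type set))" by simp
  fix u v :: site and j :: "nat \<times> pauli_type" assume "j \<in> {..<n} \<times> UNIV"
  moreover obtain x y c t a b where uj: "u = (x, y)" "j = (c, t)" "v = (a, b)" by (metis prod.collapse)
  ultimately show "toric_gen (u, j) \<in> paulis_on (UNIV \<times> ({..<n} \<times> UNIV))"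
    by (cases t) (auto intro!: paulis_on_add)
  show "toric_gen (u + v, j) = relabel (apfst ((+) v)) (toric_gen (u, j))"
    unfolding uj by (cases t) (simp_all add: relabel_add relabel_Xop relabel_Zop algebra_simps)
next
  fix B :: "site \<times> nat \<times> pauli_type \<Rightarrow>\<^sub>0 bit"
  assume "Poly_Mapping.keys B \<subseteq> UNIV \<times> {..<n} \<times> UNIV" "combine toric_gen B = 0"
  then show "B = 0"
    using independent_if_extremal[of "UNIV \<times> {..<n} \<times> UNIV" toric_gen B] toric_gen_extremal by blast
qed

lemma card_pm_keys_subset:
  assumes "finite S" shows "card {B :: 'a \<Rightarrow>\<^sub>0 bit. Poly_Mapping.keys B \<subseteq> S} = 2 ^ card S"
proof -
  have "bij_betw (\<lambda>F. \<Sum>k\<in>F. Poly_Mapping.single k (1 :: bit)) (Pow S) {B. Poly_Mapping.keys B \<subseteq> S}"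
  proof (rule bij_betw_byWitness[where f' = Poly_Mapping.keys])
    have lookup: "Poly_Mapping.lookup (\<Sum>k\<in>F. Poly_Mapping.single k (1 :: bit)) i = of_bool (i \<in> F)"
      if "finite F" for F :: "'a set" and i
      using that by (simp add: lookup_sum lookup_single when_def)
    then have keys: "Poly_Mapping.keys (\<Sum>k\<in>F. Poly_Mapping.single k (1 :: bit)) = F"
      if "finite F" for F :: "'a set" using that by (auto simp: in_keys_iff)
    show "\<forall>F\<in>Pow S. Poly_Mapping.keys (\<Sum>k\<in>F. Poly_Mapping.single k (1 :: bit)) = F"
      using assms finite_subset keys by (metis PowD)
    show "\<forall>B\<in>{B. Poly_Mapping.keys B \<subseteq> S}. (\<Sum>k\<in>Poly_Mapping.keys B. Poly_Mapping.single k (1 :: bit)) = B"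
    proof (intro ballI poly_mapping_eqI)
      fix B :: "'a \<Rightarrow>\<^sub>0 bit" and k
      show "Poly_Mapping.lookup (\<Sum>k\<in>Poly_Mapping.keys B. Poly_Mapping.single k 1) k = Poly_Mapping.lookup B k"
        by (simp add: lookup in_keys_iff)
    qed
    show "(\<lambda>F. \<Sum>k\<in>F. Poly_Mapping.single k (1 :: bit)) ` Pow S \<subseteq> {B. Poly_Mapping.keys B \<subseteq> S}"
      using assms finite_subset keys by (metis (no_types, lifting) PowD image_subsetI mem_Collect_eq)
    show "Poly_Mapping.keys ` {B :: 'a \<Rightarrow>\<^sub>0 bit. Poly_Mapping.keys B \<subseteq> S} \<subseteq> Pow S" by blast
  qed
  then have "card (Pow S) = card {B :: 'a \<Rightarrow>\<^sub>0 bit. Poly_Mapping.keys B \<subseteq> S}" by (rule bij_betw_same_card)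
  then show ?thesis using assms by (simp add: card_Pow)
qed

lemma int_shift_induct:
  fixes x :: int
  assumes "R 0" "\<And>x. R x \<longleftrightarrow> R (x + 1)" shows "R x"
proof (induction x rule: int_induct[of _ 0])
  case (step2 i)
  then show ?case using assms(2)[of "i - 1"] by simp
qed (use assms in auto)

text \<open>The parity of violated generators for each copy and type, that is, the electric and
  magnetic charge of each toric code.\<close>

definition total_charge :: "(site \<times> (nat \<times> pauli_type) \<Rightarrow>\<^sub>0 bit) \<Rightarrow> (nat \<times> pauli_type \<Rightarrow>\<^sub>0 bit)" where
  "total_charge = combine (\<lambda>(u, j). Poly_Mapping.single j 1)"

lemma total_charge_add: "total_charge (A + B) = total_charge A + total_charge B"
  by (simp add: total_charge_def combine_add)

lemma total_charge_single: "total_charge (Poly_Mapping.single (u, j) 1) = Poly_Mapping.single j 1"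
  by (simp add: total_charge_def)

text \<open>A single Pauli operator violates two generators of the same copy and type, so parities
  are conserved. Conversely, strings carry all excitations to the origin, where equal ones
  annihilate and only the total charge is left.\<close>

lemma created_toric_patterns_iff:
  assumes "Poly_Mapping.keys A \<subseteq> UNIV \<times> ({..<n} \<times> UNIV)"
  shows "A \<in> created_patterns (UNIV \<times> ({..<n} \<times> UNIV)) (UNIV \<times> ({..<n} \<times> UNIV)) toric_gen \<longleftrightarrow>
    total_charge A = 0"
proof -
  let ?I = "UNIV \<times> ({..<n} \<times> UNIV) :: (site \<times> (nat \<times> pauli_type)) set"
  let ?Q = "UNIV \<times> ({..<n} \<times> UNIV) :: (site \<times> (nat \<times> edge)) set"
  let ?C = "created_patterns ?Q ?I toric_gen"
  \<comment> \<open>The two generators that a Pauli operator on the edge violates: the adjacent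
    plaquettes for X, the end points for Z.\<close>
  define pair :: "site \<times> (nat \<times> edge) \<Rightarrow> pauli_type \<Rightarrow> site \<times> site" where
    "pair = (\<lambda>((x, y), (c, e)) t. ((x, y), case (e, t) of
       (Horiz, PX) \<Rightarrow> (x, y - 1) | (Vert, PX) \<Rightarrow> (x - 1, y) | (Horiz, PZ) \<Rightarrow> (x + 1, y) | (Vert, PZ) \<Rightarrow> (x, y + 1)))"
  define dual where "dual t = (if t = PX then PZ else PX)" for t
  define string where "string q t = Poly_Mapping.single (fst (pair q t), (fst (snd q), dual t)) (1 :: bit) +
     Poly_Mapping.single (snd (pair q t), (fst (snd q), dual t)) 1" for q t
  have lookup_string: "Poly_Mapping.lookup (string q t) i = anticomm (Poly_Mapping.single (q, t) 1) (toric_gen i)" for q t i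
  proof -
    obtain x y c e x' y' c' t' where q: "q = ((x, y), (c, e))" and i: "i = ((x', y'), (c', t'))"
      by (metis prod.collapse)
    have single: "Poly_Mapping.lookup (Poly_Mapping.single k 1) k' = (of_bool (k = k') :: bit)"
      for k k' :: "site \<times> (nat \<times> pauli_type)"
      by (simp add: lookup_single when_def)
    show ?thesis
      by (cases t; cases t'; cases e)
        (auto simp: q i string_def pair_def dual_def lookup_add single anticomm_single_left lookup_Xop lookup_Zop)
  qed
  have keys_string: "Poly_Mapping.keys (string q t) \<subseteq> ?I" if "q \<in> ?Q" for q t
    unfolding string_def using that by (intro keys_add_subset) auto
  have string_created: "string q t \<in> ?C" if "q \<in> ?Q" for q t
    using that keys_string[OF that] lookup_string by (rule created_patterns_if_single_qubit)
  have string_charge: "total_charge (string q t) = 0" for q t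
    by (simp add: string_def total_charge_add total_charge_single)
  have C0: "0 \<in> ?C" and C_add: "\<And>A B. A \<in> ?C \<Longrightarrow> B \<in> ?C \<Longrightarrow> A + B \<in> ?C"
    using additive_subgroup_created_patterns[of ?Q ?I toric_gen] by (auto simp: additive_subgroup_def)
  have "total_charge A = 0" if "A \<in> ?C" for A
  proof -
    have "?C \<subseteq> {A. total_charge A = 0}"
    proof (rule created_patterns_subset)
      show "additive_subgroup {A. total_charge A = 0}"
        by (simp add: additive_subgroup_def total_charge_add) (simp add: total_charge_def)
      show "\<exists>A\<in>{A. total_charge A = 0}. Poly_Mapping.keys A \<subseteq> ?I \<and>
          (\<forall>i\<in>?I. Poly_Mapping.lookup A i = anticomm (Poly_Mapping.single (q, t) 1) (toric_gen i))"
        if "q \<in> ?Q" for q t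
        using string_charge keys_string[OF that] lookup_string by (intro bexI[of _ "string q t"]) simp_all
    qed
    then show ?thesis using that by blast
  qed
  moreover have "A \<in> ?C" if "total_charge A = 0"
  proof -
    \<comment> \<open>An excitation at \<open>u\<close> together with one at the origin; that this
      pattern is created means that the excitation can be carried to the origin.\<close>
    define move where "move u j = Poly_Mapping.single (u, j) 1 + Poly_Mapping.single ((0, 0), j) (1 :: bit)"
      for u :: site and j :: "nat \<times> pauli_type"
    have move: "move u j \<in> ?C" if "j \<in> {..<n} \<times> UNIV" for u j
    proof -
      obtain x y c t where uj: "u = (x, y)" "j = (c, t)" by (metis prod.collapse)
      have c: "((x, y), (c, e)) \<in> ?Q" for x y e using that by (simp add: uj)
      have chain: "move v j \<in> ?C \<longleftrightarrow> move v' j \<in> ?C"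
        if "Poly_Mapping.single (v, j) 1 + Poly_Mapping.single (v', j) 1 \<in> ?C" for v v'
      proof -
        have "move v j = (Poly_Mapping.single (v, j) 1 + Poly_Mapping.single (v', j) 1) + move v' j"
          "move v' j = (Poly_Mapping.single (v, j) 1 + Poly_Mapping.single (v', j) 1) + move v j"
          by (simp_all add: move_def ac_simps)
        then show ?thesis using C_add[OF that] by metis
      qed
      \<comment> \<open>One Pauli operator moves an excitation by one lattice step: Z on the edge
        between two vertices, X on the edge between two plaquettes.\<close>
      have X: "Poly_Mapping.single ((x, y), j) 1 + Poly_Mapping.single ((x + 1, y), j) 1 \<in> ?C" for x y
        using string_created[OF c[of x y Horiz], of PZ] string_created[OF c[of "x + 1" y Vert], of PX]
        by (cases t) (simp_all add: string_def pair_def dual_def uj add.commute)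
      have Y: "Poly_Mapping.single ((x, y), j) 1 + Poly_Mapping.single ((x, y + 1), j) 1 \<in> ?C" for x y
        using string_created[OF c[of x y Vert], of PZ] string_created[OF c[of x "y + 1" Horiz], of PX]
        by (cases t) (simp_all add: string_def pair_def dual_def uj add.commute)
      have "move (x, 0) j \<in> ?C" for x
      proof (rule int_shift_induct[where x = x])
        show "move (0, 0) j \<in> ?C" using C0 by (simp add: move_def)
      qed (rule chain[OF X])
      then have "move (x, y) j \<in> ?C" for x y
        by (rule int_shift_induct[where x = y]) (rule chain[OF Y])
      then show ?thesis by (simp add: uj)
    qed
    \<comment> \<open>Gathers a total charge at the origin.\<close>
    define embed where "embed = combine (\<lambda>j. Poly_Mapping.single ((0, 0) :: site, j :: nat \<times> pauli_type) 1)"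
    have "A + embed (total_charge A) \<in> ?C"
      using assms
    proof (induction rule: bit_pm_induct)
      case zero
      then show ?case using C0 by (simp add: total_charge_def embed_def)
    next
      case (add i A)
      obtain u j where i: "i = (u, j)" by (rule prod.exhaust)
      have eq: "Poly_Mapping.single i 1 + A + embed (total_charge (Poly_Mapping.single i 1 + A)) =
          move u j + (A + embed (total_charge A))"
        by (simp add: i total_charge_add total_charge_single embed_def combine_add move_def ac_simps)
      have "move u j \<in> ?C" using add(1) by (intro move) (simp add: i)
      then show ?case unfolding eq using add(3) by (rule C_add)
    qed
    then show ?thesis using that by (simp add: embed_def)
  qed
  ultimately show ?thesis by blast
qed

lemma order_toric_anyons:
  "order (anyon_group (UNIV \<times> ({..<n} \<times> UNIV)) (UNIV \<times> ({..<n} \<times> UNIV)) toric_gen) = 4 ^ n"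
proof -
  let ?I = "UNIV \<times> ({..<n} \<times> UNIV) :: (site \<times> (nat \<times> pauli_type)) set"
  have "order (anyon_group (UNIV \<times> ({..<n} \<times> UNIV)) ?I toric_gen) =
      card (total_charge ` {A. Poly_Mapping.keys A \<subseteq> ?I})"
  proof (rule order_anyon_group_eq_card)
    fix A B :: "site \<times> (nat \<times> pauli_type) \<Rightarrow>\<^sub>0 bit"
    assume AB: "Poly_Mapping.keys A \<subseteq> ?I" "Poly_Mapping.keys B \<subseteq> ?I"
    show "total_charge A = total_charge B \<longleftrightarrow>
        A + B \<in> created_patterns (UNIV \<times> ({..<n} \<times> UNIV)) ?I toric_gen"
      by (simp add: created_toric_patterns_iff keys_add_subset[OF AB] total_charge_add pm_add_eq_0_iff)
  qed
  also have "total_charge ` {A. Poly_Mapping.keys A \<subseteq> ?I} = {B. Poly_Mapping.keys B \<subseteq> {..<n} \<times> UNIV}"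
  proof (rule subset_antisym)
    show "total_charge ` {A. Poly_Mapping.keys A \<subseteq> ?I} \<subseteq> {B. Poly_Mapping.keys B \<subseteq> {..<n} \<times> UNIV}"
    proof (intro image_subsetI CollectI)
      fix A :: "site \<times> (nat \<times> pauli_type) \<Rightarrow>\<^sub>0 bit"
      assume "A \<in> {A. Poly_Mapping.keys A \<subseteq> ?I}"
      then show "Poly_Mapping.keys (total_charge A) \<subseteq> {..<n} \<times> UNIV"
        unfolding total_charge_def combine_def by (intro keys_sum_subset) auto
    qed
    show "{B. Poly_Mapping.keys B \<subseteq> {..<n} \<times> UNIV} \<subseteq> total_charge ` {A. Poly_Mapping.keys A \<subseteq> ?I}"
    proof
      fix B :: "nat \<times> pauli_type \<Rightarrow>\<^sub>0 bit" assume "B \<in> {B. Poly_Mapping.keys B \<subseteq> {..<n} \<times> UNIV}"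
      then have "Poly_Mapping.keys B \<subseteq> {..<n} \<times> UNIV" by simp
      then have "\<exists>A. Poly_Mapping.keys A \<subseteq> ?I \<and> total_charge A = B"
      proof (induction rule: bit_pm_induct)
        case zero
        show ?case by (rule exI[of _ 0]) (simp add: total_charge_def)
      next
        case (add j B)
        then obtain A where A: "Poly_Mapping.keys A \<subseteq> ?I" "total_charge A = B" by blast
        have "Poly_Mapping.keys (Poly_Mapping.single ((0, 0), j) 1 + A) \<subseteq> ?I"
          using A(1) add(1) by (intro keys_add_subset) auto
        then show ?case
          using A(2) by (intro exI[of _ "Poly_Mapping.single ((0, 0), j) 1 + A"])
            (simp add: total_charge_add total_charge_single)
      qed
      then show "B \<in> total_charge ` {A. Poly_Mapping.keys A \<subseteq> ?I}" by blast
    qed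
  qed
  also have "card {B :: nat \<times> pauli_type \<Rightarrow>\<^sub>0 bit. Poly_Mapping.keys B \<subseteq> {..<n} \<times> UNIV} = 2 ^ (n * 2)"
  proof -
    have "card ({..<n} \<times> (UNIV :: pauli_type set)) = n * 2"
      by (simp add: UNIV_pauli_type card_cartesian_product)
    then show ?thesis using card_pm_keys_subset[of "{..<n} \<times> (UNIV :: pauli_type set)"] by simp
  qed
  also have "(2 :: nat) ^ (n * 2) = 4 ^ n" by (simp only: mult.commute[of n] power_mult) simp
  finally show ?thesis .
qed

section \<open>The number of toric codes\<close>

text \<open>Coarse-graining, the ancillas on both sides and the circuit each preserve the number of
  sectors; the chain ends at the toric codes, whose anyons are counted.\<close>

lemma num_toric_copies:
  assumes "equivalent_to_toric_copies C n" "stab C \<subseteq> paulis_on (UNIV \<times> labels C)" "additive_subgroup (stab C)"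
  shows "num_sectors (labels C) (stab C) = 4 ^ n"
proof -
  obtain a b p q where ab: "a > 0" "b > 0"
    and equiv: "circuit_equivalent (tensor_code (coarsen a b C) (trivial_code p))
      (tensor_code (toric_copies n) (trivial_code q))"
    using assms(1) unfolding equivalent_to_toric_copies_def by blast
  let ?D = "coarsen a b C"
  have D: "stab ?D \<subseteq> paulis_on (UNIV \<times> labels ?D)" using ab assms(2) by (rule stab_coarsen_subset)
  have "additive_subgroup (stab ?D)"
    using assms(3) unfolding additive_subgroup_def coarsen_def
    by (auto simp flip: relabel_add) (metis imageI relabel_zero)
  note tensor_D = num_sectors_tensor_trivial[OF D this]
  interpret toric: local_generators "{..<n} \<times> UNIV" "{..<n} \<times> UNIV" toric_gen
    by (rule local_generators_toric)
  let ?T = "toric_copies n"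
  have T: "labels ?T = {..<n} \<times> UNIV" "stab ?T = toric.S"
    by (simp_all add: toric_copies_def toric.S_def toric.gens_def)
  have tensor_T: "num_sectors (labels (tensor_code ?T (trivial_code q))) (stab (tensor_code ?T (trivial_code q))) =
      num_sectors (labels ?T) (stab ?T)"
    by (rule num_sectors_tensor_trivial) (simp_all add: T toric.S_subset toric.S_subgroup)
  have "stab (tensor_code ?D (trivial_code p)) \<subseteq> paulis_on (UNIV \<times> labels (tensor_code ?D (trivial_code p)))"
    using D by (rule stab_tensor_trivial_subset)
  from num_sectors_circuit_equivalent[OF equiv this]
  have "num_sectors (labels C) (stab C) = num_sectors ({..<n} \<times> UNIV) toric.S"
    using tensor_D tensor_T num_sectors_coarsen[OF ab assms(2)] by (simp add: T)
  also have "\<dots> = 4 ^ n"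
    unfolding toric.num_sectors_eq_order_anyon_group toric.gens_def by (rule order_toric_anyons)
  finally show ?thesis .
qed

theorem mainTheorem1:
  fixes L i l :: nat
  assumes "L \<ge> 1" and "L = 2 ^ i * l" and "odd l"
  shows "let N = (if 3 dvd L then 2 * L - 2 ^ (i + 2) else 2 * L) in
    (\<forall>n. equivalent_to_toric_copies (compact_cubic_code L) n \<longrightarrow> n = N) \<and>
    order (compact_cubic_anyons L) = 4 ^ N"
proof -
  define N where "N = (if 3 dvd L then 2 * L - 2 ^ (i + 2) else 2 * L)"
  have order: "order (compact_cubic_anyons L) = 4 ^ N"
    unfolding N_def by (rule order_compact_cubic_anyons[OF assms])
  interpret cubic: local_generators "compact_labels L" "{0..<int L} \<times> UNIV" "compact_gen L"
    using assms(1) by (rule local_generators_cubic)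
  have gens: "cubic.gens = compact_gens L" by (simp add: cubic.gens_def compact_gens_def)
  have code: "labels (compact_cubic_code L) = compact_labels L" "stab (compact_cubic_code L) = cubic.S"
    by (simp_all add: compact_cubic_code_def cubic.S_def gens)
  have "n = N" if "equivalent_to_toric_copies (compact_cubic_code L) n" for n
  proof -
    \<comment> \<open>The same sectors are counted twice: through the equivalence with toric codes
      and through the patterns of the cubic code.\<close>
    have "num_sectors (compact_labels L) cubic.S = 4 ^ n"
      using num_toric_copies[OF that] by (simp add: code cubic.S_subset cubic.S_subgroup)
    also have "num_sectors (compact_labels L) cubic.S = 4 ^ N"
      unfolding cubic.num_sectors_eq_order_anyon_group gens order[symmetric] compact_cubic_anyons_def ..
    finally show ?thesis by simp
  qed
  then show ?thesis using order by (simp add: N_def)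
qed

end
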